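(* Let $S_1,\dots,S_k$ be similarity transformations of $\mathbb R^D$, $S_i$ having ratio $0<r_i<1$, and let $K$ be their attractor. Suppose that the Open Set Condition is satisfied and let $\delta=\dim(K)$ be the Hausdorff dimension of $K$, which is the unique positive solution of $\sum_{i=1}^kr_i^\delta=1$. Let $(p_1,\dots,p_k)$ be a probability vector with $p_i>0$ for all $i$, and let $m$ be the self-similar probability measure such that $m=\sum_{i=1}^kp_i\,m\circ S_i^{-1}$. Set $$d=\frac{\sum_{i=1}^kp_i\ln p_i}{\sum_{i=1}^kp_i\ln r_i},\qquad \sigma^2=\frac{\sum_{i=1}^kp_i(\ln p_i-d\ln r_i)^2}{-\sum_{i=1}^kp_i\ln r_i}\quad(\sigma\ge0).$$ Suppose that $d\neq\delta$ (which is equivalent to $\sigma>0$), and let $\Theta(t)=e^{\sqrt{2\ln(1/t)\,\ln\ln\ln(1/t)}}$ for $t>0$ small. Then for all $\varepsilon>0$: (1) $m\ll\widehat{\mathcal P}^\Psi$, where $\Psi(t)=t^d\,\Theta(t)^{-(\sigma-\varepsilon)}$; (2) $m\perp\widehat{\mathcal P}^\Psi$, where $\Psi(t)=t^d\,\Theta(t)^{-(\sigma+\varepsilon)}$. In particular, for every Borel set $E$, $\widehat{\mathcal P}^d(E)<+\infty$ implies $m(E)=0$.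
   Context: The attractor $K$ is the unique nonempty compact set with $K=\bigcup_{i=1}^kS_i(K)$. Open Set Condition: there exists a nonempty bounded open set $U\subset\mathbb R^D$ with $\bigcup_{i=1}^kS_i(U)\subset U$ and $S_i(U)\cap S_j(U)=\emptyset$ for $i\neq j$. Generalized packing measure: for a positive function $\Psi$ defined for small $t>0$, the packing pre-measure is $\mathcal P^\Psi(E)=\lim_{\eta\to0}\sup\{\sum_i\Psi(|B_i|)\}$, the supremum being over countable families of pairwise disjoint balls $B_i$ centered in $E$ with $0<|B_i|\le\eta$ ($|B|$ the diameter), and the packing measure is $\widehat{\mathcal P}^\Psi(E)=\inf\{\sum_i\mathcal P^\Psi(E_i):E\subset\bigcup_iE_i\}$ (countable covers). $\widehat{\mathcal P}^s$ denotes $\widehat{\mathcal P}^\Psi$ with $\Psi(t)=t^s$. $m\ll\widehat{\mathcal P}^\Psi$ means: $\widehat{\mathcal P}^\Psi(E)=0$ implies $m(E)=0$ for every Borel set $E$. $m\perp\widehat{\mathcal P}^\Psi$ means: there is a Borel set $E$ with $m(E)=1$ and $\widehat{\mathcal P}^\Psi(E)=0$. *)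

theory Defs
  imports "HOL-Probability.Probability"
begin

section \<open>Self-similar sets and measures\<close>

definition similarity :: "real \<Rightarrow> ('a::metric_space \<Rightarrow> 'a) \<Rightarrow> bool" where
  "similarity r f \<longleftrightarrow> (\<forall>x y. dist (f x) (f y) = r * dist x y)"

definition attractor :: "nat \<Rightarrow> (nat \<Rightarrow> 'a::metric_space \<Rightarrow> 'a) \<Rightarrow> 'a set \<Rightarrow> bool" where
  "attractor k S K \<longleftrightarrow> compact K \<and> K \<noteq> {} \<and> K = (\<Union>i\<in>{1..k}. S i ` K)"

definition open_set_condition :: "nat \<Rightarrow> (nat \<Rightarrow> 'a::metric_space \<Rightarrow> 'a) \<Rightarrow> bool" where
  "open_set_condition k S \<longleftrightarrow>
     (\<exists>U. U \<noteq> {} \<and> bounded U \<and> open U \<and> (\<Union>i\<in>{1..k}. S i ` U) \<subseteq> U \<and>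
          (\<forall>i\<in>{1..k}. \<forall>j\<in>{1..k}. i \<noteq> j \<longrightarrow> S i ` U \<inter> S j ` U = {}))"

definition self_similar_measure ::
  "nat \<Rightarrow> (nat \<Rightarrow> real) \<Rightarrow> (nat \<Rightarrow> 'a::metric_space \<Rightarrow> 'a) \<Rightarrow> 'a measure \<Rightarrow> bool" where
  "self_similar_measure k p S m \<longleftrightarrow>
     prob_space m \<and> sets m = sets borel \<and>
     (\<forall>E\<in>sets borel. measure m E = (\<Sum>i=1..k. p i * measure m (S i -` E)))"

section \<open>Hausdorff dimension\<close>

text \<open>The covering sets are required to be bounded because \<open>diameter\<close> is unspecified on
  unbounded sets.  Only exponents \<open>s > 0\<close> are used, so the convention \<open>0 powr 0 = 0\<close> is
  harmless, and an empty covering set contributes \<open>0 powr s = 0\<close>.\<close>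

definition hausdorff_premeasure :: "real \<Rightarrow> real \<Rightarrow> 'a::metric_space set \<Rightarrow> ennreal" where
  "hausdorff_premeasure s \<eta> E =
     (INF A \<in> {A :: nat \<Rightarrow> 'a set. E \<subseteq> (\<Union>i. A i) \<and> (\<forall>i. bounded (A i) \<and> diameter (A i) \<le> \<eta>)}.
        \<Sum>i. ennreal (diameter (A i) powr s))"

definition hausdorff_measure :: "real \<Rightarrow> 'a::metric_space set \<Rightarrow> ennreal" where
  "hausdorff_measure s E = Lim (at_right 0) (\<lambda>\<eta>. hausdorff_premeasure s \<eta> E)"

definition hausdorff_dim :: "'a::euclidean_space set \<Rightarrow> real" where
  "hausdorff_dim E = Inf {s. s > 0 \<and> hausdorff_measure s E = 0}"

section \<open>Generalized packing measures\<close>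

text \<open>Balls are closed.  A family of pairwise disjoint balls is represented by the set of its
  members; since balls are nonempty, a disjoint family has no repetitions.\<close>

definition packings :: "real \<Rightarrow> 'a::metric_space set \<Rightarrow> 'a set set set" where
  "packings \<eta> E =
     {\<B>. countable \<B> \<and> disjoint \<B> \<and>
         (\<forall>B\<in>\<B>. (\<exists>x\<in>E. \<exists>\<rho>>0. B = cball x \<rho>) \<and> 0 < diameter B \<and> diameter B \<le> \<eta>)}"

definition packing_premeasure :: "(real \<Rightarrow> real) \<Rightarrow> 'a::metric_space set \<Rightarrow> ennreal" where
  "packing_premeasure \<Psi> E =
     Lim (at_right 0) (\<lambda>\<eta>. SUP \<B>\<in>packings \<eta> E. \<Sum>\<^sub>\<infinity>B\<in>\<B>. ennreal (\<Psi> (diameter B)))"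

definition packing_measure :: "(real \<Rightarrow> real) \<Rightarrow> 'a::metric_space set \<Rightarrow> ennreal" where
  "packing_measure \<Psi> E =
     (INF A \<in> {A :: nat \<Rightarrow> 'a set. E \<subseteq> (\<Union>i. A i)}. \<Sum>i. packing_premeasure \<Psi> (A i))"

definition abs_cont_packing :: "'a::metric_space measure \<Rightarrow> (real \<Rightarrow> real) \<Rightarrow> bool" where
  "abs_cont_packing m \<Psi> \<longleftrightarrow>
     (\<forall>E\<in>sets borel. packing_measure \<Psi> E = 0 \<longrightarrow> measure m E = 0)"

definition singular_packing :: "'a::metric_space measure \<Rightarrow> (real \<Rightarrow> real) \<Rightarrow> bool" where
  "singular_packing m \<Psi> \<longleftrightarrow>
     (\<exists>E\<in>sets borel. measure m E = 1 \<and> packing_measure \<Psi> E = 0)"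

text \<open>Only the values for small \<open>t > 0\<close> (where the triple logarithm is positive) matter.\<close>

definition Theta :: "real \<Rightarrow> real" where
  "Theta t = exp (sqrt (2 * ln (1 / t) * ln (ln (ln (1 / t)))))"

end

theory Submission
  imports Defs "HOL-Real_Asymp.Real_Asymp" "HOL-Library.Sublist"
begin

text \<open>
  Code a point of \<open>K\<close> by the sequence of maps that leads to it.  The measure \<open>m\<close> is then the
  image of the Bernoulli measure with weights \<open>p i\<close>, because a self-similar measure is unique
  (\<open>self_similar_unique\<close>).  For a word \<open>w\<close> write \<open>p w\<close> and \<open>r w\<close> for the products of the weights
  and of the ratios along \<open>w\<close>.  The letters contribute independent terms
  \<open>X i = ln (p i) - d * ln (r i)\<close> to \<open>ln (p w) - d * ln (r w)\<close>, and \<open>d\<close> is exactly the number for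
  which these terms have mean zero.  By the law of the iterated logarithm, and since
  \<open>- ln (r w)\<close> grows linearly in the length of \<open>w\<close>, the mass \<open>p w\<close> of the cylinder of a typical
  sequence is, up to an arbitrarily small change of \<open>\<sigma>\<close>, eventually at least
  \<open>r w powr d * Theta (r w) powr - \<sigma>\<close> and infinitely often at most that.  The two halves of the law
  (\<open>lil_upper\<close>, \<open>lil_lower\<close>) have different sources: the upper half comes from Ville's
  inequality, the lower half from Cramer's change of measure and a second Borel--Cantelli lemma for
  disjoint blocks.

  It remains to compare cylinders with balls.  A ball around a typical point contains the cylinder
  of its own size, so its mass is bounded below (\<open>mass_ball_lower\<close>).  In the other direction
  the ball may meet cylinders much heavier than the one that contains its centre.  The
  open set condition bounds the number of cylinders of a given size near a point, so each cylinder is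
  a neighbour of boundedly many others; hence the cylinders whose neighbourhood is \<open>j\<^sup>2\<close> times heavier
  than themselves carry mass \<open>O(1 / j\<^sup>2)\<close> at scale \<open>2 powr - j\<close>, and almost every point avoids
  them eventually (\<open>mass_ball_le_cylinder\<close>).  The factor \<open>j\<^sup>2\<close> is negligible against \<open>Theta\<close>.

  Bounds on the masses of balls are translated to packing measures by two elementary facts.  If
  balls centred in \<open>E\<close> have mass at least \<open>\<Psi>\<close>, then disjointness bounds the packing premeasure of
  \<open>E\<close>, and a slightly smaller gauge gives premeasure zero (\<open>packing_premeasure_le_mass\<close>,
  \<open>packing_premeasure_smaller_gauge\<close>).  If each point of \<open>E\<close> has arbitrarily small balls whose
  fivefold enlargements have mass at most \<open>\<Psi>\<close>, then Vitali's covering lemma bounds the mass of \<open>E\<close> by its packing premeasure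
  (\<open>mass_le_packing_premeasure\<close>).

  Finally \<open>\<delta>\<close> is the solution of Moran's equation, by the natural covers and the mass
  distribution principle (\<open>hausdorff_dim_attractor\<close>), and \<open>\<sigma> = 0\<close> forces \<open>p i = r i powr d\<close>, which
  is the case \<open>d = \<delta>\<close> by Gibbs' inequality (\<open>variance_zero_iff\<close>).
\<close>

section \<open>Packing and Hausdorff measures\<close>

lemma tendsto_at_right_0_Inf:
  fixes g :: "real \<Rightarrow> ennreal"
  assumes mono: "\<And>s t. 0 < s \<Longrightarrow> s \<le> t \<Longrightarrow> g s \<le> g t"
  shows "(g \<longlongrightarrow> (INF t\<in>{0<..}. g t)) (at_right 0)"
proof (rule order_tendstoI)
  fix a assume "a < (INF t\<in>{0<..}. g t)"
  then have "\<And>t. 0 < t \<Longrightarrow> a < g t"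
    by (meson INF_lower greaterThan_iff less_le_trans)
  then show "\<forall>\<^sub>F t in at_right 0. a < g t"
    unfolding eventually_at_right_field by (intro exI[of _ 1]) auto
next
  fix a assume "(INF t\<in>{0<..}. g t) < a"
  then obtain t where "0 < t" "g t < a"
    by (auto simp: INF_less_iff)
  then show "\<forall>\<^sub>F t in at_right 0. g t < a"
    unfolding eventually_at_right_field
    by (intro exI[of _ t]) (auto intro: le_less_trans[OF mono[of _ t]])
qed

lemma tendsto_at_right_0_Sup:
  fixes g :: "real \<Rightarrow> ennreal"
  assumes mono: "\<And>s t. 0 < s \<Longrightarrow> s \<le> t \<Longrightarrow> g t \<le> g s"
  shows "(g \<longlongrightarrow> (SUP t\<in>{0<..}. g t)) (at_right 0)"
proof (rule order_tendstoI)
  fix a assume "(SUP t\<in>{0<..}. g t) < a"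
  then have "\<And>t. 0 < t \<Longrightarrow> g t < a"
    by (meson SUP_upper greaterThan_iff le_less_trans)
  then show "\<forall>\<^sub>F t in at_right 0. g t < a"
    unfolding eventually_at_right_field by (intro exI[of _ 1]) auto
next
  fix a assume "a < (SUP t\<in>{0<..}. g t)"
  then obtain t where "0 < t" "a < g t"
    by (auto simp: less_SUP_iff)
  then show "\<forall>\<^sub>F t in at_right 0. a < g t"
    unfolding eventually_at_right_field
    by (intro exI[of _ t]) (auto intro: less_le_trans[OF _ mono[of _ t]])
qed

lemma hausdorff_measure_eq_Sup:
  "hausdorff_measure s E = (SUP \<eta>\<in>{0<..}. hausdorff_premeasure s \<eta> E)"
  unfolding hausdorff_measure_def
proof (rule tendsto_Lim[OF _ tendsto_at_right_0_Sup])
  show "hausdorff_premeasure s t E \<le> hausdorff_premeasure s u E" if "0 < u" "u \<le> t" for u t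
    unfolding hausdorff_premeasure_def using that
    by (intro INF_superset_mono) (auto intro: order_trans[OF _ that(2)])
qed simp

abbreviation packing_sup :: "(real \<Rightarrow> real) \<Rightarrow> real \<Rightarrow> 'a::metric_space set \<Rightarrow> ennreal" where
  "packing_sup \<Psi> \<eta> E \<equiv> (SUP \<B>\<in>packings \<eta> E. \<Sum>\<^sub>\<infinity>B\<in>\<B>. ennreal (\<Psi> (diameter B)))"

lemma packing_premeasure_eq_Inf:
  "packing_premeasure \<Psi> E =
    (INF \<eta>\<in>{0<..}. packing_sup \<Psi> \<eta> E)"
  unfolding packing_premeasure_def
proof (rule tendsto_Lim[OF _ tendsto_at_right_0_Inf])
  show "packing_sup \<Psi> s E
     \<le> packing_sup \<Psi> t E"
    if "0 < s" "s \<le> t" for s t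
    by (intro SUP_subset_mono) (auto simp: packings_def intro: order_trans[OF _ that(2)])
qed simp

lemma packing_premeasure_le_packings:
  assumes "0 < \<eta>"
  shows "packing_premeasure \<Psi> E \<le> packing_sup \<Psi> \<eta> E"
  unfolding packing_premeasure_eq_Inf by (rule INF_lower2[of \<eta>]) (use assms in auto)

lemma infsum_ennreal_leI:
  fixes f :: "'b \<Rightarrow> ennreal"
  assumes "\<And>F. finite F \<Longrightarrow> F \<subseteq> A \<Longrightarrow> sum f F \<le> c"
  shows "infsum f A \<le> c"
  using assms by (subst nonneg_infsum_complete) (auto intro: SUP_least)

lemma sum_le_infsum_ennreal:
  fixes f :: "'b \<Rightarrow> ennreal"
  assumes "finite F" "F \<subseteq> A"
  shows "sum f F \<le> infsum f A"
  using assms by (subst nonneg_infsum_complete) (auto intro: SUP_upper)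

lemma packing_sum_le:
  assumes "\<And>F. finite F \<Longrightarrow> F \<in> packings \<eta> E \<Longrightarrow> (\<Sum>B\<in>F. ennreal (\<Psi> (diameter B))) \<le> c"
  shows "packing_sup \<Psi> \<eta> E \<le> c"
proof (rule SUP_least, rule infsum_ennreal_leI)
  fix \<B> F assume "\<B> \<in> packings \<eta> E" "finite F" "F \<subseteq> \<B>"
  then have "F \<in> packings \<eta> E"
    unfolding packings_def by (auto intro: countable_finite pairwise_subset)
  with \<open>finite F\<close> show "(\<Sum>B\<in>F. ennreal (\<Psi> (diameter B))) \<le> c"
    by (rule assms)
qed

lemma packing_premeasure_lessE:
  assumes "packing_premeasure \<Psi> E < c"
  obtains \<eta> where "0 < \<eta>" "packing_sup \<Psi> \<eta> E < c"
  using assms unfolding packing_premeasure_eq_Inf by (auto simp: INF_less_iff)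

text \<open>On fine packings the smaller gauge multiplies each sum by an arbitrarily small factor, which
  sends a finite supremum to zero.\<close>

lemma packing_premeasure_smaller_gauge:
  assumes finite: "packing_premeasure \<Psi>' E < \<infinity>"
    and small: "\<And>e. 0 < e \<Longrightarrow> \<forall>\<^sub>F t in at_right 0. \<Psi> t \<le> e * \<Psi>' t"
    and nonneg: "\<forall>\<^sub>F t in at_right 0. 0 \<le> \<Psi>' t"
  shows "packing_premeasure \<Psi> E = 0"
proof -
  define pack where "pack \<Psi> \<eta> = packing_sup \<Psi> \<eta> E" for \<Psi> \<eta>
  obtain \<eta> where \<eta>: "0 < \<eta>" "pack \<Psi>' \<eta> < \<infinity>"
    using packing_premeasure_lessE[OF finite] unfolding pack_def by blast
  have le: "packing_premeasure \<Psi> E \<le> ennreal e * pack \<Psi>' \<eta>" if e: "0 < e" for e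
  proof -
    have "\<forall>\<^sub>F t in at_right 0. \<Psi> t \<le> e * \<Psi>' t \<and> 0 \<le> \<Psi>' t"
      using small[OF e] nonneg by eventually_elim auto
    then obtain b where b: "0 < b" "\<And>t. 0 < t \<Longrightarrow> t < b \<Longrightarrow> \<Psi> t \<le> e * \<Psi>' t \<and> 0 \<le> \<Psi>' t"
      unfolding eventually_at_right_field by auto
    define \<eta>' where "\<eta>' = min \<eta> (b / 2)"
    have "0 < \<eta>'" "\<eta>' \<le> \<eta>" "\<eta>' < b" using \<eta> b by (auto simp: \<eta>'_def)
    have "packing_premeasure \<Psi> E \<le> pack \<Psi> \<eta>'"
      unfolding pack_def by (rule packing_premeasure_le_packings) fact
    also have "\<dots> \<le> ennreal e * pack \<Psi>' \<eta>"
      unfolding pack_def[of \<Psi>]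
    proof (rule packing_sum_le)
      fix F assume F: "finite F" "F \<in> packings \<eta>' E"
      have "(\<Sum>B\<in>F. ennreal (\<Psi> (diameter B))) \<le> (\<Sum>B\<in>F. ennreal e * ennreal (\<Psi>' (diameter B)))"
      proof (rule sum_mono)
        fix B assume "B \<in> F"
        then have "0 < diameter B" "diameter B < b"
          using F \<open>\<eta>' < b\<close> by (auto simp: packings_def)
        then have "\<Psi> (diameter B) \<le> e * \<Psi>' (diameter B)" "0 \<le> \<Psi>' (diameter B)"
          using b by auto
        then show "ennreal (\<Psi> (diameter B)) \<le> ennreal e * ennreal (\<Psi>' (diameter B))"
          using e by (simp add: ennreal_mult[symmetric] ennreal_leI)
      qed
      also have "\<dots> = ennreal e * (\<Sum>B\<in>F. ennreal (\<Psi>' (diameter B)))"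
        by (simp add: sum_distrib_left)
      also have "\<dots> \<le> ennreal e * (\<Sum>\<^sub>\<infinity>B\<in>F. ennreal (\<Psi>' (diameter B)))"
        using F by simp
      also have "\<dots> \<le> ennreal e * pack \<Psi>' \<eta>"
        unfolding pack_def using F \<open>\<eta>' \<le> \<eta>\<close>
        by (intro mult_left_mono SUP_upper) (auto simp: packings_def intro: order_trans[OF _ \<open>\<eta>' \<le> \<eta>\<close>])
      finally show "(\<Sum>B\<in>F. ennreal (\<Psi> (diameter B))) \<le> ennreal e * pack \<Psi>' \<eta>" .
    qed
    finally show ?thesis .
  qed
  obtain c where c: "0 \<le> c" "pack \<Psi>' \<eta> = ennreal c"
    using \<eta>(2) by (cases "pack \<Psi>' \<eta>") auto
  have "packing_premeasure \<Psi> E \<le> 0"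
  proof (rule ennreal_le_epsilon)
    fix e :: real assume e: "0 < e"
    have "packing_premeasure \<Psi> E \<le> ennreal (e / (c + 1)) * ennreal c"
      using le[of "e / (c + 1)"] c e by simp
    also have "\<dots> = ennreal (e / (c + 1) * c)"
      using c e by (intro ennreal_mult[symmetric]) auto
    also have "\<dots> \<le> ennreal e"
      using c e by (intro ennreal_leI) (simp add: field_simps)
    finally show "packing_premeasure \<Psi> E \<le> 0 + ennreal e" by simp
  qed
  then show ?thesis by simp
qed

lemma packing_measure_smaller_gauge:
  assumes finite: "packing_measure \<Psi>' E < \<infinity>"
    and small: "\<And>e. 0 < e \<Longrightarrow> \<forall>\<^sub>F t in at_right 0. \<Psi> t \<le> e * \<Psi>' t"
    and nonneg: "\<forall>\<^sub>F t in at_right 0. 0 \<le> \<Psi>' t"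
  shows "packing_measure \<Psi> E = 0"
proof -
  obtain A :: "nat \<Rightarrow> 'a set" where A: "E \<subseteq> (\<Union>i. A i)" "(\<Sum>i. packing_premeasure \<Psi>' (A i)) < \<infinity>"
    using finite unfolding packing_measure_def by (auto simp: INF_less_iff)
  have "packing_premeasure \<Psi>' (A i) < \<infinity>" for i
    using ennreal_suminf_lessD[OF A(2)] by auto
  then have "packing_premeasure \<Psi> (A i) = 0" for i
    using packing_premeasure_smaller_gauge[OF _ small nonneg] by blast
  then have "(\<Sum>i. packing_premeasure \<Psi> (A i)) = 0" by simp
  then show ?thesis
    unfolding packing_measure_def using A(1)
    by (metis (mono_tags, lifting) INF_lower le_zero_eq mem_Collect_eq)
qed

text \<open>The balls of a packing are disjoint, so their masses add up to at most the total mass.\<close>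

lemma packing_premeasure_le_mass:
  fixes m :: "'a::euclidean_space measure"
  assumes "finite_measure m" and sets: "sets m = sets borel" and "0 < R"
    and ball: "\<And>x \<rho>. x \<in> E \<Longrightarrow> 0 < \<rho> \<Longrightarrow> \<rho> < R \<Longrightarrow> \<Psi> (2 * \<rho>) \<le> measure m (cball x \<rho>)"
  shows "packing_premeasure \<Psi> E \<le> emeasure m (space m)"
proof -
  interpret finite_measure m by fact
  have "packing_premeasure \<Psi> E \<le> packing_sup \<Psi> R E"
    using \<open>0 < R\<close> by (rule packing_premeasure_le_packings)
  also have "\<dots> \<le> emeasure m (space m)"
  proof (rule packing_sum_le)
    fix F assume F: "finite F" "F \<in> packings R E"
    have ball_F: "\<exists>x\<in>E. \<exists>\<rho>>0. B = cball x \<rho> \<and> \<rho> < R" if "B \<in> F" for B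
    proof -
      have "\<exists>x\<in>E. \<exists>\<rho>>0. B = cball x \<rho>" and diam: "diameter B \<le> R"
        using F(2) that by (simp_all add: packings_def)
      then obtain x \<rho> where *: "x \<in> E" "0 < \<rho>" "B = cball x \<rho>" by blast
      with diam have "\<rho> < R" by simp
      with * show ?thesis by blast
    qed
    have "(\<Sum>B\<in>F. ennreal (\<Psi> (diameter B))) \<le> (\<Sum>B\<in>F. emeasure m B)"
    proof (rule sum_mono)
      fix B assume "B \<in> F"
      then obtain x \<rho> where "x \<in> E" "0 < \<rho>" "B = cball x \<rho>" "\<rho> < R" using ball_F by blast
      then show "ennreal (\<Psi> (diameter B)) \<le> emeasure m B"
        using ball[of x \<rho>] by (simp add: emeasure_eq_measure ennreal_leI)
    qed
    also have "\<dots> = emeasure m (\<Union>B\<in>F. B)"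
    proof (rule sum_emeasure)
      show "(\<lambda>B. B) ` F \<subseteq> sets m" using ball_F sets by fastforce
      show "disjoint_family_on (\<lambda>B. B) F"
        using F unfolding packings_def disjoint_def disjoint_family_on_def by auto
    qed (use F in auto)
    also have "\<dots> \<le> emeasure m (space m)"
      by (rule emeasure_space)
    finally show "(\<Sum>B\<in>F. ennreal (\<Psi> (diameter B))) \<le> emeasure m (space m)" .
  qed
  finally show ?thesis .
qed

text \<open>Unordered sums over the members of a packing are compared with measures through finite
  partial unions.\<close>

lemma emeasure_UN_le_infsum:
  assumes "countable I" and meas: "\<And>i. i \<in> I \<Longrightarrow> A i \<in> sets m"
    and le: "\<And>i. i \<in> I \<Longrightarrow> emeasure m (A i) \<le> f i"
  shows "emeasure m (\<Union>i\<in>I. A i) \<le> infsum f I"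
proof (cases "I = {}")
  case False
  define e where "e = from_nat_into I"
  have range_e: "range e = I" unfolding e_def using False assms(1) by (rule range_from_nat_into)
  define V where "V n = (\<Union>i\<in>e ` {..n}. A i)" for n :: nat
  have eI: "e n \<in> I" for n using range_e by auto
  have "emeasure m (\<Union>i\<in>I. A i) = emeasure m (\<Union>n. V n)"
    unfolding V_def using range_e by (intro arg_cong[of _ _ "emeasure m"]) blast
  also have "\<dots> = (SUP n. emeasure m (V n))"
    by (rule SUP_emeasure_incseq[symmetric])
      (use eI in \<open>auto simp: V_def atMost_Suc intro!: meas sets.finite_UN incseq_SucI\<close>)
  also have "\<dots> \<le> infsum f I"
  proof (rule SUP_least)
    fix n
    have "emeasure m (V n) \<le> (\<Sum>i\<in>e ` {..n}. emeasure m (A i))"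
      unfolding V_def using eI by (intro emeasure_subadditive_finite) (auto intro: meas)
    also have "\<dots> \<le> (\<Sum>i\<in>e ` {..n}. f i)"
      using eI le by (intro sum_mono) auto
    also have "\<dots> \<le> infsum f I"
      using eI by (intro sum_le_infsum_ennreal) auto
    finally show "emeasure m (V n) \<le> infsum f I" .
  qed
  finally show ?thesis .
qed simp

text \<open>A Vitali selection of the given balls is a packing of \<open>A\<close>, and the fivefold enlargements of
  its members still cover \<open>A \<inter> G\<close>.  Their union \<open>V\<close> appears in the conclusion because \<open>A\<close> and
  \<open>G\<close> may fail to be measurable.\<close>

lemma mass_le_packing_premeasure:
  fixes m :: "'a::euclidean_space measure"
  assumes sets: "sets m = sets borel"
    and ball: "\<And>x \<eta>. x \<in> G \<Longrightarrow> 0 < \<eta> \<Longrightarrow>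
      \<exists>\<rho>>0. \<rho> \<le> \<eta> \<and> emeasure m (cball x (5 * \<rho>)) \<le> ennreal (\<Psi> (2 * \<rho>))"
    and c: "packing_premeasure \<Psi> A < c"
  shows "\<exists>V\<in>sets borel. A \<inter> G \<subseteq> V \<and> emeasure m V \<le> c"
proof -
  obtain \<eta> where \<eta>: "0 < \<eta>"
    and sup: "packing_sup \<Psi> \<eta> A < c"
    using packing_premeasure_lessE[OF c] by blast
  have "\<forall>x\<in>G. \<exists>\<rho>. 0 < \<rho> \<and> \<rho> \<le> \<eta> / 2 \<and> emeasure m (cball x (5 * \<rho>)) \<le> ennreal (\<Psi> (2 * \<rho>))"
    using ball[of _ "\<eta> / 2"] \<eta> by auto
  then obtain \<rho> where \<rho>: "\<And>x. x \<in> G \<Longrightarrow> 0 < \<rho> x" "\<And>x. x \<in> G \<Longrightarrow> \<rho> x \<le> \<eta> / 2"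
    "\<And>x. x \<in> G \<Longrightarrow> emeasure m (cball x (5 * \<rho> x)) \<le> ennreal (\<Psi> (2 * \<rho> x))"
    by metis
  have "A \<inter> G \<subseteq> (\<Union>x\<in>A \<inter> G. cball x (\<rho> x))"
    using \<rho>(1) by force
  then obtain C where C: "countable C" "C \<subseteq> A \<inter> G"
      "pairwise (\<lambda>i j. disjnt (cball i (\<rho> i)) (cball j (\<rho> j))) C"
      "A \<inter> G \<subseteq> (\<Union>i\<in>C. cball i (5 * \<rho> i))"
    by (rule Vitali_covering_lemma_cballs[of "A \<inter> G" "\<lambda>x. x" \<rho> "A \<inter> G" "\<eta> / 2"]) (use \<rho> in auto)
  define b where "b x = cball x (\<rho> x)" for x
  have inj: "inj_on b C"
  proof (rule inj_onI, rule ccontr)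
    fix x y assume "x \<in> C" "y \<in> C" "b x = b y" "x \<noteq> y"
    then have "disjnt (b x) (b x)" using C(3) unfolding b_def pairwise_def by metis
    moreover have "x \<in> b x" using \<open>x \<in> C\<close> C(2) \<rho>(1)[of x] by (auto simp: b_def)
    ultimately show False by (auto simp: disjnt_def)
  qed
  have diam: "diameter (b x) = 2 * \<rho> x" if "x \<in> C" for x
    using that C(2) \<rho>(1)[of x] by (auto simp: b_def)
  have pack: "b ` C \<in> packings \<eta> A"
    unfolding packings_def
  proof (intro CollectI conjI ballI)
    show "countable (b ` C)" using C(1) by simp
    show "disjoint (b ` C)"
      using C(3) unfolding pairwise_image b_def by (rule pairwise_mono) auto
    fix B assume "B \<in> b ` C"
    then obtain x where x: "x \<in> C" "B = b x" by auto
    then have "0 < \<rho> x" "\<rho> x \<le> \<eta> / 2" "x \<in> A" using C(2) \<rho> by auto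
    then show "\<exists>x\<in>A. \<exists>\<rho>>0. B = cball x \<rho>" "0 < diameter B" "diameter B \<le> \<eta>"
      using x diam[of x] by (auto simp: b_def)
  qed
  define V where "V = (\<Union>x\<in>C. cball x (5 * \<rho> x))"
  have "emeasure m V \<le> (\<Sum>\<^sub>\<infinity>x\<in>C. ennreal (\<Psi> (diameter (b x))))"
    unfolding V_def
  proof (rule emeasure_UN_le_infsum)
    show "emeasure m (cball x (5 * \<rho> x)) \<le> ennreal (\<Psi> (diameter (b x)))" if "x \<in> C" for x
      using that C(2) \<rho>(3)[of x] by (auto simp: diam)
  qed (use C sets in auto)
  also have "\<dots> = (\<Sum>\<^sub>\<infinity>B\<in>b ` C. ennreal (\<Psi> (diameter B)))"
    using infsum_reindex[OF inj, of "\<lambda>B. ennreal (\<Psi> (diameter B))"] by (simp add: o_def)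
  also have "\<dots> \<le> c"
    using pack sup by (meson SUP_upper le_less_trans less_imp_le)
  finally have "emeasure m V \<le> c" .
  moreover have "V \<in> sets borel" unfolding V_def using C(1) by (intro sets.countable_UN') auto
  moreover have "A \<inter> G \<subseteq> V" unfolding V_def using C(4) .
  ultimately show ?thesis by blast
qed

text \<open>The cover in the definition of the packing measure consists of arbitrary sets \<open>A i\<close>; each
  \<open>A i \<inter> G\<close> is first enclosed in a Borel set of nearly the right mass.\<close>

lemma null_if_packing_null:
  fixes m :: "'a::euclidean_space measure"
  assumes sets: "sets m = sets borel" and G: "AE x in m. x \<in> G"
    and ball: "\<And>x \<eta>. x \<in> G \<Longrightarrow> 0 < \<eta> \<Longrightarrow>
      \<exists>\<rho>>0. \<rho> \<le> \<eta> \<and> emeasure m (cball x (5 * \<rho>)) \<le> ennreal (\<Psi> (2 * \<rho>))"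
    and E: "E \<in> sets borel" and null: "packing_measure \<Psi> E = 0"
  shows "emeasure m E = 0"
proof -
  have "emeasure m E \<le> 0"
  proof (rule ennreal_le_epsilon)
    fix e :: real assume e: "0 < e"
    then have "packing_measure \<Psi> E < ennreal (e / 2)" using null by simp
    then obtain A :: "nat \<Rightarrow> 'a set" where A: "E \<subseteq> (\<Union>i. A i)"
        and sumA: "(\<Sum>i. packing_premeasure \<Psi> (A i)) < ennreal (e / 2)"
      unfolding packing_measure_def by (auto simp: INF_less_iff)
    define c where "c i = ennreal (e / 2 * (1 / 2) ^ Suc i)" for i
    have fin: "packing_premeasure \<Psi> (A i) < top" for i
      using ennreal_suminf_lessD[OF less_trans[OF sumA]] by (simp add: ennreal_less_top)
    have "packing_premeasure \<Psi> (A i) < packing_premeasure \<Psi> (A i) + c i" for i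
      using fin[of i] e by (cases "packing_premeasure \<Psi> (A i)")
        (auto simp: c_def ennreal_plus[symmetric] ennreal_less_iff simp del: ennreal_plus)
    then have "\<exists>V\<in>sets borel. A i \<inter> G \<subseteq> V \<and> emeasure m V \<le> packing_premeasure \<Psi> (A i) + c i" for i
      by (intro mass_le_packing_premeasure[OF sets ball]) auto
    then obtain V where V: "\<And>i. V i \<in> sets borel" "\<And>i. A i \<inter> G \<subseteq> V i"
        "\<And>i. emeasure m (V i) \<le> packing_premeasure \<Psi> (A i) + c i"
      by metis
    have "emeasure m E \<le> emeasure m (\<Union>i. V i)"
    proof (rule emeasure_mono_AE)
      show "AE x in m. x \<in> E \<longrightarrow> x \<in> (\<Union>i. V i)"
        using G by eventually_elim (use A V(2) in blast)
    qed (use V(1) sets in auto)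
    also have "\<dots> \<le> (\<Sum>i. emeasure m (V i))"
      using V(1) sets by (intro emeasure_subadditive_countably) auto
    also have "\<dots> \<le> (\<Sum>i. packing_premeasure \<Psi> (A i) + c i)"
      by (intro suminf_le V(3) allI) auto
    also have "\<dots> = (\<Sum>i. packing_premeasure \<Psi> (A i)) + (\<Sum>i. c i)"
      by (intro suminf_add[symmetric]) auto
    also have "(\<Sum>i. c i) = ennreal (e / 2)"
    proof -
      have "(\<lambda>i. e / 2 * (1 / 2) ^ Suc i) sums (e / 2 * 1)"
        by (intro sums_mult power_half_series)
      then show ?thesis unfolding c_def using e by (intro suminf_ennreal_eq) auto
    qed
    also have "(\<Sum>i. packing_premeasure \<Psi> (A i)) + ennreal (e / 2) \<le> ennreal (e / 2) + ennreal (e / 2)"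
      using sumA by (intro add_right_mono) auto
    also have "\<dots> = 0 + ennreal e"
      using e by (simp add: ennreal_plus[symmetric] del: ennreal_plus)
    finally show "emeasure m E \<le> 0 + ennreal e" .
  qed
  then show ?thesis by simp
qed

text \<open>A closed ball is the intersection of the concentric larger ones, and these contain the balls of
  radius \<open>\<rho>\<close> around all nearby points.  Closedness makes the exceptional sets below
  Borel.\<close>

lemma closed_mass_cball_ge:
  fixes m :: "'a::euclidean_space measure"
  assumes "finite_measure m" and sets: "sets m = sets borel"
  shows "closed {x. c \<le> measure m (cball x \<rho>)}"
  unfolding closed_sequential_limits
proof (intro allI impI, elim conjE)
  interpret finite_measure m by fact
  fix f :: "nat \<Rightarrow> 'a" and x
  assume f: "\<forall>n. f n \<in> {x. c \<le> measure m (cball x \<rho>)}" and lim: "f \<longlonglongrightarrow> x"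
  define B where "B n = cball x (\<rho> + inverse (real (Suc n)))" for n
  have "(\<Inter>n. B n) \<subseteq> cball x \<rho>"
  proof
    fix y assume "y \<in> (\<Inter>n. B n)"
    then have *: "dist x y \<le> \<rho> + inverse (real (Suc n))" for n unfolding B_def by auto
    have "dist x y \<le> \<rho> + 0"
      by (rule LIMSEQ_le_const[OF tendsto_add[OF tendsto_const LIMSEQ_inverse_real_of_nat]])
        (intro exI[of _ 0] allI impI *)
    then show "y \<in> cball x \<rho>" by simp
  qed
  moreover have "cball x \<rho> \<subseteq> (\<Inter>n. B n)"
    unfolding B_def by (intro INT_greatest subset_cball) (simp del: of_nat_Suc)
  ultimately have eq: "(\<Inter>n. B n) = cball x \<rho>" by blast
  have "decseq B"
    unfolding B_def by (intro decseq_SucI subset_cball add_left_mono le_imp_inverse_le) auto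
  moreover have "range B \<subseteq> sets m" by (auto simp: B_def sets)
  ultimately have "(\<lambda>n. measure m (B n)) \<longlonglongrightarrow> measure m (\<Inter>n. B n)"
    by (intro finite_Lim_measure_decseq)
  then have "(\<lambda>n. measure m (B n)) \<longlonglongrightarrow> measure m (cball x \<rho>)"
    by (simp only: eq)
  moreover have "c \<le> measure m (B n)" for n
  proof -
    have "\<forall>\<^sub>F i in sequentially. dist (f i) x < inverse (real (Suc n))"
      by (intro tendstoD[OF lim]) auto
    then obtain i where i: "dist (f i) x < inverse (real (Suc n))"
      by (auto simp: eventually_sequentially)
    have "c \<le> measure m (cball (f i) \<rho>)" using f by auto
    also have "\<dots> \<le> measure m (B n)"
    proof (rule finite_measure_mono)
      show "cball (f i) \<rho> \<subseteq> B n"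
      proof
        fix y assume "y \<in> cball (f i) \<rho>"
        then show "y \<in> B n"
          using i dist_triangle[of x y "f i"] by (simp add: B_def dist_commute)
      qed
    qed (auto simp: B_def sets)
    finally show ?thesis .
  qed
  ultimately have "c \<le> measure m (cball x \<rho>)"
    using LIMSEQ_le_const by blast
  then show "x \<in> {x. c \<le> measure m (cball x \<rho>)}" by simp
qed

lemma borel_measurable_mass_cball:
  fixes m :: "'a::euclidean_space measure"
  assumes "finite_measure m" and sets: "sets m = sets borel"
  shows "(\<lambda>x. measure m (cball x \<rho>)) \<in> borel_measurable borel"
proof (rule borel_measurableI_ge)
  show "{x \<in> space borel. y \<le> measure m (cball x \<rho>)} \<in> sets borel" for y
    using borel_closed[OF closed_mass_cball_ge[OF assms, of y \<rho>]] by simp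
qed

section \<open>The similarity dimension and Gibbs' inequality\<close>

lemma moran_sum_strict_anti:
  fixes r :: "'i \<Rightarrow> real"
  assumes "finite I" "I \<noteq> {}" "\<And>i. i \<in> I \<Longrightarrow> 0 < r i \<and> r i < 1" "s < t"
  shows "(\<Sum>i\<in>I. r i powr t) < (\<Sum>i\<in>I. r i powr s)"
  using assms by (intro sum_strict_mono powr_less_mono') auto

text \<open>The sum is \<open>card I > 1\<close> at \<open>s = 0\<close> and tends to \<open>0\<close>; the intermediate value theorem applies.\<close>

lemma moran_exponent_exists:
  fixes r :: "'i \<Rightarrow> real"
  assumes fin: "finite I" and card: "2 \<le> card I" and r: "\<And>i. i \<in> I \<Longrightarrow> 0 < r i \<and> r i < 1"
  shows "\<exists>s>0. (\<Sum>i\<in>I. r i powr s) = 1"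
proof -
  define f where "f s = (\<Sum>i\<in>I. r i powr s)" for s
  have "((\<lambda>s. r i powr s) \<longlongrightarrow> 0) at_top" if "i \<in> I" for i
    using r[OF that] by real_asymp
  then have "(f \<longlongrightarrow> (\<Sum>i\<in>I. 0)) at_top" unfolding f_def by (intro tendsto_sum)
  then have "\<forall>\<^sub>F s in at_top. f s < 1" by (intro order_tendstoD) auto
  then have "\<forall>\<^sub>F s in at_top. f s < 1 \<and> 0 < s"
    using eventually_gt_at_top[of 0] by eventually_elim auto
  then obtain b where b: "f b < 1" "0 < b" by (auto simp: eventually_at_top_linorder)
  have "continuous_on {0..b} f"
    unfolding f_def using r by (intro continuous_intros) fastforce
  moreover have f0: "f 0 = card I"
    unfolding f_def using r by (simp add: less_imp_neq[symmetric])
  ultimately obtain s where s: "0 \<le> s" "f s = 1"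
    using IVT2'[of f b 1 0] b card by auto
  then have "s \<noteq> 0" using f0 card by auto
  then show ?thesis using s by (intro exI[of _ s]) (auto simp: f_def)
qed

text \<open>The equality case of Gibbs' inequality, from the equality case of \<open>ln x \<le> x - 1\<close>.\<close>

lemma gibbs_equality:
  fixes p q :: "'i \<Rightarrow> real"
  assumes fin: "finite I" and pos: "\<And>i. i \<in> I \<Longrightarrow> 0 < p i" "\<And>i. i \<in> I \<Longrightarrow> 0 < q i"
    and sums: "sum p I = 1" "sum q I = 1"
    and eq: "(\<Sum>i\<in>I. p i * ln (p i)) = (\<Sum>i\<in>I. p i * ln (q i))" and i: "i \<in> I"
  shows "p i = q i"
proof -
  define g where "g i = p i * (q i / p i - 1 - ln (q i / p i))" for i
  have g: "g i = q i - p i - p i * ln (q i) + p i * ln (p i)" if "i \<in> I" for i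
    using pos[OF that] by (simp add: g_def ln_div field_simps)
  have "0 \<le> g i" if "i \<in> I" for i
    using pos[OF that] ln_le_minus_one[of "q i / p i"] unfolding g_def by (intro mult_nonneg_nonneg) auto
  moreover have "sum g I = 0"
  proof -
    have "sum g I = (\<Sum>i\<in>I. q i - p i - p i * ln (q i) + p i * ln (p i))"
      by (intro sum.cong g) auto
    also have "\<dots> = 0" by (simp add: sum.distrib sum_subtractf sums eq)
    finally show ?thesis .
  qed
  ultimately have "g i = 0" using fin i by (simp add: sum_nonneg_eq_0_iff)
  then have "ln (q i / p i) = q i / p i - 1" using pos[OF i] by (simp add: g_def)
  then have "q i / p i = 1" using pos[OF i] by (intro ln_eq_minus_one) auto
  then show ?thesis using pos[OF i] by simp
qed

lemma entropy_quotient_pos: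
  fixes p r :: "'i \<Rightarrow> real"
  assumes fin: "finite I" and card: "2 \<le> card I"
    and p: "\<And>i. i \<in> I \<Longrightarrow> 0 < p i" "sum p I = 1"
    and r: "\<And>i. i \<in> I \<Longrightarrow> 0 < r i \<and> r i < 1"
  shows "0 < (\<Sum>i\<in>I. p i * ln (p i)) / (\<Sum>i\<in>I. p i * ln (r i))"
proof (rule divide_neg_neg)
  have "I \<noteq> {}" using card by auto
  have "p i < 1" if "i \<in> I" for i
  proof -
    have "card (I - {i}) \<noteq> 0" using card that fin by simp
    then have "I - {i} \<noteq> {}" by (metis card.empty)
    then have "0 < sum p (I - {i})" using fin p(1) by (intro sum_pos) auto
    then show ?thesis using sum.remove[OF fin that, of p] p(2) by simp
  qed
  then have "(\<Sum>i\<in>I. p i * ln (p i)) < (\<Sum>i\<in>I. 0)"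
    using fin \<open>I \<noteq> {}\<close> p(1) by (intro sum_strict_mono mult_pos_neg) auto
  then show "(\<Sum>i\<in>I. p i * ln (p i)) < 0" by simp
  have "(\<Sum>i\<in>I. p i * ln (r i)) < (\<Sum>i\<in>I. 0)"
    using fin \<open>I \<noteq> {}\<close> p(1) r by (intro sum_strict_mono mult_pos_neg) auto
  then show "(\<Sum>i\<in>I. p i * ln (r i)) < 0" by simp
qed

text \<open>Zero variance means \<open>p i = r i powr d\<close> for all \<open>i\<close>.  Summation over \<open>i\<close> gives Moran's equation
  for \<open>d\<close>; conversely, the definition of \<open>d\<close> is the equality case of Gibbs' inequality for the
  weights \<open>r i powr d\<close>.\<close>

lemma variance_zero_iff:
  fixes p r :: "'i \<Rightarrow> real"
  assumes fin: "finite I" and card: "2 \<le> card I"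
    and p: "\<And>i. i \<in> I \<Longrightarrow> 0 < p i" "sum p I = 1"
    and r: "\<And>i. i \<in> I \<Longrightarrow> 0 < r i \<and> r i < 1"
    and s: "(\<Sum>i\<in>I. r i powr s) = 1"
    and d: "d = (\<Sum>i\<in>I. p i * ln (p i)) / (\<Sum>i\<in>I. p i * ln (r i))"
  shows "(\<Sum>i\<in>I. p i * (ln (p i) - d * ln (r i))\<^sup>2) = 0 \<longleftrightarrow> d = s"
proof -
  have ne: "I \<noteq> {}" using card by auto
  have "(\<Sum>i\<in>I. p i * ln (r i)) \<noteq> 0"
    using entropy_quotient_pos[OF fin card p, of r] r by force
  then have dsum: "(\<Sum>i\<in>I. p i * ln (p i)) = (\<Sum>i\<in>I. p i * ln (r i powr d))"
  proof -
    have "(\<Sum>i\<in>I. p i * ln (r i powr d)) = (\<Sum>i\<in>I. d * (p i * ln (r i)))"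
      using r by (intro sum.cong) (auto simp: ln_powr)
    also have "\<dots> = d * (\<Sum>i\<in>I. p i * ln (r i))" by (rule sum_distrib_left[symmetric])
    finally show ?thesis using d \<open>(\<Sum>i\<in>I. p i * ln (r i)) \<noteq> 0\<close> by simp
  qed
  have "(\<Sum>i\<in>I. p i * (ln (p i) - d * ln (r i))\<^sup>2) = 0 \<longleftrightarrow> (\<forall>i\<in>I. ln (p i) - d * ln (r i) = 0)"
  proof -
    have "(\<Sum>i\<in>I. p i * (ln (p i) - d * ln (r i))\<^sup>2) = 0
        \<longleftrightarrow> (\<forall>i\<in>I. p i * (ln (p i) - d * ln (r i))\<^sup>2 = 0)"
      using fin p by (intro sum_nonneg_eq_0_iff) (auto simp: less_imp_le)
    also have "\<dots> \<longleftrightarrow> (\<forall>i\<in>I. ln (p i) - d * ln (r i) = 0)"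
      using p(1) by (intro ball_cong refl) fastforce
    finally show ?thesis .
  qed
  also have "\<dots> \<longleftrightarrow> (\<forall>i\<in>I. p i = r i powr d)"
  proof (intro ball_cong refl)
    fix i assume "i \<in> I"
    then have "0 < p i" "0 < r i powr d" "ln (r i powr d) = d * ln (r i)"
      using p(1) r[of i] by (auto simp: ln_powr)
    then show "(ln (p i) - d * ln (r i) = 0) = (p i = r i powr d)"
      using ln_inj_iff[of "p i" "r i powr d"] by auto
  qed
  also have "\<dots> \<longleftrightarrow> d = s"
  proof
    assume "\<forall>i\<in>I. p i = r i powr d"
    then have "(\<Sum>i\<in>I. r i powr d) = 1" using p(2) by simp
    then show "d = s"
      using moran_sum_strict_anti[of I r d s] moran_sum_strict_anti[of I r s d] fin ne r s
      by (cases d s rule: linorder_cases) auto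
  next
    assume "d = s"
    then show "\<forall>i\<in>I. p i = r i powr d"
      using gibbs_equality[OF fin p(1) _ p(2) _ dsum] s r by (metis less_irrefl powr_gt_zero)
  qed
  finally show ?thesis .
qed

section \<open>Random sequences of letters\<close>

locale bernoulli_shift =
  fixes I :: "nat set" and p :: "nat \<Rightarrow> real"
  assumes finite_I: "finite I" and p_pos: "i \<in> I \<Longrightarrow> 0 < p i" and p_sum: "(\<Sum>i\<in>I. p i) = 1"
begin

definition letter_pmf :: "nat pmf" where
  "letter_pmf = embed_pmf (\<lambda>i. if i \<in> I then p i else 0)"

lemma pmf_letter: "pmf letter_pmf i = (if i \<in> I then p i else 0)"
  unfolding letter_pmf_def
proof (rule pmf_embed_pmf)
  have "(\<integral>\<^sup>+ x. ennreal (if x \<in> I then p x else 0) \<partial>count_space UNIV)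
      = (\<integral>\<^sup>+ x. ennreal (p x) \<partial>count_space I)"
    by (subst nn_integral_count_space_indicator)
      (auto intro!: nn_integral_cong simp: indicator_def)
  also have "\<dots> = ennreal (\<Sum>i\<in>I. p i)"
    using finite_I p_pos by (subst nn_integral_count_space_finite) (auto simp: less_imp_le)
  finally show "(\<integral>\<^sup>+ x. ennreal (if x \<in> I then p x else 0) \<partial>count_space UNIV) = 1"
    by (simp add: p_sum)
qed (use p_pos in \<open>auto simp: less_imp_le\<close>)

lemma set_letter: "set_pmf letter_pmf = I"
  using p_pos by (fastforce simp: set_pmf_iff pmf_letter split: if_splits)

definition M :: "nat stream measure" where
  "M = stream_space (measure_pmf letter_pmf)"

sublocale M: prob_space M
  unfolding M_def by (rule prob_space.prob_space_stream_space[OF prob_space_measure_pmf])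

lemma sets_M [measurable_cong]: "sets M = sets (stream_space (count_space UNIV))"
  unfolding M_def by (rule sets_stream_space_cong) simp

lemma space_M [simp]: "space M = UNIV"
  by (simp add: M_def space_stream_space)

lemma AE_streams: "AE \<omega> in M. \<omega> \<in> streams I"
proof -
  have "AE \<omega> in M. stream_all (\<lambda>i. i \<in> I) \<omega>"
    unfolding M_def
    by (rule prob_space.AE_stream_all[OF prob_space_measure_pmf]) (auto simp: AE_measure_pmf_iff set_letter)
  then show ?thesis
    by eventually_elim (auto simp: streams_iff_snth stream_all_def)
qed

lemma measurable_stake_set [measurable]: "{\<omega>. stake n \<omega> \<in> A} \<in> sets M"
proof -
  have "stake n \<in> measurable M (count_space UNIV)" by measurable
  then have "stake n -` A \<inter> space M \<in> sets M" by (rule measurable_sets) simp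
  then show ?thesis by (simp add: vimage_def)
qed

lemma measurable_stake_pred [measurable]: "Measurable.pred M (\<lambda>\<omega>. P (stake n \<omega>))"
  using measurable_stake_set[of n "{w. P w}"] by (simp add: pred_def)

lemma measurable_sdrop_M [measurable]: "sdrop n \<in> measurable M M"
  unfolding M_def by measurable

lemma measurable_Cons_M [measurable]: "(##) i \<in> measurable M M"
  unfolding M_def by measurable

lemma first_step:
  assumes A: "A \<in> sets M"
  shows "measure M A = (\<Sum>i\<in>I. p i * measure M {\<omega>. i ## \<omega> \<in> A})"
proof -
  have "emeasure M A = (\<integral>\<^sup>+i. emeasure M {\<omega>. i ## \<omega> \<in> A} \<partial>measure_pmf letter_pmf)"
    using prob_space.emeasure_stream_space[OF prob_space_measure_pmf, of A letter_pmf] A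
    by (simp add: M_def[symmetric])
  also have "\<dots> = (\<Sum>i\<in>I. emeasure M {\<omega>. i ## \<omega> \<in> A} * ennreal (p i))"
    using finite_I by (subst nn_integral_measure_pmf_support[of I])
      (auto simp: set_letter pmf_letter intro!: sum.cong)
  also have "\<dots> = (\<Sum>i\<in>I. ennreal (p i * measure M {\<omega>. i ## \<omega> \<in> A}))"
    using p_pos by (intro sum.cong refl)
      (auto simp: M.emeasure_eq_measure ennreal_mult[symmetric] less_imp_le mult.commute)
  also have "\<dots> = ennreal (\<Sum>i\<in>I. p i * measure M {\<omega>. i ## \<omega> \<in> A})"
    using p_pos by (intro sum_ennreal) (auto simp: less_imp_le)
  finally show ?thesis
    using p_pos by (simp add: M.emeasure_eq_measure sum_nonneg less_imp_le)
qed

text \<open>The expectation of a function of the first \<open>n\<close> letters, written as an iterated finite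
  sum.  The weights \<open>q\<close> are a parameter so that they can be tilted.\<close>

fun word_sum :: "(nat \<Rightarrow> real) \<Rightarrow> nat \<Rightarrow> (nat list \<Rightarrow> real) \<Rightarrow> real" where
  "word_sum q 0 f = f []"
| "word_sum q (Suc n) f = (\<Sum>i\<in>I. q i * word_sum q n (\<lambda>w. f (i # w)))"

lemma word_sum_mono:
  assumes "\<And>i. i \<in> I \<Longrightarrow> 0 \<le> q i" "\<And>w. length w = n \<Longrightarrow> set w \<subseteq> I \<Longrightarrow> f w \<le> g w"
  shows "word_sum q n f \<le> word_sum q n g"
  using assms(2)
proof (induction n arbitrary: f g)
  case (Suc n)
  then show ?case
    using assms(1) by (auto intro!: sum_mono mult_left_mono)
qed simp

lemma word_sum_cong:
  assumes "\<And>w. length w = n \<Longrightarrow> set w \<subseteq> I \<Longrightarrow> f w = g w"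
  shows "word_sum q n f = word_sum q n g"
  using assms
proof (induction n arbitrary: f g)
  case (Suc n)
  have "word_sum q n (\<lambda>w. f (i # w)) = word_sum q n (\<lambda>w. g (i # w))" if "i \<in> I" for i
    using that by (intro Suc.IH Suc.prems) auto
  then show ?case by simp
qed simp

lemma word_sum_add: "word_sum q n (\<lambda>w. f w + g w) = word_sum q n f + word_sum q n g"
  by (induction n arbitrary: f g) (simp_all add: distrib_left sum.distrib)

lemma word_sum_cmult: "word_sum q n (\<lambda>w. c * f w) = c * word_sum q n f"
  by (induction n arbitrary: f) (simp_all add: sum_distrib_left mult.left_commute)

lemma word_sum_const:
  assumes "(\<Sum>i\<in>I. q i) = 1" shows "word_sum q n (\<lambda>w. c) = c"
  by (induction n) (simp_all add: sum_distrib_right[symmetric] assms)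

text \<open>The change of measure: a density that is a product over letters is absorbed in the weights.\<close>

lemma word_sum_tilt:
  "word_sum (\<lambda>i. q i * h i) n f = word_sum q n (\<lambda>w. prod_list (map h w) * f w)"
proof (induction n arbitrary: f)
  case (Suc n)
  show ?case
    by (simp add: Suc word_sum_cmult[symmetric] mult.assoc)
qed simp

lemma measure_stake_eq_word_sum:
  "measure M {\<omega>. stake n \<omega> \<in> A} = word_sum p n (indicator A)"
proof (induction n arbitrary: A)
  case 0
  then show ?case using M.prob_space by (cases "[] \<in> A") auto
next
  case (Suc n)
  have "measure M {\<omega>. stake (Suc n) \<omega> \<in> A} = (\<Sum>i\<in>I. p i * measure M {\<omega>. stake n \<omega> \<in> {w. i # w \<in> A}})"
    by (subst first_step[OF measurable_stake_set]) simp
  also have "\<dots> = word_sum p (Suc n) (indicator A)"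
    unfolding Suc by (auto intro!: sum.cong word_sum_cong simp: indicator_def)
  finally show ?case .
qed

lemma word_sum_indicator:
  assumes "set w \<subseteq> I"
  shows "word_sum q (length w) (indicator {w}) = prod_list (map q w)"
  using assms
proof (induction w)
  case (Cons a w)
  have "word_sum q (length w) (\<lambda>u. indicator {a # w} (i # u))
      = (if i = a then prod_list (map q w) else 0)" for i
  proof (cases "i = a")
    case True
    then have "(\<lambda>u. indicator {a # w} (i # u)) = (indicator {w} :: nat list \<Rightarrow> real)"
      by (auto simp: indicator_def)
    then show ?thesis using Cons True by simp
  next
    case False
    then have "(\<lambda>u. indicator {a # w} (i # u)) = (\<lambda>u. (0 * 0 :: real))"
      by (auto simp: indicator_def)
    then show ?thesis using False word_sum_cmult[of q "length w" 0 "\<lambda>u. 0"] by simp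
  qed
  then show ?case
    using Cons.prems finite_I by (simp add: if_distrib[of "\<lambda>x. q _ * x"] cong: if_cong)
qed simp

lemma measure_cylinder:
  assumes "set w \<subseteq> I"
  shows "measure M {\<omega>. stake (length w) \<omega> = w} = prod_list (map p w)"
  using measure_stake_eq_word_sum[of "length w" "{w}"] word_sum_indicator[OF assms, of p] by simp

text \<open>Independence of past and future: \<open>first_step\<close> peels off the letters one at a time.\<close>

lemma markov:
  assumes B: "B \<in> sets M"
  shows "measure M {\<omega>. stake n \<omega> \<in> A \<and> sdrop n \<omega> \<in> B} = measure M {\<omega>. stake n \<omega> \<in> A} * measure M B"
proof (induction n arbitrary: A)
  case 0
  then show ?case using M.prob_space by (cases "[] \<in> A") auto
next
  case (Suc n)
  have meas: "{\<omega>. stake n \<omega> \<in> A \<and> sdrop n \<omega> \<in> B} \<in> sets M" for n A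
  proof -
    have "sdrop n -` B \<inter> space M \<in> sets M" by (rule measurable_sets[OF measurable_sdrop_M B])
    then have "{\<omega>. stake n \<omega> \<in> A} \<inter> sdrop n -` B \<in> sets M" by (intro sets.Int) auto
    also have "{\<omega>. stake n \<omega> \<in> A} \<inter> sdrop n -` B = {\<omega>. stake n \<omega> \<in> A \<and> sdrop n \<omega> \<in> B}" by auto
    finally show ?thesis .
  qed
  have "measure M {\<omega>. stake (Suc n) \<omega> \<in> A \<and> sdrop (Suc n) \<omega> \<in> B}
      = (\<Sum>i\<in>I. p i * measure M {\<omega>. stake n \<omega> \<in> {w. i # w \<in> A} \<and> sdrop n \<omega> \<in> B})"
    by (subst first_step[OF meas]) simp
  also have "\<dots> = (\<Sum>i\<in>I. p i * measure M {\<omega>. stake n \<omega> \<in> {w. i # w \<in> A}}) * measure M B"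
    unfolding Suc by (simp add: sum_distrib_right mult.assoc)
  also have "(\<Sum>i\<in>I. p i * measure M {\<omega>. stake n \<omega> \<in> {w. i # w \<in> A}}) = measure M {\<omega>. stake (Suc n) \<omega> \<in> A}"
    by (subst (2) first_step[OF measurable_stake_set]) simp
  finally show ?case .
qed

end

section \<open>The law of the iterated logarithm\<close>

definition lil :: "real \<Rightarrow> real" where
  "lil x = sqrt (2 * x * ln (ln x))"

lemma ln_ln_mono: "exp 1 \<le> x \<Longrightarrow> x \<le> y \<Longrightarrow> ln (ln x) \<le> ln (ln (y::real))"
proof -
  assume "exp 1 \<le> x" "x \<le> y"
  moreover have "0 < x" using \<open>exp 1 \<le> x\<close> exp_gt_zero[of "1::real"] by linarith
  moreover have "1 \<le> ln x" using \<open>exp 1 \<le> x\<close> \<open>0 < x\<close> by (simp add: ln_ge_iff)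
  moreover have "ln x \<le> ln y" using \<open>0 < x\<close> \<open>x \<le> y\<close> by simp
  ultimately show ?thesis by (intro ln_mono) linarith+
qed

lemma ln_ln_nonneg: "exp 1 \<le> (x::real) \<Longrightarrow> 0 \<le> ln (ln x)"
  using ln_ln_mono[of "exp 1" x] by simp

lemma lil_mono:
  assumes "exp 1 \<le> x" "x \<le> y" shows "lil x \<le> lil y"
proof -
  have "0 < x" using assms(1) exp_gt_zero[of "1::real"] by linarith
  then show ?thesis
    unfolding lil_def using assms ln_ln_mono[OF assms] ln_ln_nonneg[OF assms(1)]
    by (intro real_sqrt_le_mono mult_mono) auto
qed

context bernoulli_shift
begin

lemma sum_list_affine:
  "sum_list (map (\<lambda>i. c * X i - g) w) = c * sum_list (map X w) - real (length w) * (g::real)"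
  by (induction w) (simp_all add: algebra_simps)

text \<open>Ville's inequality for the supermartingale \<open>exp (Y \<omega>\<^sub>1 + \<dots> + Y \<omega>\<^sub>n)\<close>: conditioning on the
  first letter lowers the level \<open>a\<close> by \<open>Y \<omega>\<^sub>1\<close> and shortens the horizon.\<close>

lemma ville:
  assumes "(\<Sum>i\<in>I. p i * exp (Y i)) \<le> 1"
  shows "measure M {\<omega>. \<exists>n\<le>N. a \<le> sum_list (map Y (stake n \<omega>))} \<le> exp (- a)"
proof (induction N arbitrary: a)
  case 0
  show ?case
  proof (cases "a \<le> 0")
    case True
    then have "1 \<le> exp (- a)" by simp
    then show ?thesis using M.prob_le_1 order_trans by blast
  qed auto
next
  case (Suc N)
  show ?case
  proof (cases "a \<le> 0")
    case True
    then have "1 \<le> exp (- a)" by simp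
    then show ?thesis using M.prob_le_1 order_trans by blast
  next
    case False
    have meas: "{\<omega>. \<exists>n\<le>N. a \<le> sum_list (map Y (stake n \<omega>))} \<in> sets M" for N a
    proof -
      have "Measurable.pred M (\<lambda>\<omega>. \<exists>n\<in>{..N}. a \<le> sum_list (map Y (stake n \<omega>)))"
        by measurable
      then show ?thesis by (simp add: pred_def Bex_def)
    qed
    have "measure M {\<omega>. i ## \<omega> \<in> {\<omega>. \<exists>n\<le>Suc N. a \<le> sum_list (map Y (stake n \<omega>))}} \<le> exp (Y i - a)" for i
    proof -
      have "measure M {\<omega>. i ## \<omega> \<in> {\<omega>. \<exists>n\<le>Suc N. a \<le> sum_list (map Y (stake n \<omega>))}}
         \<le> measure M {\<omega>. \<exists>n\<le>N. a - Y i \<le> sum_list (map Y (stake n \<omega>))}"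
      proof (rule M.finite_measure_mono[OF subsetI meas])
        fix \<omega> assume "\<omega> \<in> {\<omega>. i ## \<omega> \<in> {\<omega>. \<exists>n\<le>Suc N. a \<le> sum_list (map Y (stake n \<omega>))}}"
        then obtain n where n: "n \<le> Suc N" "a \<le> sum_list (map Y (stake n (i ## \<omega>)))" by blast
        then obtain k where "n = Suc k" using False by (cases n) auto
        with n show "\<omega> \<in> {\<omega>. \<exists>n\<le>N. a - Y i \<le> sum_list (map Y (stake n \<omega>))}"
          by (intro CollectI exI[of _ k]) auto
      qed
      also have "\<dots> \<le> exp (- (a - Y i))" by (rule Suc.IH)
      finally show ?thesis by simp
    qed
    then have "measure M {\<omega>. \<exists>n\<le>Suc N. a \<le> sum_list (map Y (stake n \<omega>))}
      \<le> (\<Sum>i\<in>I. p i * exp (Y i - a))"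
      by (subst first_step[OF meas]) (intro sum_mono mult_left_mono, auto simp: p_pos less_imp_le)
    also have "\<dots> = exp (- a) * (\<Sum>i\<in>I. p i * exp (Y i))"
      by (simp add: sum_distrib_left exp_diff exp_minus field_simps)
    also have "\<dots> \<le> exp (- a) * 1"
      using assms by (intro mult_left_mono) auto
    finally show ?thesis by simp
  qed
qed

text \<open>Second-order Taylor expansion: the linear term has mean zero, and the remainder is bounded
  through \<open>\<bar>X i\<bar> \<le> B\<close>.\<close>

lemma exp_moment_upper:
  assumes "0 \<le> c" and B: "\<And>i. i \<in> I \<Longrightarrow> \<bar>X i\<bar> \<le> B"
    and mean: "(\<Sum>i\<in>I. p i * X i) = 0" and var: "(\<Sum>i\<in>I. p i * (X i)\<^sup>2) \<le> v"
  shows "(\<Sum>i\<in>I. p i * exp (c * X i)) \<le> exp (c\<^sup>2 * v / 2 * exp (c * B))"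
proof -
  have "exp (c * X i) \<le> 1 + c * X i + c\<^sup>2 / 2 * exp (c * B) * (X i)\<^sup>2" if "i \<in> I" for i
  proof -
    obtain t where t: "\<bar>t\<bar> \<le> \<bar>c * X i\<bar>"
      "exp (c * X i) = (\<Sum>m<2. (c * X i) ^ m / fact m) + (exp t / fact 2) * (c * X i)\<^sup>2"
      using Maclaurin_exp_le[of "c * X i" 2] by auto
    have "t \<le> c * B"
      using t(1) mult_left_mono[OF B[OF that] \<open>0 \<le> c\<close>] \<open>0 \<le> c\<close> by (simp add: abs_mult)
    then have "(exp t / fact 2) * (c * X i)\<^sup>2 \<le> (exp (c * B) / fact 2) * (c * X i)\<^sup>2"
      by (intro mult_right_mono divide_right_mono) auto
    also have "\<dots> = c\<^sup>2 / 2 * exp (c * B) * (X i)\<^sup>2"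
      by (simp add: power_mult_distrib)
    finally show ?thesis using t(2) by (simp add: lessThan_nat_numeral)
  qed
  then have "(\<Sum>i\<in>I. p i * exp (c * X i))
      \<le> (\<Sum>i\<in>I. p i * (1 + c * X i + c\<^sup>2 / 2 * exp (c * B) * (X i)\<^sup>2))"
    by (intro sum_mono mult_left_mono) (auto simp: p_pos less_imp_le)
  also have "\<dots> = (\<Sum>i\<in>I. p i + c * (p i * X i) + c\<^sup>2 / 2 * exp (c * B) * (p i * (X i)\<^sup>2))"
    by (intro sum.cong) (auto simp: algebra_simps)
  also have "\<dots> = 1 + c\<^sup>2 / 2 * exp (c * B) * (\<Sum>i\<in>I. p i * (X i)\<^sup>2)"
    by (simp only: sum.distrib sum_distrib_left[symmetric] p_sum mean)
  also have "\<dots> \<le> 1 + c\<^sup>2 / 2 * exp (c * B) * v"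
    using var by (intro add_left_mono mult_left_mono) auto
  also have "\<dots> \<le> exp (c\<^sup>2 / 2 * exp (c * B) * v)"
    by (rule exp_ge_add_one_self)
  finally show ?thesis by (simp add: mult_ac)
qed

lemma bounded_letters: "\<exists>B\<ge>0. \<forall>i\<in>I. \<bar>X i\<bar> \<le> (B::real)"
proof (intro exI conjI ballI)
  show "0 \<le> (\<Sum>i\<in>I. \<bar>X i\<bar>)" by (simp add: sum_nonneg)
  show "\<bar>X i\<bar> \<le> (\<Sum>i\<in>I. \<bar>X i\<bar>)" if "i \<in> I" for i
    using that finite_I by (intro member_le_sum) auto
qed

text \<open>On each geometric block Ville's inequality is used with the parameter
  \<open>lam\<close> that is optimal at the left end of the block; the failure probabilities are then
  at most \<open>(j * ln \<theta>) powr - (1 + \<eta>)\<close> and Borel--Cantelli applies.\<close>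

theorem lil_upper:
  assumes mean: "(\<Sum>i\<in>I. p i * X i) = 0" and var: "(\<Sum>i\<in>I. p i * (X i)\<^sup>2) \<le> v"
    and v: "0 < v" and \<epsilon>: "0 < \<epsilon>"
  shows "AE \<omega> in M. \<forall>\<^sub>F n in sequentially.
    sum_list (map X (stake n \<omega>)) \<le> (1 + \<epsilon>) * sqrt v * lil (real n)"
proof -
  define \<eta> where "\<eta> = min 1 \<epsilon> / 2"
  have \<eta>: "0 < \<eta>" "\<eta> < 1" "2 * \<eta> \<le> \<epsilon>" using \<epsilon> by (auto simp: \<eta>_def)
  have const: "(1 + \<eta>) * (2 + \<eta>) / 2 \<le> 1 + \<epsilon>"
  proof -
    have "(1 + \<eta>) * (2 + \<eta>) \<le> (1 + \<eta>) * 2 + 2 * \<eta>"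
      using \<eta> by (simp add: distrib_left mult_le_cancel_right1 distrib_right)
    then show ?thesis using \<eta> by simp
  qed
  define \<theta> where "\<theta> = 1 + \<eta>"
  have \<theta>: "1 < \<theta>" using \<eta> by (simp add: \<theta>_def)
  obtain B where B: "0 \<le> B" "\<And>i. i \<in> I \<Longrightarrow> \<bar>X i\<bar> \<le> B" using bounded_letters by blast
  define N where "N j = \<theta> ^ j" for j :: nat
  define L where "L j = ln (ln (N j))" for j
  define lam where "lam j = sqrt (2 * L j / (N j * v))" for j
  \<comment> \<open>\<open>g j\<close> exceeds the logarithmic moment of \<open>lam j * X\<close>, as \<open>lam j\<close> tends to zero\<close>
  define g where "g j = (lam j)\<^sup>2 * v / 2 * (1 + \<eta>)" for j
  define bad where "bad j = {\<omega>. \<exists>n\<le>nat \<lceil>N (Suc j)\<rceil>.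
      (1 + \<eta>) * L j \<le> sum_list (map (\<lambda>i. lam j * X i - g j) (stake n \<omega>))}" for j
  have N_pos: "0 < N j" for j using \<theta> by (simp add: N_def)
  have N_lim: "filterlim N at_top sequentially"
    unfolding N_def using \<theta> by real_asymp
  have "((\<lambda>x. sqrt (2 * ln (ln x) / (x * v))) \<longlongrightarrow> 0) at_top" using v by real_asymp
  from filterlim_compose[OF this N_lim] have lam_lim: "lam \<longlonglongrightarrow> 0"
    unfolding lam_def L_def by simp
  have "(\<lambda>j. exp (lam j * B)) \<longlonglongrightarrow> exp (0 * B)" by (intro tendsto_intros lam_lim)
  then have ev1: "\<forall>\<^sub>F j in sequentially. exp (lam j * B) < 1 + \<eta>"
    using \<eta> by (intro order_tendstoD) auto
  have ev2: "\<forall>\<^sub>F j in sequentially. exp 2 \<le> N j"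
    using N_lim by (simp add: filterlim_at_top)
  have bad_le: "\<forall>\<^sub>F j in sequentially. measure M (bad j) \<le> ln \<theta> powr (- (1 + \<eta>)) * real j powr (- (1 + \<eta>))"
    using ev1 ev2
  proof eventually_elim
    case (elim j)
    have lnN: "2 \<le> ln (N j)" using elim(2) N_pos[of j] by (simp add: ln_ge_iff)
    have "0 < L j" using lnN unfolding L_def by simp
    have lam_nonneg: "0 \<le> lam j" using \<open>0 < L j\<close> N_pos[of j] v by (simp add: lam_def)
    have "(\<Sum>i\<in>I. p i * exp (lam j * X i - g j)) = (\<Sum>i\<in>I. p i * exp (lam j * X i)) * exp (- g j)"
      by (simp add: sum_distrib_right exp_diff exp_minus divide_inverse mult.assoc)
    also have "\<dots> \<le> exp ((lam j)\<^sup>2 * v / 2 * exp (lam j * B)) * exp (- g j)"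
      using exp_moment_upper[OF lam_nonneg B(2) mean var] by (intro mult_right_mono) auto
    also have "\<dots> = exp ((lam j)\<^sup>2 * v / 2 * (exp (lam j * B) - (1 + \<eta>)))"
      by (simp add: exp_add[symmetric] g_def algebra_simps)
    also have "\<dots> \<le> 1"
      using elim(1) v by (simp add: mult_nonneg_nonpos)
    finally have "measure M (bad j) \<le> exp (- ((1 + \<eta>) * L j))"
      unfolding bad_def by (rule ville)
    also have "\<dots> = ln (N j) powr (- (1 + \<eta>))"
      using lnN by (simp add: powr_def L_def minus_mult_left[symmetric] del: minus_add_distrib)
    also have "ln (N j) = ln \<theta> * real j"
      unfolding N_def using \<theta> by (simp add: ln_realpow)
    also have "\<dots> powr (- (1 + \<eta>)) = ln \<theta> powr (- (1 + \<eta>)) * real j powr (- (1 + \<eta>))"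
      by (rule powr_mult)
    finally show ?case .
  qed
  have bad_sets: "bad j \<in> sets M" for j
  proof -
    have "Measurable.pred M (\<lambda>\<omega>. \<exists>n\<in>{..nat \<lceil>N (Suc j)\<rceil>}.
       (1 + \<eta>) * L j \<le> sum_list (map (\<lambda>i. lam j * X i - g j) (stake n \<omega>)))"
      by measurable
    then show ?thesis by (simp add: pred_def Bex_def bad_def)
  qed
  have "summable (\<lambda>j. measure M (bad j))"
  proof (rule summable_comparison_test_ev)
    show "\<forall>\<^sub>F j in sequentially. norm (measure M (bad j)) \<le> ln \<theta> powr (- (1 + \<eta>)) * real j powr (- (1 + \<eta>))"
      using bad_le by simp
    show "summable (\<lambda>j. ln \<theta> powr (- (1 + \<eta>)) * real j powr (- (1 + \<eta>)))"
      using \<eta> by (intro summable_mult) (simp add: summable_real_powr_iff)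
  qed
  then have "AE \<omega> in M. \<forall>\<^sub>F j in sequentially. \<omega> \<in> space M - bad j"
    by (intro borel_cantelli_AE1 bad_sets) (auto simp: M.emeasure_eq_measure)
  then show ?thesis
  proof eventually_elim
    case (elim \<omega>)
    have "\<forall>\<^sub>F j in sequentially. \<omega> \<notin> bad j \<and> exp 2 \<le> N j"
      using elim ev2 by eventually_elim auto
    then obtain J where J: "\<And>j. J \<le> j \<Longrightarrow> \<omega> \<notin> bad j \<and> exp 2 \<le> N j"
      by (auto simp: eventually_sequentially)
    have "sum_list (map X (stake n \<omega>)) \<le> (1 + \<epsilon>) * sqrt v * lil (real n)"
      if n: "nat \<lceil>N J\<rceil> \<le> n" for n
    proof -
      have nJ: "N J \<le> real n" using n by linarith
      have n_pos: "0 < real n" using nJ N_pos[of J] by linarith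
      \<comment> \<open>the block that contains \<open>n\<close>\<close>
      define j where "j = nat \<lfloor>log \<theta> (real n)\<rfloor>"
      have logJ: "real J \<le> log \<theta> (real n)"
        using nJ \<theta> n_pos by (simp add: N_def le_log_iff powr_realpow)
      have "J \<le> j" unfolding j_def using logJ by (simp add: le_nat_floor)
      have "real j \<le> log \<theta> (real n)" "log \<theta> (real n) < real (Suc j)"
        unfolding j_def using logJ by linarith+
      then have Nn: "N j \<le> real n" "real n < N (Suc j)"
        using \<theta> n_pos unfolding N_def
        by (simp_all add: le_log_iff log_less_iff powr_realpow[symmetric] del: power_Suc of_nat_Suc)
      have "\<omega> \<notin> bad j" and N2: "exp 2 \<le> N j" using J[OF \<open>J \<le> j\<close>] by auto
      have lnN: "2 \<le> ln (N j)" using N2 N_pos[of j] by (simp add: ln_ge_iff)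
      have L_pos: "0 < L j" using lnN unfolding L_def by simp
      have lam_pos: "0 < lam j" using L_pos N_pos[of j] v by (simp add: lam_def)
      have "n \<le> nat \<lceil>N (Suc j)\<rceil>" using Nn by linarith
      with \<open>\<omega> \<notin> bad j\<close> have "sum_list (map (\<lambda>i. lam j * X i - g j) (stake n \<omega>)) < (1 + \<eta>) * L j"
        unfolding bad_def by fastforce
      then have "lam j * sum_list (map X (stake n \<omega>)) < (1 + \<eta>) * L j + real n * g j"
        by (simp add: sum_list_affine)
      also have "\<dots> \<le> (1 + \<eta>) * L j + (\<theta> * N j) * g j"
        using Nn v \<eta> by (intro add_left_mono mult_right_mono) (auto simp: N_def g_def)
      also have "(\<theta> * N j) * g j = \<theta> * (1 + \<eta>) * L j"
        unfolding g_def lam_def using L_pos N_pos[of j] v by simp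
      also have "(1 + \<eta>) * L j + \<theta> * (1 + \<eta>) * L j = ((1 + \<eta>) * (2 + \<eta>) / 2) * (2 * L j)"
        by (simp add: \<theta>_def algebra_simps)
      also have "2 * L j = lam j * (sqrt v * lil (N j))"
      proof -
        have "lam j * (sqrt v * lil (N j)) = sqrt (2 * L j / (N j * v) * (v * (2 * N j * L j)))"
          unfolding lam_def lil_def L_def by (simp only: real_sqrt_mult)
        also have "2 * L j / (N j * v) * (v * (2 * N j * L j)) = (2 * L j)\<^sup>2"
          using N_pos[of j] v by (simp add: power2_eq_square)
        finally show ?thesis using L_pos by (simp only: real_sqrt_abs)
      qed
      finally have "lam j * sum_list (map X (stake n \<omega>))
          < lam j * (((1 + \<eta>) * (2 + \<eta>) / 2) * (sqrt v * lil (N j)))"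
        by (simp add: mult.left_commute)
      then have "sum_list (map X (stake n \<omega>)) < ((1 + \<eta>) * (2 + \<eta>) / 2) * (sqrt v * lil (N j))"
        using lam_pos by simp
      also have "\<dots> \<le> (1 + \<epsilon>) * (sqrt v * lil (real n))"
      proof (intro mult_mono const lil_mono Nn order_refl)
        show "exp 1 \<le> N j" using N2 by (rule order_trans[rotated]) simp
        have "0 \<le> lil (N j)" unfolding lil_def using L_pos N_pos[of j] by (simp add: L_def)
        then show "0 \<le> sqrt v * lil (N j)" "0 \<le> lil (N j)" using v by auto
      qed (use v \<epsilon> in auto)
      finally show ?thesis by (simp add: mult.assoc)
    qed
    then show ?case unfolding eventually_sequentially by blast
  qed
qed

end

lemma tendsto_exp_quotient_1: "((\<lambda>c. (exp (c * x) - 1) / c) \<longlongrightarrow> (x::real)) (at_right 0)"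
  by (cases x "0::real" rule: linorder_cases) (real_asymp | simp)+

lemma tendsto_exp_quotient_2:
  "((\<lambda>c. (exp (c * x) - 1 - c * x) / c\<^sup>2) \<longlongrightarrow> (x::real)\<^sup>2 / 2) (at_right 0)"
proof (cases x "0::real" rule: linorder_cases)
  case less
  then show ?thesis by (real_asymp simp: power2_eq_square)
next
  case greater
  then show ?thesis by (real_asymp simp: power2_eq_square)
qed simp

context bernoulli_shift
begin

text \<open>The offset \<open>c\<close> collects the letters already read, which lets the induction remove the first
  letter.\<close>

lemma word_sum_variance:
  assumes "(\<Sum>i\<in>I. q i) = 1" "(\<Sum>i\<in>I. q i * Y i) = 0"
  shows "word_sum q n (\<lambda>w. (c + sum_list (map Y w))\<^sup>2) = c\<^sup>2 + real n * (\<Sum>i\<in>I. q i * (Y i)\<^sup>2)"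
proof (induction n arbitrary: c)
  case (Suc n)
  let ?V = "\<Sum>i\<in>I. q i * (Y i)\<^sup>2"
  have "word_sum q (Suc n) (\<lambda>w. (c + sum_list (map Y w))\<^sup>2) = (\<Sum>i\<in>I. q i * ((c + Y i)\<^sup>2 + real n * ?V))"
    using Suc[of "c + Y _"] by (simp add: add.assoc)
  also have "\<dots> = (\<Sum>i\<in>I. (c\<^sup>2 + real n * ?V) * q i + (2 * c) * (q i * Y i) + q i * (Y i)\<^sup>2)"
    by (intro sum.cong) (auto simp: power2_eq_square algebra_simps)
  also have "\<dots> = c\<^sup>2 + real n * ?V + ?V"
    by (simp only: sum.distrib sum_distrib_left[symmetric] assms) simp
  finally show ?case by (simp add: algebra_simps)
qed simp

text \<open>Cramer's lower bound for moderate deviations.  Under the tilted weights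
  \<open>p i * exp (c * X i) / Z\<close> the sum of \<open>n\<close> letters concentrates near \<open>n * c * v\<close>, by
  Chebyshev; on that event the density of the tilted weights is at most
  \<open>exp ((1 + \<eta>) * n * c\<^sup>2 * v / 2)\<close>.\<close>

lemma moderate_deviation_lower:
  assumes mean: "(\<Sum>i\<in>I. p i * X i) = 0" and var: "(\<Sum>i\<in>I. p i * (X i)\<^sup>2) = v"
    and v: "0 < v" and \<eta>: "0 < \<eta>"
  shows "\<exists>c0>0. \<exists>C. \<forall>c n. 0 < c \<longrightarrow> c < c0 \<longrightarrow> C \<le> real n * c\<^sup>2 \<longrightarrow>
    exp (- ((1 + \<eta>) * (real n * c\<^sup>2 * v / 2))) / 2
      \<le> measure M {\<omega>. (1 - \<eta>) * (real n * c * v) \<le> sum_list (map X (stake n \<omega>))}"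
proof -
  \<comment> \<open>room for the errors in the tilted mean, in \<open>ln Z\<close> and in Chebyshev's inequality\<close>
  define e where "e = \<eta> / 8"
  have e: "0 < e" using \<eta> by (simp add: e_def)
  obtain B where B: "0 \<le> B" "\<And>i. i \<in> I \<Longrightarrow> \<bar>X i\<bar> \<le> B" using bounded_letters by blast
  define Z where "Z c = (\<Sum>i\<in>I. p i * exp (c * X i))" for c
  define a where "a = v / 2 * (1 - e / 2)"
  have "((\<lambda>c. \<Sum>i\<in>I. p i * ((exp (c * X i) - 1 - c * X i) / c\<^sup>2)) \<longlongrightarrow> (\<Sum>i\<in>I. p i * ((X i)\<^sup>2 / 2))) (at_right 0)"
    by (intro tendsto_sum tendsto_mult tendsto_const tendsto_exp_quotient_2)
  also have "(\<Sum>i\<in>I. p i * ((X i)\<^sup>2 / 2)) = v / 2"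
    by (simp add: var[symmetric] sum_divide_distrib)
  finally have lim2: "((\<lambda>c. \<Sum>i\<in>I. p i * ((exp (c * X i) - 1 - c * X i) / c\<^sup>2)) \<longlongrightarrow> v / 2) (at_right 0)" .
  have "((\<lambda>c. \<Sum>i\<in>I. p i * X i * ((exp (c * X i) - 1) / c)) \<longlongrightarrow> (\<Sum>i\<in>I. p i * X i * X i)) (at_right 0)"
    by (intro tendsto_sum tendsto_mult tendsto_const tendsto_exp_quotient_1)
  also have "(\<Sum>i\<in>I. p i * X i * X i) = v"
    by (simp add: var[symmetric] power2_eq_square mult.assoc)
  finally have lim1: "((\<lambda>c. \<Sum>i\<in>I. p i * X i * ((exp (c * X i) - 1) / c)) \<longlongrightarrow> v) (at_right 0)" .
  have "(Z \<longlongrightarrow> (\<Sum>i\<in>I. p i * exp (0 * X i))) (at_right 0)"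
    unfolding Z_def by (intro tendsto_intros)
  then have limZ: "(Z \<longlongrightarrow> 1) (at_right 0)" by (simp add: p_sum)
  have ev_Z: "\<forall>\<^sub>F c in at_right 0. 1 + a * c\<^sup>2 \<le> Z c"
  proof -
    have "a < v / 2" using e v by (simp add: a_def algebra_simps)
    from order_tendstoD(1)[OF lim2 this] eventually_at_right_less[of 0] show ?thesis
    proof eventually_elim
      case (elim c)
      have "(\<Sum>i\<in>I. p i * ((exp (c * X i) - 1 - c * X i) / c\<^sup>2)) * c\<^sup>2
          = (\<Sum>i\<in>I. p i * exp (c * X i) - p i - c * (p i * X i))"
        using elim(2) unfolding sum_distrib_right by (intro sum.cong) (auto simp: field_simps)
      also have "\<dots> = Z c - 1"
        by (simp only: sum_subtractf sum_distrib_left[symmetric] p_sum mean Z_def)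
      finally have "Z c - 1 = (\<Sum>i\<in>I. p i * ((exp (c * X i) - 1 - c * X i) / c\<^sup>2)) * c\<^sup>2" by simp
      also have "\<dots> \<ge> a * c\<^sup>2" using elim(1) by (intro mult_right_mono) auto
      finally show ?case by simp
    qed
  qed
  have ev_ln: "\<forall>\<^sub>F c in at_right 0. v / 2 * (1 - e) * c\<^sup>2 \<le> ln (1 + a * c\<^sup>2)"
  proof -
    have lim: "((\<lambda>c. ln (1 + a * c\<^sup>2) / c\<^sup>2) \<longlongrightarrow> a) (at_right 0)"
      by (cases a "0::real" rule: linorder_cases) (real_asymp | simp)+
    have "v / 2 * (1 - e) < a" unfolding a_def using e v by (intro mult_strict_left_mono) auto
    from order_tendstoD(1)[OF lim this] eventually_at_right_less[of 0] show ?thesis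
      by eventually_elim (simp add: field_simps)
  qed
  have ev_mean: "\<forall>\<^sub>F c in at_right 0. \<bar>(\<Sum>i\<in>I. p i * X i * ((exp (c * X i) - 1) / c)) / Z c - v\<bar> < e * v"
  proof -
    have "((\<lambda>c. (\<Sum>i\<in>I. p i * X i * ((exp (c * X i) - 1) / c)) / Z c) \<longlongrightarrow> v / 1) (at_right 0)"
      by (intro tendsto_divide lim1 limZ) simp
    from tendstoD[OF this, of "e * v"] show ?thesis
      using e v by (simp add: dist_real_def)
  qed
  have ev_pos: "\<forall>\<^sub>F c in at_right 0. 0 < 1 + a * c\<^sup>2"
  proof -
    have "((\<lambda>c. 1 + a * c\<^sup>2) \<longlongrightarrow> 1 + a * 0\<^sup>2) (at_right 0)" by (intro tendsto_intros)
    from order_tendstoD(1)[OF this, of 0] show ?thesis by simp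
  qed
  have "\<forall>\<^sub>F c in at_right 0. exp (v / 2 * (1 - e) * c\<^sup>2) \<le> Z c \<and>
     \<bar>(\<Sum>i\<in>I. p i * X i * ((exp (c * X i) - 1) / c)) / Z c - v\<bar> < e * v"
    using ev_Z ev_ln ev_mean ev_pos
  proof eventually_elim
    case (elim c)
    have "exp (v / 2 * (1 - e) * c\<^sup>2) \<le> exp (ln (1 + a * c\<^sup>2))" using elim(2) by simp
    also have "\<dots> = 1 + a * c\<^sup>2" using elim(4) by simp
    finally show ?case using elim(1,3) by simp
  qed
  then obtain c0 where c0: "0 < c0" "\<And>c. 0 < c \<Longrightarrow> c < c0 \<Longrightarrow> exp (v / 2 * (1 - e) * c\<^sup>2) \<le> Z c \<and>
     \<bar>(\<Sum>i\<in>I. p i * X i * ((exp (c * X i) - 1) / c)) / Z c - v\<bar> < e * v"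
    unfolding eventually_at_right_field by auto
  \<comment> \<open>makes Chebyshev's bound at most \<open>1 / 2\<close>\<close>
  define C where "C = 2 * B\<^sup>2 / (e * v)\<^sup>2 + 1"
  show ?thesis
  proof (rule exI[of _ c0], rule conjI[OF c0(1)], rule exI[of _ C], intro allI impI)
    fix c :: real and n :: nat
    assume c: "0 < c" "c < c0" and n: "C \<le> real n * c\<^sup>2"
    note Zc = c0(2)[OF c]
    have "0 < real n * c\<^sup>2" using n unfolding C_def by (smt (verit) zero_le_divide_iff zero_le_power2)
    then have n_pos: "0 < real n" using c by (simp add: zero_less_mult_iff)
    have Z_pos: "0 < Z c" using Zc exp_gt_zero less_le_trans by blast
    define q where "q i = p i * (exp (c * X i) / Z c)" for i
    define \<mu> where "\<mu> = (\<Sum>i\<in>I. q i * X i)"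
    have q_sum: "(\<Sum>i\<in>I. q i) = 1"
      using Z_pos by (simp add: q_def sum_divide_distrib[symmetric] Z_def[symmetric])
    have q_nonneg: "0 \<le> q i" if "i \<in> I" for i
      using Z_pos p_pos[OF that] by (simp add: q_def)
    have \<mu>: "\<bar>\<mu> - c * v\<bar> < e * (c * v)"
    proof -
      have "c * ((\<Sum>i\<in>I. p i * X i * ((exp (c * X i) - 1) / c)) / Z c)
          = (\<Sum>i\<in>I. q i * X i - (p i * X i) / Z c)"
        using c unfolding sum_distrib_left sum_divide_distrib q_def
        by (intro sum.cong) (auto simp: diff_divide_distrib algebra_simps)
      also have "\<dots> = \<mu>"
        by (simp only: sum_subtractf sum_divide_distrib[symmetric] mean \<mu>_def)
      finally have "\<mu> - c * v = c * ((\<Sum>i\<in>I. p i * X i * ((exp (c * X i) - 1) / c)) / Z c - v)"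
        by (simp only: right_diff_distrib)
      then have "\<bar>\<mu> - c * v\<bar> = c * \<bar>(\<Sum>i\<in>I. p i * X i * ((exp (c * X i) - 1) / c)) / Z c - v\<bar>"
        using c by (simp only: abs_mult)
      also have "\<dots> < c * (e * v)" using Zc c by (intro mult_strict_left_mono) auto
      finally show ?thesis by (simp add: mult_ac)
    qed
    define V where "V = (\<Sum>i\<in>I. q i * (X i - \<mu>)\<^sup>2)"
    have "V = (\<Sum>i\<in>I. q i * (X i)\<^sup>2 - (2 * \<mu>) * (q i * X i) + \<mu>\<^sup>2 * q i)"
      unfolding V_def by (intro sum.cong) (auto simp: power2_eq_square algebra_simps)
    also have "\<dots> = (\<Sum>i\<in>I. q i * (X i)\<^sup>2) - (2 * \<mu>) * \<mu> + \<mu>\<^sup>2 * 1"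
      by (simp only: sum_subtractf sum.distrib sum_distrib_left[symmetric] q_sum \<mu>_def)
    also have "\<dots> \<le> (\<Sum>i\<in>I. q i * (X i)\<^sup>2)" by (simp add: power2_eq_square)
    also have "\<dots> \<le> (\<Sum>i\<in>I. q i * B\<^sup>2)"
      using B q_nonneg by (intro sum_mono mult_left_mono) (auto intro!: power2_le_iff_abs_le[THEN iffD2])
    also have "\<dots> = B\<^sup>2" by (simp add: sum_distrib_right[symmetric] q_sum)
    finally have V: "V \<le> B\<^sup>2" .
    define h where "h = e * (real n * c * v)"
    have h: "0 < h" using e n_pos c v by (simp add: h_def)
    define G where "G = {w. \<bar>sum_list (map X w) - real n * \<mu>\<bar> < h}"
    have "1 = word_sum q n (\<lambda>w. 1)" by (simp add: word_sum_const q_sum)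
    also have "\<dots> \<le> word_sum q n (\<lambda>w. indicator G w + (1 / h\<^sup>2) * (0 + sum_list (map (\<lambda>i. 1 * X i - \<mu>) w))\<^sup>2)"
    proof (intro word_sum_mono q_nonneg)
      fix w :: "nat list" assume w: "length w = n"
      show "1 \<le> indicator G w + 1 / h\<^sup>2 * (0 + sum_list (map (\<lambda>i. 1 * X i - \<mu>) w))\<^sup>2"
      proof (cases "w \<in> G")
        case False
        then have "h \<le> \<bar>sum_list (map X w) - real n * \<mu>\<bar>" by (simp add: G_def)
        then have "h\<^sup>2 \<le> (sum_list (map X w) - real n * \<mu>)\<^sup>2"
          using h by (metis abs_ge_zero less_imp_le power2_abs power_mono)
        then show ?thesis using h False unfolding sum_list_affine w by (simp add: field_simps)
      qed simp
    qed
    also have "\<dots> = word_sum q n (indicator G) + (1 / h\<^sup>2) * (0\<^sup>2 + real n * V)"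
    proof -
      have "(\<Sum>i\<in>I. q i * (1 * X i - \<mu>)) = (\<Sum>i\<in>I. q i * X i - \<mu> * q i)"
        by (intro sum.cong) (auto simp: algebra_simps)
      also have "\<dots> = 0"
        by (simp only: sum_subtractf sum_distrib_left[symmetric] q_sum \<mu>_def)
      finally show ?thesis
        unfolding word_sum_add word_sum_cmult V_def
        by (subst word_sum_variance) (simp_all add: q_sum)
    qed
    also have "\<dots> \<le> word_sum q n (indicator G) + 1 / 2"
    proof -
      have "2 * B\<^sup>2 \<le> (e * v)\<^sup>2 * (real n * c\<^sup>2)"
      proof -
        have "2 * B\<^sup>2 / (e * v)\<^sup>2 \<le> real n * c\<^sup>2" using n by (simp add: C_def)
        then show ?thesis using e v by (simp add: pos_divide_le_eq mult.commute)
      qed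
      then have "(2 * B\<^sup>2) * real n \<le> ((e * v)\<^sup>2 * (real n * c\<^sup>2)) * real n"
        using n_pos by (intro mult_right_mono) auto
      also have "\<dots> = h\<^sup>2" by (simp add: h_def power2_eq_square)
      finally have "2 * (real n * B\<^sup>2) \<le> h\<^sup>2" by (simp add: mult_ac)
      moreover have "real n * V \<le> real n * B\<^sup>2" using V by (intro mult_left_mono) auto
      ultimately have "2 * (real n * V) \<le> h\<^sup>2" by linarith
      then show ?thesis using h by (simp add: field_simps)
    qed
    finally have half: "1 / 2 \<le> word_sum q n (indicator G)" by simp
    have low: "(1 - \<eta>) * (real n * c * v) \<le> sum_list (map X w)"
      and up: "sum_list (map X w) \<le> (1 + 2 * e) * (real n * c * v)" if "w \<in> G" for w
    proof -
      have \<mu>n: "\<bar>real n * \<mu> - real n * c * v\<bar> \<le> h"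
      proof -
        have "real n * \<mu> - real n * c * v = real n * (\<mu> - c * v)"
          by (simp add: right_diff_distrib)
        then have "\<bar>real n * \<mu> - real n * c * v\<bar> = real n * \<bar>\<mu> - c * v\<bar>"
          by (simp only: abs_mult)
        also have "\<dots> \<le> real n * (e * (c * v))" using \<mu> by (intro mult_left_mono) auto
        finally show ?thesis by (simp add: h_def mult_ac)
      qed
      have w: "\<bar>sum_list (map X w) - real n * \<mu>\<bar> < h" using that by (simp add: G_def)
      from \<mu>n w have "\<bar>sum_list (map X w) - real n * c * v\<bar> \<le> 2 * h" by linarith
      moreover have "2 * h \<le> \<eta> * (real n * c * v)"
        unfolding h_def e_def using n_pos c v \<eta> by simp
      ultimately show "(1 - \<eta>) * (real n * c * v) \<le> sum_list (map X w)"
        "sum_list (map X w) \<le> (1 + 2 * e) * (real n * c * v)"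
        by (auto simp: h_def algebra_simps abs_le_iff)
    qed
    define T where "T = real n * c\<^sup>2 * v / 2"
    have T: "0 \<le> T" using v by (simp add: T_def)
    have dens: "prod_list (map (\<lambda>i. exp (c * X i) / Z c) w) * indicator G w
        \<le> exp ((1 + \<eta>) * T) * indicator {w. (1 - \<eta>) * (real n * c * v) \<le> sum_list (map X w)} w"
      if "length w = n" for w
    proof (cases "w \<in> G")
      case True
      have "prod_list (map (\<lambda>i. exp (c * X i) / Z c) w) = exp (c * sum_list (map X w)) / Z c ^ length w"
        by (induction w) (simp_all add: exp_add distrib_left)
      also have "\<dots> \<le> exp (c * ((1 + 2 * e) * (real n * c * v))) / exp (v / 2 * (1 - e) * c\<^sup>2) ^ length w"
        using Zc c up[OF True] by (intro frac_le power_mono) auto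
      also have "\<dots> = exp (c * ((1 + 2 * e) * (real n * c * v)) - real n * (v / 2 * (1 - e) * c\<^sup>2))"
        by (simp only: exp_of_nat_mult[symmetric] exp_diff that)
      also have "c * ((1 + 2 * e) * (real n * c * v)) - real n * (v / 2 * (1 - e) * c\<^sup>2) = (1 + 5 * e) * T"
        by (simp add: T_def power2_eq_square field_simps)
      also have "exp ((1 + 5 * e) * T) \<le> exp ((1 + \<eta>) * T)"
        using T \<eta> by (intro exp_le_cancel_iff[THEN iffD2] mult_right_mono) (auto simp: e_def)
      finally show ?thesis using True low[OF True] by simp
    qed simp
    have "1 / 2 \<le> word_sum p n (\<lambda>w. prod_list (map (\<lambda>i. exp (c * X i) / Z c) w) * indicator G w)"
      using half unfolding q_def word_sum_tilt .
    also have "\<dots> \<le> word_sum p n (\<lambda>w. exp ((1 + \<eta>) * T) *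
        indicator {w. (1 - \<eta>) * (real n * c * v) \<le> sum_list (map X w)} w)"
      by (intro word_sum_mono dens) (auto simp: p_pos less_imp_le)
    also have "\<dots> = exp ((1 + \<eta>) * T) * word_sum p n (indicator {w. (1 - \<eta>) * (real n * c * v) \<le> sum_list (map X w)})"
      by (rule word_sum_cmult)
    also have "\<dots> = exp ((1 + \<eta>) * T) *
        measure M {\<omega>. (1 - \<eta>) * (real n * c * v) \<le> sum_list (map X (stake n \<omega>))}"
      using measure_stake_eq_word_sum[of n "{w. (1 - \<eta>) * (real n * c * v) \<le> sum_list (map X w)}"] by simp
    finally have "exp (- ((1 + \<eta>) * T)) * (1 / 2) \<le> exp (- ((1 + \<eta>) * T)) * (exp ((1 + \<eta>) * T) *
        measure M {\<omega>. (1 - \<eta>) * (real n * c * v) \<le> sum_list (map X (stake n \<omega>))})"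
      by (rule mult_left_mono) simp
    then show "exp (- ((1 + \<eta>) * (real n * c\<^sup>2 * v / 2))) / 2
      \<le> measure M {\<omega>. (1 - \<eta>) * (real n * c * v) \<le> sum_list (map X (stake n \<omega>))}"
      unfolding T_def[symmetric] mult.assoc[symmetric, of "exp _"] exp_add[symmetric] by simp
  qed
qed


text \<open>Disjoint blocks of letters are independent, so the probability that no block from \<open>J\<close> to
  \<open>J + n - 1\<close> succeeds is a product of factors \<open>1 - Q j \<le> exp (- Q j)\<close>.\<close>

lemma borel_cantelli_blocks:
  fixes pos :: "nat \<Rightarrow> nat"
  assumes pos: "mono pos"
    and div: "\<not> summable (\<lambda>j. measure M {\<omega>. stake (pos (Suc j) - pos j) \<omega> \<in> A j})"
  shows "AE \<omega> in M. \<exists>\<^sub>F j in sequentially. stake (pos (Suc j) - pos j) (sdrop (pos j) \<omega>) \<in> A j"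
proof -
  define len where "len j = pos (Suc j) - pos j" for j
  define Q where "Q j = measure M {\<omega>. stake (len j) \<omega> \<in> A j}" for j
  define F where "F J n = {\<omega>. \<forall>j\<in>{J..<n}. stake (len j) (sdrop (pos j) \<omega>) \<notin> A j}" for J n
  have F_stake: "F J n = {\<omega>. stake (pos n) \<omega> \<in> {w. \<forall>j\<in>{J..<n}. take (len j) (drop (pos j) w) \<notin> A j}}" for J n
  proof -
    have eq: "take (len j) (drop (pos j) (stake (pos n) \<omega>)) = stake (len j) (sdrop (pos j) \<omega>)"
      if "j < n" for j \<omega>
    proof -
      have "pos (Suc j) \<le> pos n" using that by (intro monoD[OF pos]) auto
      then have "min (len j) (pos n - pos j) = len j" by (simp add: len_def)
      then show ?thesis by (simp only: take_stake drop_stake)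
    qed
    have "(\<forall>j\<in>{J..<n}. stake (len j) (sdrop (pos j) \<omega>) \<notin> A j)
        \<longleftrightarrow> (\<forall>j\<in>{J..<n}. take (len j) (drop (pos j) (stake (pos n) \<omega>)) \<notin> A j)" for \<omega>
      by (intro ball_cong refl) (metis eq atLeastLessThan_iff)
    then show ?thesis by (simp only: F_def mem_Collect_eq)
  qed
  have F_sets: "F J n \<in> sets M" for J n
    unfolding F_stake by (rule measurable_stake_set)
  have F_Suc: "measure M (F J (Suc n)) = measure M (F J n) * (1 - Q n)" if "J \<le> n" for J n
  proof -
    have eq: "F J (Suc n) = {\<omega>. stake (pos n) \<omega> \<in> {w. \<forall>j\<in>{J..<n}. take (len j) (drop (pos j) w) \<notin> A j} \<and>
        sdrop (pos n) \<omega> \<in> {\<omega>. stake (len n) \<omega> \<in> - A n}}"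
      using that F_stake[of J n] by (auto simp: F_def atLeastLessThanSuc)
    have "measure M (F J (Suc n)) = measure M (F J n) * measure M {\<omega>. stake (len n) \<omega> \<in> - A n}"
      unfolding eq F_stake[of J n] by (rule markov[OF measurable_stake_set])
    also have "measure M {\<omega>. stake (len n) \<omega> \<in> - A n} = 1 - Q n"
    proof -
      have "{\<omega>. stake (len n) \<omega> \<in> - A n} = space M - {\<omega>. stake (len n) \<omega> \<in> A n}" by auto
      then show ?thesis unfolding Q_def by (simp only: M.prob_compl[OF measurable_stake_set])
    qed
    finally show ?thesis .
  qed
  have Q: "0 \<le> Q j" "Q j \<le> 1" for j by (auto simp: Q_def)
  have F_le: "measure M (F J (J + n)) \<le> exp (- (\<Sum>j<n. Q (J + j)))" for J n
  proof (induction n)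
    case (Suc n)
    have "measure M (F J (Suc (J + n))) = measure M (F J (J + n)) * (1 - Q (J + n))"
      by (rule F_Suc) simp
    also have "\<dots> \<le> exp (- (\<Sum>j<n. Q (J + j))) * exp (- Q (J + n))"
      using Suc Q exp_ge_add_one_self[of "- Q (J + n)"] by (intro mult_mono) auto
    finally show ?case by (simp add: exp_add[symmetric])
  qed simp
  have "measure M (\<Inter>n. F J (J + n)) = 0" for J
  proof (rule ccontr)
    define c where "c = measure M (\<Inter>n. F J (J + n))"
    assume "measure M (\<Inter>n. F J (J + n)) \<noteq> 0"
    then have c: "0 < c" by (simp add: c_def zero_less_measure_iff)
    have "summable (\<lambda>j. Q (j + J))"
    proof (rule summableI_nonneg_bounded)
      fix n
      have "c \<le> measure M (F J (J + n))"
        unfolding c_def by (intro M.finite_measure_mono F_sets) auto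
      also note F_le
      finally have "ln c \<le> - (\<Sum>j<n. Q (J + j))"
        using c by (metis exp_gt_zero ln_exp ln_le_cancel_iff)
      then show "(\<Sum>j<n. Q (j + J)) \<le> - ln c" by (simp add: add.commute)
    qed (rule Q)
    then have "summable Q" by (rule summable_iff_shift[THEN iffD1])
    with div show False by (simp add: Q_def[abs_def] len_def)
  qed
  then have "(\<Inter>n. F J (J + n)) \<in> null_sets M" for J
    by (intro null_setsI) (auto simp: M.emeasure_eq_measure intro!: F_sets)
  then have "AE \<omega> in M. \<omega> \<notin> (\<Inter>n. F J (J + n))" for J
    by (rule AE_not_in)
  then have "AE \<omega> in M. \<forall>J. \<omega> \<notin> (\<Inter>n. F J (J + n))"
    by (simp add: AE_all_countable)
  then show ?thesis
  proof eventually_elim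
    case (elim \<omega>)
    have "\<exists>j\<ge>J. stake (pos (Suc j) - pos j) (sdrop (pos j) \<omega>) \<in> A j" for J
      using elim[rule_format, of J] by (auto simp: F_def len_def)
    then show ?case unfolding frequently_sequentially by blast
  qed
qed

text \<open>Over the last block of length \<open>(q - 1) * q ^ j\<close> before time
  \<open>q ^ (j + 1)\<close> the increment is infinitely often of the required size, and for large \<open>q\<close> the
  earlier letters are negligible by the upper half.\<close>

theorem lil_lower:
  assumes mean: "(\<Sum>i\<in>I. p i * X i) = 0" and var: "(\<Sum>i\<in>I. p i * (X i)\<^sup>2) = v"
    and v: "0 < v" and \<epsilon>: "0 < \<epsilon>"
  shows "AE \<omega> in M. \<exists>\<^sub>F n in sequentially.
    (1 - \<epsilon>) * sqrt v * lil (real n) \<le> sum_list (map X (stake n \<omega>))"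
proof -
  define \<eta> where "\<eta> = min 1 \<epsilon> / 4"
  have \<eta>: "0 < \<eta>" "\<eta> \<le> 1 / 4" "4 * \<eta> \<le> \<epsilon>" using \<epsilon> by (auto simp: \<eta>_def)
  obtain q0 :: nat where q0: "(3 / \<eta>)\<^sup>2 \<le> real q0" using real_arch_simple by blast
  define q where "q = q0 + 2"
  have q: "2 \<le> q" "3 / \<eta> \<le> sqrt (real q)"
    using q0 \<eta> by (auto simp: q_def intro!: real_le_rsqrt)
  \<comment> \<open>cancels the loss \<open>1 + \<eta>\<close> in the exponent, so that block \<open>j\<close> succeeds with
    probability of order \<open>1 / j\<close>\<close>
  define k where "k = 1 / (1 + \<eta>)"
  have k: "0 < k" "1 - \<eta> \<le> k" "k < 1"
    using \<eta> by (auto simp: k_def field_simps)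
  have const: "1 - \<epsilon> \<le> (1 - \<eta>) * sqrt (k * (1 - 1 / q)) - 2 / sqrt q"
  proof -
    have sq: "1 \<le> sqrt (real q)" using q by simp
    have "1 / real q \<le> 1 / sqrt (real q)"
      using sq q by (intro divide_left_mono) (auto simp: real_le_lsqrt power2_eq_square)
    moreover have "3 / sqrt (real q) \<le> \<eta>" using q sq \<eta> by (simp add: field_simps)
    ultimately have s: "1 / real q + 2 / sqrt q \<le> \<eta>" by simp
    have r: "0 \<le> k * (1 - 1 / q)" "k * (1 - 1 / q) \<le> 1"
      using k q by (auto intro!: mult_le_one)
    have "(1 - \<eta>) * (1 - 1 / q) \<le> k * (1 - 1 / q)" using k q by (intro mult_right_mono) auto
    also have "\<dots> \<le> sqrt (k * (1 - 1 / q))"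
      using r by (intro real_le_rsqrt) (simp add: power2_eq_square mult_left_le)
    finally have "(1 - \<eta>) * ((1 - \<eta>) * (1 - 1 / q)) \<le> (1 - \<eta>) * sqrt (k * (1 - 1 / q))"
      using \<eta> by (intro mult_left_mono) auto
    moreover have "1 - 2 * \<eta> - 1 / q \<le> (1 - \<eta>) * ((1 - \<eta>) * (1 - 1 / q))"
    proof -
      have "(1 - \<eta>) * (1 - \<eta>) = 1 - 2 * \<eta> + \<eta> * \<eta>" by (simp add: algebra_simps)
      then have "1 - 2 * \<eta> \<le> (1 - \<eta>) * (1 - \<eta>)" by simp
      then have "(1 - 2 * \<eta>) * (1 - 1 / q) \<le> (1 - \<eta>) * (1 - \<eta>) * (1 - 1 / q)"
        using q by (intro mult_right_mono) auto
      moreover have "(1 - 2 * \<eta>) * (1 - 1 / q) = 1 - 2 * \<eta> - 1 / q + 2 * \<eta> / q"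
        by (simp add: algebra_simps)
      moreover have "0 \<le> 2 * \<eta> / q" using \<eta> by simp
      ultimately show ?thesis by (simp only: mult.assoc)
    qed
    ultimately show ?thesis using s \<eta> by linarith
  qed
  obtain c0 C where c0: "0 < c0" and dev: "\<And>c n. 0 < c \<Longrightarrow> c < c0 \<Longrightarrow> C \<le> real n * c\<^sup>2 \<Longrightarrow>
    exp (- ((1 + \<eta>) * (real n * c\<^sup>2 * v / 2))) / 2
      \<le> measure M {\<omega>. (1 - \<eta>) * (real n * c * v) \<le> sum_list (map X (stake n \<omega>))}"
    using moderate_deviation_lower[OF mean var v \<eta>(1)] by blast
  define pos where "pos j = q ^ j" for j
  define len where "len j = pos (Suc j) - pos j" for j
  define L where "L j = ln (ln (real (pos (Suc j))))" for j
  define c where "c j = sqrt (2 * k * L j / (real (len j) * v))" for j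
  define A where "A j = {w. (1 - \<eta>) * (real (len j) * c j * v) \<le> sum_list (map X w)}" for j
  have pos_pos: "0 < real (pos j)" for j using q by (simp add: pos_def)
  have len: "real (len j) = real (pos (Suc j)) * (1 - 1 / q)" for j
    using q by (simp add: len_def pos_def of_nat_diff field_simps)
  have len_pos: "0 < real (len j)" for j
    unfolding len using pos_pos q by (intro mult_pos_pos) auto
  have pos_lim: "filterlim (\<lambda>j. real (pos j)) at_top sequentially"
  proof -
    have "filterlim (\<lambda>j. x ^ j) at_top sequentially" if "1 < x" for x :: real
      using that by real_asymp
    from this[of "real q"] show ?thesis using q by (simp add: pos_def)
  qed
  have pos_lim': "filterlim (\<lambda>j. real (pos (Suc j))) at_top sequentially"
    using pos_lim by (rule filterlim_compose[OF _ filterlim_Suc])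
  have L_lim: "filterlim L at_top sequentially"
  proof -
    have "filterlim (\<lambda>x::real. ln (ln x)) at_top at_top" by real_asymp
    from filterlim_compose[OF this pos_lim'] show ?thesis by (simp add: L_def[abs_def])
  qed
  have c_lim: "c \<longlonglongrightarrow> 0"
  proof -
    have "((\<lambda>x. sqrt (a * (ln (ln x) / x))) \<longlongrightarrow> 0) at_top" if "0 < a" for a :: real
      using that by real_asymp
    from filterlim_compose[OF this[of "2 * k / ((1 - 1 / real q) * v)"] pos_lim']
    have "(\<lambda>j. sqrt (2 * k / ((1 - 1 / real q) * v) * (L j / real (pos (Suc j))))) \<longlonglongrightarrow> 0"
      using k v q by (simp add: L_def)
    then show ?thesis by (simp add: c_def[abs_def] len mult_ac)
  qed
  have ev: "\<forall>\<^sub>F j in sequentially. c j < c0 \<and> 1 \<le> L j \<and> C * v / (2 * k) \<le> L j \<and> exp 1 \<le> real (pos j)"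
    using order_tendstoD(2)[OF c_lim c0] L_lim[THEN filterlim_at_top[THEN iffD1], rule_format, of 1]
      L_lim[THEN filterlim_at_top[THEN iffD1], rule_format, of "C * v / (2 * k)"]
      pos_lim[THEN filterlim_at_top[THEN iffD1], rule_format, of "exp 1"]
    by eventually_elim auto
  have prob: "\<forall>\<^sub>F j in sequentially. 1 / (2 * ln (real q)) * (1 / real (Suc j)) \<le> measure M {\<omega>. stake (len j) \<omega> \<in> A j}"
    using ev
  proof eventually_elim
    case (elim j)
    have c_sq: "real (len j) * (c j)\<^sup>2 = 2 * k * L j / v"
      unfolding c_def using elim k v len_pos[of j] by simp
    have c_pos: "0 < c j" unfolding c_def using elim k v len_pos[of j] by simp
    have "C \<le> real (len j) * (c j)\<^sup>2"
      unfolding c_sq using elim k v by (simp add: field_simps)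
    with c_pos elim have "exp (- ((1 + \<eta>) * (real (len j) * (c j)\<^sup>2 * v / 2))) / 2
      \<le> measure M {\<omega>. stake (len j) \<omega> \<in> A j}"
      unfolding A_def using dev by simp
    also have "(1 + \<eta>) * (real (len j) * (c j)\<^sup>2 * v / 2) = L j"
    proof -
      have "(1 + \<eta>) * k = 1" using \<eta> by (simp add: k_def)
      moreover have "(1 + \<eta>) * (2 * k * L j / v * v / 2) = ((1 + \<eta>) * k) * L j" using v by simp
      ultimately show ?thesis unfolding c_sq by simp
    qed
    also have "exp (- L j) = 1 / ln (real (pos (Suc j)))"
    proof -
      have "real (pos j) \<le> real (pos (Suc j))" using q by (simp add: pos_def)
      then have "exp 1 \<le> real (pos (Suc j))" using elim by linarith
      then have "1 \<le> ln (real (pos (Suc j)))" using pos_pos[of "Suc j"] by (simp add: ln_ge_iff)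
      then show ?thesis by (simp add: L_def exp_minus inverse_eq_divide)
    qed
    also have "ln (real (pos (Suc j))) = real (Suc j) * ln (real q)"
      using q unfolding pos_def of_nat_power by (subst ln_realpow) auto
    finally show ?case by (simp add: field_simps)
  qed
  have "\<not> summable (\<lambda>j. measure M {\<omega>. stake (len j) \<omega> \<in> A j})"
  proof
    assume "summable (\<lambda>j. measure M {\<omega>. stake (len j) \<omega> \<in> A j})"
    then have "summable (\<lambda>j. 1 / (2 * ln (real q)) * (1 / real (Suc j)))"
      by (rule summable_comparison_test_ev[rotated]) (use prob q in \<open>auto elim!: eventually_mono\<close>)
    then have "summable (\<lambda>j. 1 / real (Suc j))"
      using q by (subst (asm) summable_cmult_iff) auto
    then have "summable (\<lambda>j. 1 / real j)"
      using summable_Suc_iff[of "\<lambda>j. 1 / real j"] by simp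
    then show False using not_summable_harmonic[where 'a=real] by (simp add: inverse_eq_divide)
  qed
  then have "AE \<omega> in M. \<exists>\<^sub>F j in sequentially. stake (len j) (sdrop (pos j) \<omega>) \<in> A j"
    unfolding len_def using q by (intro borel_cantelli_blocks) (auto simp: pos_def mono_def power_increasing)
  moreover have "AE \<omega> in M. \<forall>\<^sub>F n in sequentially.
      sum_list (map (\<lambda>i. - X i) (stake n \<omega>)) \<le> (1 + 1) * sqrt v * lil (real n)"
    using mean var v by (intro lil_upper) (auto simp: sum_negf)
  ultimately show ?thesis
  proof eventually_elim
    case (elim \<omega>)
    have pos_nat: "filterlim pos at_top sequentially"
      using pos_lim by (simp add: filterlim_sequentially_iff_filterlim_real)
    from elim(2) have prev: "\<forall>\<^sub>F j in sequentially. sum_list (map (\<lambda>i. - X i) (stake (pos j) \<omega>)) \<le> 2 * sqrt v * lil (real (pos j))"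
      using pos_nat by (auto simp: filterlim_iff)
    have "\<exists>\<^sub>F j in sequentially. stake (len j) (sdrop (pos j) \<omega>) \<in> A j \<and>
        (sum_list (map (\<lambda>i. - X i) (stake (pos j) \<omega>)) \<le> 2 * sqrt v * lil (real (pos j)) \<and>
         (c j < c0 \<and> 1 \<le> L j \<and> C * v / (2 * k) \<le> L j \<and> exp 1 \<le> real (pos j)))"
      by (rule frequently_rev_mp[OF elim(1)]) (use prev ev in \<open>eventually_elim, simp\<close>)
    then have "\<exists>\<^sub>F j in sequentially. (1 - \<epsilon>) * sqrt v * lil (real (pos (Suc j)))
        \<le> sum_list (map X (stake (pos (Suc j)) \<omega>))"
    proof (rule frequently_elim1, elim conjE)
      fix j
      assume blk: "stake (len j) (sdrop (pos j) \<omega>) \<in> A j"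
        and prev: "sum_list (map (\<lambda>i. - X i) (stake (pos j) \<omega>)) \<le> 2 * sqrt v * lil (real (pos j))"
        and L: "1 \<le> L j" and e: "exp 1 \<le> real (pos j)"
      define l where "l = lil (real (pos (Suc j)))"
      have "0 \<le> l" using L pos_pos[of "Suc j"] by (simp add: l_def lil_def L_def)
      have l_sq: "l = sqrt (2 * real (pos (Suc j)) * L j)" by (simp add: l_def lil_def L_def)
      have "pos (Suc j) = pos j + len j" using q by (simp add: len_def pos_def)
      then have "sum_list (map X (stake (pos (Suc j)) \<omega>))
          = sum_list (map X (stake (pos j) \<omega>)) + sum_list (map X (stake (len j) (sdrop (pos j) \<omega>)))"
        by (simp only: stake_add[symmetric] map_append sum_list.append)
      moreover have "sum_list (map (\<lambda>i. - X i) w) = - sum_list (map X w)" for w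
        by (induction w) auto
      ultimately have sum: "- (2 * sqrt v * lil (real (pos j))) + (1 - \<eta>) * (real (len j) * c j * v)
          \<le> sum_list (map X (stake (pos (Suc j)) \<omega>))"
        using prev blk by (simp add: A_def)
      have "lil (real (pos j)) \<le> l / sqrt q"
      proof -
        have "ln (ln (real (pos j))) \<le> L j"
          unfolding L_def using e q by (intro ln_ln_mono) (simp_all add: pos_def)
        then have "2 * real (pos j) * ln (ln (real (pos j))) \<le> 2 * real (pos (Suc j)) * L j / q"
          using q pos_pos[of j] by (simp add: pos_def)
        then show ?thesis
          unfolding lil_def l_sq real_sqrt_divide[symmetric] by (rule real_sqrt_le_mono)
      qed
      then have 1: "2 * sqrt v * lil (real (pos j)) \<le> sqrt v * l * (2 / sqrt q)"
        using v mult_left_mono[of "lil (real (pos j))" "l / sqrt q" "2 * sqrt v"] by (simp add: mult_ac)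
      have 2: "real (len j) * c j * v = sqrt v * l * sqrt (k * (1 - 1 / q))"
      proof -
        have "real (len j) * c j * v = sqrt ((real (len j) * v)\<^sup>2 * (2 * k * L j / (real (len j) * v)))"
          unfolding c_def using v len_pos[of j] by (simp only: real_sqrt_mult real_sqrt_abs) simp
        also have "(real (len j) * v)\<^sup>2 * (2 * k * L j / (real (len j) * v)) = v * (2 * k * L j * real (len j))"
          using v len_pos[of j] by (simp add: power2_eq_square)
        also have "\<dots> = v * (2 * real (pos (Suc j)) * L j) * (k * (1 - 1 / q))"
          unfolding len by (simp add: mult_ac)
        finally show ?thesis by (simp only: real_sqrt_mult l_sq)
      qed
      have "(1 - \<epsilon>) * (sqrt v * l) \<le> ((1 - \<eta>) * sqrt (k * (1 - 1 / q)) - 2 / sqrt q) * (sqrt v * l)"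
        using \<open>0 \<le> l\<close> v by (intro mult_right_mono const) auto
      also have "\<dots> = - (sqrt v * l * (2 / sqrt q)) + (1 - \<eta>) * (real (len j) * c j * v)"
        unfolding 2 by (simp add: algebra_simps)
      also have "\<dots> \<le> sum_list (map X (stake (pos (Suc j)) \<omega>))"
        using sum 1 by linarith
      finally show "(1 - \<epsilon>) * sqrt v * lil (real (pos (Suc j))) \<le> sum_list (map X (stake (pos (Suc j)) \<omega>))"
        by (simp add: l_def mult.assoc)
    qed
    moreover have "filterlim (\<lambda>j. pos (Suc j)) sequentially sequentially"
      by (rule filterlim_compose[OF pos_nat filterlim_Suc])
    ultimately show ?case
      by (auto simp: frequently_def filterlim_iff)
  qed
qed

end

section \<open>Coding by sequences of letters\<close>

text \<open>Up to scaling and translation, a similarity of a Euclidean space is an orthogonal map.\<close>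

lemma similarity_surj:
  fixes f :: "'a::euclidean_space \<Rightarrow> 'a"
  assumes "similarity c f" "0 < c"
  shows "surj f"
proof -
  define g where "g x = (1 / c) *\<^sub>R (f x - f 0)" for x
  have "dist (g x) (g y) = dist x y" for x y
  proof -
    have "g x - g y = (1 / c) *\<^sub>R (f x - f y)" by (simp add: g_def algebra_simps)
    then show ?thesis using assms by (simp add: dist_norm similarity_def)
  qed
  moreover have "g 0 = 0" by (simp add: g_def)
  ultimately have "orthogonal_transformation g"
    by (simp add: orthogonal_transformation_isometry)
  then have "surj g" by (rule orthogonal_transformation_surj)
  have "\<exists>x. f x = y" for y
  proof -
    obtain x where "g x = (1 / c) *\<^sub>R (y - f 0)" using \<open>surj g\<close> by (metis surjD)
    then show ?thesis using assms(2) by (intro exI[of _ x]) (simp add: g_def)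
  qed
  then show ?thesis by (metis surjI)
qed

locale ifs =
  fixes I :: "nat set" and S :: "nat \<Rightarrow> 'a::euclidean_space \<Rightarrow> 'a" and r :: "nat \<Rightarrow> real" and K :: "'a set"
  assumes finite_letters: "finite I" and letters_ne: "I \<noteq> {}"
    and ratio: "i \<in> I \<Longrightarrow> 0 < r i" "i \<in> I \<Longrightarrow> r i < 1"
    and sim: "i \<in> I \<Longrightarrow> similarity (r i) (S i)"
    and K_compact: "compact K" and K_ne: "K \<noteq> {}" and K_eq: "K = (\<Union>i\<in>I. S i ` K)"
begin

definition "rmax = Max (r ` I)"
definition "rmin = Min (r ` I)"

lemma rmax: "0 < rmax" "rmax < 1" "i \<in> I \<Longrightarrow> r i \<le> rmax"
proof -
  have "rmax \<in> r ` I" unfolding rmax_def using finite_letters letters_ne by (intro Max_in) auto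
  then show "0 < rmax" "rmax < 1" using ratio by auto
  show "r i \<le> rmax" if "i \<in> I" unfolding rmax_def using finite_letters that by simp
qed

lemma rmin: "0 < rmin" "i \<in> I \<Longrightarrow> rmin \<le> r i"
proof -
  have "rmin \<in> r ` I" unfolding rmin_def using finite_letters letters_ne by (intro Min_in) auto
  then show "0 < rmin" using ratio by auto
  show "rmin \<le> r i" if "i \<in> I" unfolding rmin_def using finite_letters that by simp
qed

definition rat :: "nat list \<Rightarrow> real" where "rat w = prod_list (map r w)"

lemma rat_simps [simp]: "rat [] = 1" "rat (i # w) = r i * rat w" "rat (u @ v) = rat u * rat v"
  by (simp_all add: rat_def)

lemma rat_pos: "set w \<subseteq> I \<Longrightarrow> 0 < rat w"
  by (induction w) (auto intro!: mult_pos_pos ratio)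

lemma rat_le: "set w \<subseteq> I \<Longrightarrow> rat w \<le> rmax ^ length w"
  by (induction w) (auto intro!: mult_mono rmax less_imp_le[OF rat_pos] less_imp_le[OF rmax(1)])

lemma rat_le_1: "set w \<subseteq> I \<Longrightarrow> rat w \<le> 1"
  using rat_le[of w] power_le_one[of rmax "length w"] rmax by linarith

lemma dist_letter: "i \<in> I \<Longrightarrow> dist (S i x) (S i y) = r i * dist x y"
  using sim by (simp add: similarity_def)

lemma dist_word: "set w \<subseteq> I \<Longrightarrow> dist (foldr S w x) (foldr S w y) = rat w * dist x y"
  by (induction w) (simp_all add: dist_letter)

lemma continuous_word:
  assumes "set w \<subseteq> I" shows "continuous_on UNIV (foldr S w)"
proof (rule continuous_on_iff[THEN iffD2], intro ballI allI impI)
  fix x :: 'a and e :: real assume "0 < e"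
  have "dist (foldr S w x') (foldr S w x) < e" if "dist x' x < e" for x'
  proof -
    have "rat w * dist x' x \<le> 1 * dist x' x" using rat_le_1[OF assms] by (intro mult_right_mono) auto
    then show ?thesis using that by (simp add: dist_word[OF assms])
  qed
  then show "\<exists>d>0. \<forall>x'\<in>UNIV. dist x' x < d \<longrightarrow> dist (foldr S w x') (foldr S w x) < e"
    using \<open>0 < e\<close> by blast
qed

lemma continuous_letter: "i \<in> I \<Longrightarrow> continuous_on UNIV (S i)"
  using continuous_word[of "[i]"] by simp

lemma vimage_word_borel: "set w \<subseteq> I \<Longrightarrow> E \<in> sets borel \<Longrightarrow> foldr S w -` E \<in> sets borel"
  using measurable_sets[OF borel_measurable_continuous_onI[OF continuous_word]] by fastforce

lemma vimage_letter_borel: "i \<in> I \<Longrightarrow> E \<in> sets borel \<Longrightarrow> S i -` E \<in> sets borel"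
  using vimage_word_borel[of "[i]"] by simp

lemma word_K: "set w \<subseteq> I \<Longrightarrow> x \<in> K \<Longrightarrow> foldr S w x \<in> K"
proof (induction w)
  case (Cons i w)
  then have "S i (foldr S w x) \<in> (\<Union>i\<in>I. S i ` K)" by auto
  then show ?case using K_eq by simp
qed simp

lemma K_covered_by_words: "x \<in> K \<Longrightarrow> \<exists>w. length w = n \<and> set w \<subseteq> I \<and> x \<in> foldr S w ` K"
proof (induction n arbitrary: x)
  case (Suc n)
  then obtain i y where i: "i \<in> I" "y \<in> K" "x = S i y" using K_eq by blast
  with Suc.IH[of y] obtain w where "length w = n" "set w \<subseteq> I" "y \<in> foldr S w ` K" by blast
  then show ?case using i by (intro exI[of _ "i # w"]) auto
qed auto

lemma dist_K: "x \<in> K \<Longrightarrow> y \<in> K \<Longrightarrow> dist x y \<le> diameter K"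
  using diameter_bounded_bound[OF compact_imp_bounded[OF K_compact]] .

lemma diameter_K: "0 \<le> diameter K"
  by (rule diameter_ge_0[OF compact_imp_bounded[OF K_compact]])

definition "x0 = (SOME x. x \<in> K)"

lemma x0: "x0 \<in> K" unfolding x0_def using K_ne by (simp add: some_in_eq)

definition code :: "nat stream \<Rightarrow> 'a" where
  "code \<omega> = lim (\<lambda>n. foldr S (stake n \<omega>) x0)"

lemma set_stake: "\<omega> \<in> streams I \<Longrightarrow> set (stake n \<omega>) \<subseteq> I"
  by (auto simp: in_set_conv_nth streams_iff_snth)

lemma sdrop_streams: "\<omega> \<in> streams I \<Longrightarrow> sdrop n \<omega> \<in> streams I"
  by (simp add: streams_iff_snth sdrop_snth)

lemma code_lim:
  assumes \<omega>: "\<omega> \<in> streams I"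
  shows "(\<lambda>n. foldr S (stake n \<omega>) x0) \<longlonglongrightarrow> code \<omega>"
proof -
  let ?y = "\<lambda>n. foldr S (stake n \<omega>) x0"
  have le: "dist (?y m) (?y (m + n)) \<le> rmax ^ m * diameter K" for m n
  proof -
    have 1: "?y (m + n) = foldr S (stake m \<omega>) (foldr S (stake n (sdrop m \<omega>)) x0)"
      by (simp only: stake_add[symmetric] foldr_append o_apply)
    have "dist (?y m) (?y (m + n)) = rat (stake m \<omega>) * dist x0 (foldr S (stake n (sdrop m \<omega>)) x0)"
      unfolding 1 by (rule dist_word[OF set_stake[OF \<omega>]])
    also have "\<dots> \<le> rmax ^ m * diameter K"
      using rat_le[OF set_stake[OF \<omega>], of m] rmax
      by (intro mult_mono dist_K word_K set_stake x0 sdrop_streams \<omega>) auto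
    finally show ?thesis .
  qed
  have "(\<lambda>m. rmax ^ m * diameter K) \<longlonglongrightarrow> 0 * diameter K"
    using rmax by (intro tendsto_intros LIMSEQ_realpow_zero) auto
  then have lim: "(\<lambda>m. rmax ^ m * diameter K) \<longlonglongrightarrow> 0" by simp
  have "Cauchy ?y"
  proof (rule metric_CauchyI)
    fix e :: real assume "0 < e"
    then obtain M where M: "rmax ^ M * diameter K < e / 2"
      using order_tendstoD(2)[OF lim, of "e / 2"] by (auto simp: eventually_sequentially)
    have "dist (?y m) (?y n) < e" if "M \<le> m" "M \<le> n" for m n
    proof -
      have "dist (?y M) (?y m) < e / 2" "dist (?y M) (?y n) < e / 2"
        using le[of M "m - M"] le[of M "n - M"] M that by auto
      then show ?thesis using dist_triangle_half_r by blast
    qed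
    then show "\<exists>M. \<forall>m\<ge>M. \<forall>n\<ge>M. dist (?y m) (?y n) < e" by blast
  qed
  then show ?thesis unfolding code_def by (intro convergent_LIMSEQ_iff[THEN iffD1] Cauchy_convergent)
qed

lemma code_in_K:
  assumes "\<omega> \<in> streams I" shows "code \<omega> \<in> K"
  by (rule closed_sequentially[OF compact_imp_closed[OF K_compact] _ code_lim[OF assms]])
    (intro word_K set_stake assms x0)

lemma code_Cons:
  assumes i: "i \<in> I" and \<omega>: "\<omega> \<in> streams I"
  shows "code (i ## \<omega>) = S i (code \<omega>)"
proof -
  have "(\<lambda>n. S i (foldr S (stake n \<omega>) x0)) \<longlonglongrightarrow> S i (code \<omega>)"
    using continuous_letter[OF i] code_lim[OF \<omega>]
    by (intro continuous_on_tendsto_compose[of UNIV "S i"]) auto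
  moreover have "(\<lambda>n. foldr S (stake (Suc n) (i ## \<omega>)) x0) \<longlonglongrightarrow> code (i ## \<omega>)"
    using code_lim[of "i ## \<omega>"] i \<omega> by (intro LIMSEQ_Suc) (auto intro: streams.intros)
  ultimately show ?thesis by (simp add: LIMSEQ_unique)
qed

lemma code_stake:
  assumes \<omega>: "\<omega> \<in> streams I"
  shows "code \<omega> = foldr S (stake n \<omega>) (code (sdrop n \<omega>))"
  using assms
proof (induction n arbitrary: \<omega>)
  case (Suc n)
  then obtain i \<omega>' where "\<omega> = i ## \<omega>'" "i \<in> I" "\<omega>' \<in> streams I" by (auto elim: streams.cases)
  with Suc.IH[of \<omega>'] show ?case by (simp add: code_Cons)
qed simp

end

locale weighted_ifs = bernoulli_shift I p + ifs I S r K
  for I p and S :: "nat \<Rightarrow> 'a::euclidean_space \<Rightarrow> 'a" and r K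
begin

lemma code_measurable [measurable]: "code \<in> borel_measurable M"
proof -
  have "(\<lambda>\<omega>. foldr S (stake n \<omega>) x0) \<in> borel_measurable M" for n
  proof -
    have "stake n \<in> measurable M (count_space UNIV)" by measurable
    then show ?thesis by (rule measurable_compose) simp
  qed
  then show ?thesis unfolding code_def[abs_def] by (intro borel_measurable_lim_metric)
qed

definition self_similar :: "'a measure \<Rightarrow> bool" where
  "self_similar m \<longleftrightarrow> prob_space m \<and> sets m = sets borel \<and>
     (\<forall>E\<in>sets borel. measure m E = (\<Sum>i\<in>I. p i * measure m (S i -` E)))"

definition \<mu> :: "'a measure" where "\<mu> = distr M borel code"

lemma measure_\<mu>: "E \<in> sets borel \<Longrightarrow> measure \<mu> E = measure M {\<omega>. code \<omega> \<in> E}"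
  unfolding \<mu>_def by (subst measure_distr) (simp_all add: vimage_def)

lemma code_sets: "E \<in> sets borel \<Longrightarrow> {\<omega>. code \<omega> \<in> E} \<in> sets M"
  using measurable_sets[OF code_measurable, of E] by (simp add: vimage_def)

lemma self_similar_\<mu>: "self_similar \<mu>"
  unfolding self_similar_def
proof (intro conjI ballI)
  show "prob_space \<mu>" unfolding \<mu>_def by (rule M.prob_space_distr) simp
  show "sets \<mu> = sets borel" by (simp add: \<mu>_def)
  fix E :: "'a set" assume E: "E \<in> sets borel"
  have "measure \<mu> E = (\<Sum>i\<in>I. p i * measure M {\<omega>. code (i ## \<omega>) \<in> E})"
    using first_step[OF code_sets[OF E]] by (simp add: measure_\<mu>[OF E])
  also have "\<dots> = (\<Sum>i\<in>I. p i * measure \<mu> (S i -` E))"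
  proof (intro sum.cong refl arg_cong2[of _ _ _ _ "(*)"])
    fix i assume i: "i \<in> I"
    have "measure M {\<omega>. code (i ## \<omega>) \<in> E} = measure M {\<omega>. code \<omega> \<in> S i -` E}"
    proof (rule M.finite_measure_eq_AE)
      show "AE \<omega> in M. (\<omega> \<in> {\<omega>. code (i ## \<omega>) \<in> E}) = (\<omega> \<in> {\<omega>. code \<omega> \<in> S i -` E})"
        using AE_streams by eventually_elim (simp add: code_Cons[OF i])
      show "{\<omega>. code (i ## \<omega>) \<in> E} \<in> sets M"
        using measurable_sets[OF measurable_Cons_M code_sets[OF E], of i] by (simp add: vimage_def)
      show "{\<omega>. code \<omega> \<in> S i -` E} \<in> sets M"
        by (rule code_sets[OF vimage_letter_borel[OF i E]])
    qed
    then show "measure M {\<omega>. code (i ## \<omega>) \<in> E} = measure \<mu> (S i -` E)"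
      by (simp add: measure_\<mu>[OF vimage_letter_borel[OF i E]])
  qed
  finally show "measure \<mu> E = (\<Sum>i\<in>I. p i * measure \<mu> (S i -` E))" .
qed

lemma self_similar_iterate:
  assumes m: "self_similar m" and E: "E \<in> sets borel"
  shows "measure m E = word_sum p n (\<lambda>w. measure m (foldr S w -` E))"
  using E
proof (induction n arbitrary: E)
  case (Suc n)
  have "measure m E = (\<Sum>i\<in>I. p i * measure m (S i -` E))"
    using m Suc.prems by (simp add: self_similar_def)
  also have "\<dots> = word_sum p (Suc n) (\<lambda>w. measure m (foldr S w -` E))"
    using Suc.IH[OF vimage_letter_borel[OF _ Suc.prems]]
    by (auto intro!: sum.cong simp: vimage_comp o_def)
  finally show ?case .
qed simp

lemma large_ball:
  fixes m :: "'a measure"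
  assumes "prob_space m" "sets m = sets borel" "0 < e"
  shows "\<exists>R>0. 1 - e \<le> measure m (cball 0 R)"
proof -
  interpret prob_space m by fact
  have "(\<lambda>n. measure m (cball 0 (real n))) \<longlonglongrightarrow> measure m (\<Union>n. cball 0 (real n))"
    by (rule finite_Lim_measure_incseq) (auto simp: assms incseq_def)
  also have "(\<Union>n. cball 0 (real n)) = (space m :: 'a set)"
    using real_arch_simple sets_eq_imp_space_eq[OF assms(2)] by auto
  finally have "(\<lambda>n. measure m (cball 0 (real n))) \<longlonglongrightarrow> 1" by (simp add: prob_space)
  then have "\<forall>\<^sub>F n in sequentially. 1 - e < measure m (cball 0 (real n))"
    using \<open>0 < e\<close> by (intro order_tendstoD) auto
  then have "\<forall>\<^sub>F n in sequentially. 1 - e < measure m (cball 0 (real n)) \<and> 0 < n"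
    using eventually_gt_at_top[of 0] by eventually_elim auto
  then obtain n where "1 - e < measure m (cball 0 (real n))" "0 < n"
    by (auto simp: eventually_sequentially)
  then show ?thesis by (intro exI[of _ "real n"]) auto
qed

text \<open>At level \<open>n\<close> both measures are mixtures, with the same weights, of copies that live essentially
  on images of one fixed ball, and these images are small.  A fixed ball is used instead of
  \<open>K\<close> because the support of \<open>m\<close> is not known in advance.\<close>

lemma self_similar_closed_le:
  assumes m: "self_similar m" and m': "self_similar m'" and F: "closed F" "F \<noteq> {}"
  shows "measure m F \<le> measure m' F"
proof -
  interpret m: prob_space m using m by (simp add: self_similar_def)
  interpret m': prob_space m' using m' by (simp add: self_similar_def)
  have sets: "sets m = sets borel" "sets m' = sets borel"
    using m m' by (auto simp: self_similar_def)
  define Fe where "Fe e = {x. infdist x F \<le> e}" for e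
  have closed_Fe: "closed (Fe e)" for e
    unfolding Fe_def by (intro closed_Collect_le continuous_intros)
  have Fe_le: "measure m F \<le> measure m' (Fe e) + 2 * e" if e: "0 < e" for e
  proof -
    obtain R1 where R1: "0 < R1" "1 - e \<le> measure m (cball 0 R1)"
      using large_ball[OF m.prob_space_axioms sets(1) e] by blast
    obtain R2 where R2: "0 < R2" "1 - e \<le> measure m' (cball 0 R2)"
      using large_ball[OF m'.prob_space_axioms sets(2) e] by blast
    define R where "R = max R1 R2"
    have R: "0 < R" "1 - e \<le> measure m (cball 0 R)" "1 - e \<le> measure m' (cball 0 R)"
      using R1 R2 m.finite_measure_mono[of "cball 0 R1" "cball 0 R"]
        m'.finite_measure_mono[of "cball 0 R2" "cball 0 R"]
      by (auto simp: R_def sets subset_cball)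
    have "(\<lambda>n. rmax ^ n * (2 * R)) \<longlonglongrightarrow> 0 * (2 * R)"
      using rmax by (intro tendsto_intros LIMSEQ_realpow_zero) auto
    then have "\<forall>\<^sub>F n in sequentially. rmax ^ n * (2 * R) < e"
      using e by (intro order_tendstoD) auto
    then obtain n where n: "rmax ^ n * (2 * R) < e" by (auto simp: eventually_sequentially)
    have "measure m F = word_sum p n (\<lambda>w. measure m (foldr S w -` F))"
      using F(1) by (intro self_similar_iterate m) auto
    also have "\<dots> \<le> word_sum p n (\<lambda>w. measure m' (foldr S w -` Fe e) + e)"
    proof (rule word_sum_mono)
      fix w :: "nat list" assume w: "length w = n" "set w \<subseteq> I"
      have F_sets: "foldr S w -` F \<in> sets borel" "foldr S w -` Fe e \<in> sets borel"
        using F(1) closed_Fe by (auto intro!: vimage_word_borel w)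
      show "measure m (foldr S w -` F) \<le> measure m' (foldr S w -` Fe e) + e"
      proof (cases "cball 0 R \<inter> foldr S w -` F = {}")
        case True
        then have "measure m (foldr S w -` F) \<le> measure m (space m - cball 0 R)"
          using F_sets sets sets_eq_imp_space_eq[OF sets(1)] by (intro m.finite_measure_mono) auto
        also have "\<dots> = 1 - measure m (cball 0 R)"
          by (rule m.prob_compl) (simp add: sets)
        finally show ?thesis using R measure_nonneg[of m' "foldr S w -` Fe e"] by linarith
      next
        case False
        then obtain x where x: "norm x \<le> R" "foldr S w x \<in> F" by auto
        have "cball 0 R \<subseteq> foldr S w -` Fe e"
        proof
          fix y assume "y \<in> cball (0::'a) R"
          then have "dist y x \<le> 2 * R" using x norm_triangle_ineq4[of y x] by (simp add: dist_norm)
          then have "rat w * dist y x \<le> rmax ^ n * (2 * R)"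
            using rat_le[OF w(2)] w(1) rmax by (intro mult_mono) auto
          then have "dist (foldr S w y) (foldr S w x) \<le> e" using n by (simp add: dist_word w)
          then show "y \<in> foldr S w -` Fe e" using x(2) by (simp add: Fe_def infdist_le2)
        qed
        then have "measure m' (cball 0 R) \<le> measure m' (foldr S w -` Fe e)"
          using F_sets sets by (intro m'.finite_measure_mono) auto
        then show ?thesis using R m.prob_le_1[of "foldr S w -` F"] by linarith
      qed
    qed (simp add: p_pos less_imp_le)
    also have "\<dots> = measure m' (Fe e) + e"
      using closed_Fe unfolding word_sum_add word_sum_const[OF p_sum]
      by (subst self_similar_iterate[OF m', symmetric]) auto
    finally show ?thesis using e by simp
  qed
  define e where "e n = inverse (real (Suc n))" for n
  have e_lim: "e \<longlonglongrightarrow> 0" unfolding e_def by (rule LIMSEQ_inverse_real_of_nat)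
  have "decseq e" unfolding e_def by (intro decseq_SucI le_imp_inverse_le) auto
  then have "decseq (\<lambda>n. Fe (e n))"
    unfolding Fe_def decseq_def by (auto intro: order_trans)
  then have "(\<lambda>n. measure m' (Fe (e n))) \<longlonglongrightarrow> measure m' (\<Inter>n. Fe (e n))"
    by (intro m'.finite_Lim_measure_decseq) (auto simp: sets closed_Fe)
  also have "(\<Inter>n. Fe (e n)) = F"
  proof
    show "(\<Inter>n. Fe (e n)) \<subseteq> F"
    proof
      fix x assume "x \<in> (\<Inter>n. Fe (e n))"
      then have "infdist x F \<le> e n" for n by (auto simp: Fe_def)
      then have "infdist x F \<le> 0" using LIMSEQ_le_const[OF e_lim] by blast
      then show "x \<in> F" using F infdist_nonneg[of x F] by (simp add: in_closed_iff_infdist_zero)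
    qed
    show "F \<subseteq> (\<Inter>n. Fe (e n))" by (auto simp: Fe_def e_def)
  qed
  finally have "(\<lambda>n. measure m' (Fe (e n)) + 2 * e n) \<longlonglongrightarrow> measure m' F + 2 * 0"
    by (intro tendsto_intros e_lim)
  moreover have "measure m F \<le> measure m' (Fe (e n)) + 2 * e n" for n
    by (rule Fe_le) (simp add: e_def)
  ultimately show ?thesis using LIMSEQ_le_const by fastforce
qed

text \<open>Closed sets form an intersection-stable generator of the Borel sets.\<close>

theorem self_similar_unique:
  assumes m: "self_similar m" shows "m = \<mu>"
proof (rule measure_eqI_generator_eq)
  show "Int_stable (Collect closed :: 'a set set)" by (auto simp: Int_stable_def)
  show "sets m = sigma_sets UNIV (Collect closed)" "sets \<mu> = sigma_sets UNIV (Collect closed)"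
    using m by (simp_all add: self_similar_def \<mu>_def borel_eq_closed)
  interpret m: prob_space m using m by (simp add: self_similar_def)
  interpret \<mu>: prob_space \<mu> using self_similar_\<mu> by (simp add: self_similar_def)
  fix X :: "'a set" assume "X \<in> Collect closed"
  then show "emeasure m X = emeasure \<mu> X"
    using self_similar_closed_le[OF m self_similar_\<mu>, of X] self_similar_closed_le[OF self_similar_\<mu> m, of X]
    by (cases "X = {}") (auto simp: m.emeasure_eq_measure \<mu>.emeasure_eq_measure)
next
  show "range (\<lambda>i::nat. UNIV :: 'a set) \<subseteq> Collect closed" by auto
  interpret m: prob_space m using m by (simp add: self_similar_def)
  show "emeasure m UNIV \<noteq> \<infinity>" by simp
qed auto

end

section \<open>The open set condition and the mass of balls\<close>

locale osc_ifs = weighted_ifs I p S r K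
  for I p and S :: "nat \<Rightarrow> 'a::euclidean_space \<Rightarrow> 'a" and r K +
  fixes U :: "'a set"
  assumes U_open: "open U" and U_ne: "U \<noteq> {}"
    and U_sub: "i \<in> I \<Longrightarrow> S i ` U \<subseteq> U"
    and U_disj: "i \<in> I \<Longrightarrow> j \<in> I \<Longrightarrow> i \<noteq> j \<Longrightarrow> S i ` U \<inter> S j ` U = {}"
begin

lemma word_U: "set w \<subseteq> I \<Longrightarrow> x \<in> U \<Longrightarrow> foldr S w x \<in> U"
  by (induction w) (use U_sub in auto)

lemma inj_word: "set w \<subseteq> I \<Longrightarrow> foldr S w x = foldr S w y \<Longrightarrow> x = y"
  using dist_word[of w x y] rat_pos[of w] by simp

lemma word_surj: "set w \<subseteq> I \<Longrightarrow> \<exists>x. foldr S w x = y"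
  using similarity_surj[of "rat w" "foldr S w"] rat_pos[of w] dist_word[of w]
  by (metis similarity_def surjD)

lemma parallel_words_disjoint:
  assumes "v \<parallel> w" "set v \<subseteq> I" "set w \<subseteq> I" "x \<in> U" "y \<in> U"
  shows "foldr S v x \<noteq> foldr S w y"
proof
  assume eq: "foldr S v x = foldr S w y"
  obtain u i v' j w' where *: "i \<noteq> j" "v = u @ i # v'" "w = u @ j # w'"
    using parallel_decomp[OF assms(1)] by blast
  have "set u \<subseteq> I" "i \<in> I" "j \<in> I" "set v' \<subseteq> I" "set w' \<subseteq> I" using * assms(2,3) by auto
  have "S i (foldr S v' x) = S j (foldr S w' y)"
    using eq * \<open>set u \<subseteq> I\<close> by (auto intro: inj_word)
  moreover have "S i (foldr S v' x) \<in> S i ` U" "S j (foldr S w' y) \<in> S j ` U"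
    using word_U \<open>set v' \<subseteq> I\<close> \<open>set w' \<subseteq> I\<close> assms by auto
  ultimately show False using U_disj[OF \<open>i \<in> I\<close> \<open>j \<in> I\<close> \<open>i \<noteq> j\<close>] by auto
qed

text \<open>A ball of radius \<open>b\<close> around \<open>u\<close> in \<open>U\<close> is mapped by \<open>foldr S w\<close> onto a ball of radius
  \<open>rat w * b\<close>; so incomparable words send \<open>u\<close> to points that are far apart.\<close>

lemma parallel_words_separated:
  assumes ball: "ball u b \<subseteq> U" "u \<in> U" and par: "v \<parallel> w" and vw: "set v \<subseteq> I" "set w \<subseteq> I"
  shows "rat v * b \<le> dist (foldr S v u) (foldr S w u)"
proof (rule ccontr)
  assume "\<not> ?thesis"
  obtain x where x: "foldr S v x = foldr S w u" using word_surj[OF vw(1)] by blast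
  with \<open>\<not> ?thesis\<close> have "rat v * dist u x < rat v * b"
    using dist_word[OF vw(1), of u x] by simp
  then have "x \<in> U" using rat_pos[OF vw(1)] ball by auto
  then show False using parallel_words_disjoint[OF par vw _ ball(2)] x by blast
qed

text \<open>The words at which the ratio first drops to \<open>\<rho>\<close>.  Words of one cut have images of comparable
  size and are pairwise incomparable, and for \<open>\<rho> < 1\<close> every sequence passes through the cut.\<close>

definition cut :: "real \<Rightarrow> nat list set" where
  "cut \<rho> = {w. w \<noteq> [] \<and> set w \<subseteq> I \<and> rat w \<le> \<rho> \<and> \<rho> < rat (butlast w)}"

lemma cut_bounds:
  assumes "w \<in> cut \<rho>"
  shows "set w \<subseteq> I" "rat w \<le> \<rho>" "rmin * \<rho> \<le> rat w" "0 < \<rho>"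
proof -
  from assms have w: "w \<noteq> []" "set w \<subseteq> I" "rat w \<le> \<rho>" "\<rho> < rat (butlast w)"
    by (auto simp: cut_def)
  then show "set w \<subseteq> I" "rat w \<le> \<rho>" by auto
  show "0 < \<rho>" using rat_pos[OF w(2)] w(3) by linarith
  have "last w \<in> I" using w by auto
  have "rat w = rat (butlast w @ [last w])" using w(1) by simp
  then have "rat w = rat (butlast w) * r (last w)" by (simp only: rat_simps)
  moreover have "rmin * \<rho> \<le> r (last w) * rat (butlast w)"
    using rmin \<open>last w \<in> I\<close> w \<open>0 < \<rho>\<close> ratio[of "last w"] by (intro mult_mono) auto
  ultimately show "rmin * \<rho> \<le> rat w" by (simp add: mult.commute)
qed

lemma cut_parallel:
  assumes v: "v \<in> cut \<rho>" and w: "w \<in> cut \<rho>" and "v \<noteq> w"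
  shows "v \<parallel> w"
proof -
  have no: "\<not> prefix x y" if x: "x \<in> cut \<rho>" and y: "y \<in> cut \<rho>" and "x \<noteq> y" for x y
  proof
    assume "prefix x y"
    then obtain z' where z': "y = x @ z'" by (auto simp: prefix_def)
    define z where "z = butlast z'"
    have "z' \<noteq> []" using z' \<open>x \<noteq> y\<close> by auto
    then have z: "butlast y = x @ z" by (simp add: z' z_def butlast_append)
    have "set (butlast y) \<subseteq> I" using y by (auto simp: cut_def dest: in_set_butlastD)
    then have "rat (butlast y) \<le> rat x * 1"
      using rat_le_1[of z] rat_pos[of x] z by (auto intro!: mult_left_mono)
    then show False using x y by (auto simp: cut_def)
  qed
  show ?thesis using no[OF v w] no[OF w v] \<open>v \<noteq> w\<close> by (simp add: parallel_def)
qed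

lemma finite_cut: "finite (cut \<rho>)"
proof (cases "0 < \<rho>")
  case True
  have "(\<lambda>n. rmax ^ n) \<longlonglongrightarrow> 0" using rmax by (intro LIMSEQ_realpow_zero) auto
  then obtain n where n: "\<And>j. n \<le> j \<Longrightarrow> rmax ^ j < \<rho>"
    using order_tendstoD(2)[of _ 0 sequentially \<rho>] True by (auto simp: eventually_sequentially)
  have "cut \<rho> \<subseteq> {w. set w \<subseteq> I \<and> length w \<le> Suc n}"
  proof
    fix w assume w: "w \<in> cut \<rho>"
    then have "set (butlast w) \<subseteq> I" by (auto simp: cut_def dest: in_set_butlastD)
    from rat_le[OF this] w n[of "length (butlast w)"] have "\<not> n \<le> length (butlast w)"
      by (auto simp: cut_def)
    then show "w \<in> {w. set w \<subseteq> I \<and> length w \<le> Suc n}" using w by (auto simp: cut_def)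
  qed
  then show ?thesis using finite_lists_length_le[OF finite_letters] by (rule finite_subset)
next
  case False
  then have "cut \<rho> = {}" using cut_bounds(4) by blast
  then show ?thesis by simp
qed

lemma stake_in_cut:
  assumes \<omega>: "\<omega> \<in> streams I" and \<rho>: "0 < \<rho>" "\<rho> < 1"
  shows "\<exists>n. stake n \<omega> \<in> cut \<rho>"
proof -
  have "(\<lambda>n. rmax ^ n) \<longlonglongrightarrow> 0" using rmax by (intro LIMSEQ_realpow_zero) auto
  then have "\<forall>\<^sub>F n in sequentially. rmax ^ n < \<rho>" using \<rho> by (intro order_tendstoD)
  then obtain n0 where "rmax ^ n0 < \<rho>" by (auto simp: eventually_sequentially)
  then have ex: "rat (stake n0 \<omega>) \<le> \<rho>" using rat_le[OF set_stake[OF \<omega>], of n0] by simp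
  define n where "n = (LEAST n. rat (stake n \<omega>) \<le> \<rho>)"
  have n: "rat (stake n \<omega>) \<le> \<rho>" unfolding n_def using ex by (rule LeastI)
  then obtain k where k: "n = Suc k" using \<rho> by (cases n) auto
  have "\<not> rat (stake k \<omega>) \<le> \<rho>" using k not_less_Least[of k "\<lambda>n. rat (stake n \<omega>) \<le> \<rho>"] by (simp add: n_def)
  moreover have "butlast (stake n \<omega>) = stake k \<omega>" by (simp only: k stake_Suc butlast_snoc)
  ultimately have "stake n \<omega> \<in> cut \<rho>"
    using n set_stake[OF \<omega>, of n] k by (auto simp: cut_def)
  then show ?thesis ..
qed

text \<open>After rescaling by \<open>1 / \<rho>\<close>, the images of one point of \<open>U\<close> under the cut words are
  uniformly separated points of a fixed ball, so their number is bounded by total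
  boundedness.\<close>

lemma cut_words_near_point:
  "\<exists>N::nat. \<forall>\<rho> x T. T \<subseteq> cut \<rho> \<longrightarrow> (\<forall>v\<in>T. \<exists>y\<in>K. dist (foldr S v y) x \<le> C * \<rho>) \<longrightarrow> card T \<le> N"
proof -
  obtain u where u: "u \<in> U" using U_ne by blast
  then obtain b where b: "0 < b" "ball u b \<subseteq> U" using U_open open_contains_ball by blast
  obtain D where D: "\<And>y. y \<in> K \<Longrightarrow> dist u y \<le> D"
    using compact_imp_bounded[OF K_compact] bounded_any_center[of K u] by (auto simp: bounded_def)
  define g where "g = rmin * b"
  have g: "0 < g" using rmin b by (simp add: g_def)
  have "compact (cball (0::'a) (C + D))" by simp
  then obtain Z where Z: "finite Z" "cball (0::'a) (C + D) \<subseteq> (\<Union>z\<in>Z. ball z (g / 2))"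
    using g unfolding compact_eq_totally_bounded by (meson half_gt_zero)
  show ?thesis
  proof (intro exI[of _ "card Z"] allI impI)
    fix \<rho> x T assume T: "T \<subseteq> cut \<rho>" and near: "\<forall>v\<in>T. \<exists>y\<in>K. dist (foldr S v y) x \<le> C * \<rho>"
    define f where "f v = (1 / \<rho>) *\<^sub>R (foldr S v u - x)" for v
    have \<rho>: "0 < \<rho>" if "v \<in> T" for v using T that cut_bounds(4) by blast
    have "f v \<in> cball 0 (C + D)" if v: "v \<in> T" for v
    proof -
      obtain y where y: "y \<in> K" "dist (foldr S v y) x \<le> C * \<rho>" using near v by blast
      have "dist (foldr S v u) (foldr S v y) = rat v * dist u y"
        using cut_bounds(1) T v by (intro dist_word) blast
      also have "\<dots> \<le> \<rho> * D"
        using cut_bounds(2)[of v \<rho>] T v D[OF y(1)] \<rho>[OF v] by (intro mult_mono) auto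
      finally have "dist (foldr S v u) x \<le> (C + D) * \<rho>"
        using y(2) dist_triangle[of "foldr S v u" x "foldr S v y"] by (simp add: algebra_simps)
      moreover have "norm (f v) = dist (foldr S v u) x / \<rho>"
        using \<rho>[OF v] by (simp add: f_def dist_norm)
      ultimately show ?thesis using \<rho>[OF v] by (simp add: pos_divide_le_eq)
    qed
    then have "\<forall>v\<in>T. \<exists>z\<in>Z. dist z (f v) < g / 2" using Z(2) by fastforce
    then obtain c where c: "\<And>v. v \<in> T \<Longrightarrow> c v \<in> Z" "\<And>v. v \<in> T \<Longrightarrow> dist (c v) (f v) < g / 2"
      by metis
    have "inj_on c T"
    proof (rule inj_onI, rule ccontr)
      fix v w assume vw: "v \<in> T" "w \<in> T" "c v = c w" "v \<noteq> w"
      then have cut: "v \<in> cut \<rho>" "w \<in> cut \<rho>" using T by auto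
      have "dist (f v) (f w) < g"
        using c(2)[OF vw(1)] c(2)[OF vw(2)] vw(3) dist_triangle_half_r by metis
      moreover have "f v - f w = (1 / \<rho>) *\<^sub>R (foldr S v u - foldr S w u)"
        by (simp add: f_def algebra_simps)
      then have "dist (f v) (f w) = dist (foldr S v u) (foldr S w u) / \<rho>"
        using \<rho>[OF vw(1)] by (simp only: dist_norm norm_scaleR) simp
      ultimately have "dist (foldr S v u) (foldr S w u) < g * \<rho>"
        using \<rho>[OF vw(1)] by (simp add: pos_divide_less_eq)
      moreover have "rat v * b \<le> dist (foldr S v u) (foldr S w u)"
        by (intro parallel_words_separated b u cut_parallel[OF cut] vw cut_bounds[OF cut(1)] cut_bounds[OF cut(2)])
      moreover have "rmin * \<rho> * b \<le> rat v * b"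
        using cut_bounds(3)[OF cut(1)] b by (intro mult_right_mono) auto
      ultimately show False by (simp add: g_def mult_ac)
    qed
    then show "card T \<le> card Z" using c(1) Z(1) by (intro card_inj_on_le) auto
  qed
qed

definition pw :: "nat list \<Rightarrow> real" where "pw w = prod_list (map p w)"

lemma pw_simps [simp]: "pw [] = 1" "pw (i # w) = p i * pw w" "pw (u @ v) = pw u * pw v"
  by (simp_all add: pw_def)

lemma pw_pos: "set w \<subseteq> I \<Longrightarrow> 0 < pw w"
  by (induction w) (auto intro!: mult_pos_pos p_pos)

definition cyl :: "nat list \<Rightarrow> nat stream set" where "cyl w = {\<omega>. stake (length w) \<omega> = w}"

lemma cyl_sets [measurable]: "cyl w \<in> sets M"
  using measurable_stake_set[of "length w" "{w}"] by (simp add: cyl_def)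

lemma measure_cyl: "set w \<subseteq> I \<Longrightarrow> measure M (cyl w) = pw w"
  unfolding cyl_def pw_def by (rule measure_cylinder)

lemma measure_cyls_le:
  assumes "T \<subseteq> cut \<rho>" shows "measure M (\<Union>w\<in>T. cyl w) \<le> (\<Sum>w\<in>T. pw w)"
proof -
  have "finite T" using assms finite_cut by (rule finite_subset)
  then have "measure M (\<Union>w\<in>T. cyl w) \<le> (\<Sum>w\<in>T. measure M (cyl w))"
    by (intro M.finite_measure_subadditive_finite) auto
  also have "\<dots> = (\<Sum>w\<in>T. pw w)"
    using assms cut_bounds(1) by (intro sum.cong measure_cyl) auto
  finally show ?thesis .
qed

lemma sum_cut_le_1: "(\<Sum>w\<in>cut \<rho>. pw w) \<le> 1"
proof -
  have "disjoint_family_on cyl (cut \<rho>)"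
    unfolding disjoint_family_on_def
  proof (intro ballI impI, rule ccontr)
    fix v w assume vw: "v \<in> cut \<rho>" "w \<in> cut \<rho>" "v \<noteq> w" "cyl v \<inter> cyl w \<noteq> {}"
    then obtain \<omega> where \<omega>: "stake (length v) \<omega> = v" "stake (length w) \<omega> = w" by (auto simp: cyl_def)
    have "prefix v w \<or> prefix w v"
    proof (cases "length v \<le> length w")
      case True
      then have "v = take (length v) w" using \<omega> by (metis take_stake min.absorb1)
      then show ?thesis by (metis take_is_prefix)
    next
      case False
      then have "w = take (length w) v" using \<omega> by (metis take_stake min.absorb1 nat_le_linear)
      then show ?thesis by (metis take_is_prefix)
    qed
    then show False using cut_parallel[OF vw(1-3)] by (auto simp: parallel_def)
  qed
  then have "(\<Sum>w\<in>cut \<rho>. measure M (cyl w)) = measure M (\<Union>w\<in>cut \<rho>. cyl w)"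
    by (intro M.finite_measure_finite_Union[symmetric] finite_cut) auto
  then show ?thesis
    using cut_bounds(1) M.prob_le_1 by (simp add: measure_cyl cong: sum.cong)
qed

text \<open>A sequence coded into \<open>F\<close> passes through a cut word whose image of \<open>K\<close> meets \<open>F\<close>.\<close>

lemma measure_near_le:
  assumes \<rho>: "0 < \<rho>" "\<rho> < 1" and F: "F \<in> sets borel"
  shows "measure M {\<omega>. code \<omega> \<in> F} \<le> (\<Sum>w\<in>{w\<in>cut \<rho>. \<exists>y\<in>K. foldr S w y \<in> F}. pw w)"
proof -
  have "measure M {\<omega>. code \<omega> \<in> F} \<le> measure M (\<Union>w\<in>{w\<in>cut \<rho>. \<exists>y\<in>K. foldr S w y \<in> F}. cyl w)"
  proof (rule M.finite_measure_mono_AE)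
    show "AE \<omega> in M. \<omega> \<in> {\<omega>. code \<omega> \<in> F} \<longrightarrow> \<omega> \<in> (\<Union>w\<in>{w\<in>cut \<rho>. \<exists>y\<in>K. foldr S w y \<in> F}. cyl w)"
      using AE_streams
    proof eventually_elim
      case (elim \<omega>)
      obtain n where n: "stake n \<omega> \<in> cut \<rho>" using stake_in_cut[OF elim \<rho>] by blast
      have "code \<omega> = foldr S (stake n \<omega>) (code (sdrop n \<omega>))" by (rule code_stake[OF elim])
      moreover have "code (sdrop n \<omega>) \<in> K" by (intro code_in_K sdrop_streams elim)
      moreover have "\<omega> \<in> cyl (stake n \<omega>)" by (simp add: cyl_def)
      ultimately show ?case using n by (auto intro!: exI[of _ "stake n \<omega>"])
    qed
    show "(\<Union>w\<in>{w\<in>cut \<rho>. \<exists>y\<in>K. foldr S w y \<in> F}. cyl w) \<in> sets M"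
      using finite_cut by (intro sets.finite_UN) auto
  qed
  also have "\<dots> \<le> (\<Sum>w\<in>{w\<in>cut \<rho>. \<exists>y\<in>K. foldr S w y \<in> F}. pw w)"
    by (rule measure_cyls_le) auto
  finally show ?thesis .
qed

text \<open>A ball can meet neighbouring cylinders of much larger mass than its own, but rarely: the
  total mass of the cut words whose neighbourhood is \<open>A\<close> times heavier than themselves is at
  most \<open>N / A\<close>, as every word belongs to at most \<open>N\<close> neighbourhoods.  With \<open>A = j\<^sup>2\<close>
  at scale \<open>2 powr - j\<close> this is summable.\<close>

theorem mass_ball_le_cylinder:
  "AE \<omega> in M. \<forall>\<^sub>F j in sequentially. \<forall>n. stake n \<omega> \<in> cut ((1 / 2) ^ j) \<longrightarrow>
     measure \<mu> (cball (code \<omega>) ((1 / 2) ^ j)) \<le> (real j)\<^sup>2 * pw (stake n \<omega>)"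
proof -
  define nb where "nb \<rho> v = {w\<in>cut \<rho>. \<exists>x\<in>K. \<exists>y\<in>K. dist (foldr S v x) (foldr S w y) \<le> \<rho>}" for \<rho> v
  define bad where "bad \<rho> A = {v\<in>cut \<rho>. A * pw v < (\<Sum>w\<in>nb \<rho> v. pw w)}" for \<rho> A
  obtain N :: nat where N: "\<And>\<rho> x T. T \<subseteq> cut \<rho> \<Longrightarrow> (\<forall>v\<in>T. \<exists>y\<in>K. dist (foldr S v y) x \<le> (1 + diameter K) * \<rho>) \<Longrightarrow> card T \<le> N"
    using cut_words_near_point[of "1 + diameter K"] by blast
  have nb_card: "card {v\<in>cut \<rho>. w \<in> nb \<rho> v} \<le> N" if w: "w \<in> cut \<rho>" for \<rho> w
  proof (rule N)
    show "\<forall>v\<in>{v\<in>cut \<rho>. w \<in> nb \<rho> v}. \<exists>y\<in>K. dist (foldr S v y) (foldr S w x0) \<le> (1 + diameter K) * \<rho>"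
    proof
      fix v assume "v \<in> {v\<in>cut \<rho>. w \<in> nb \<rho> v}"
      then obtain x y where xy: "x \<in> K" "y \<in> K" "dist (foldr S v x) (foldr S w y) \<le> \<rho>"
        by (auto simp: nb_def)
      have "dist (foldr S w y) (foldr S w x0) \<le> \<rho> * diameter K"
        unfolding dist_word[OF cut_bounds(1)[OF w]] using cut_bounds[OF w]
        by (intro mult_mono dist_K xy x0) auto
      then have "dist (foldr S v x) (foldr S w x0) \<le> (1 + diameter K) * \<rho>"
        using xy(3) dist_triangle[of "foldr S v x" "foldr S w x0" "foldr S w y"] by (simp add: algebra_simps)
      then show "\<exists>y\<in>K. dist (foldr S v y) (foldr S w x0) \<le> (1 + diameter K) * \<rho>" using xy(1) by blast
    qed
  qed auto
  have bad_sum: "A * (\<Sum>v\<in>bad \<rho> A. pw v) \<le> N" for \<rho> A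
  proof -
    have "A * (\<Sum>v\<in>bad \<rho> A. pw v) \<le> (\<Sum>v\<in>bad \<rho> A. \<Sum>w\<in>nb \<rho> v. pw w)"
      unfolding sum_distrib_left by (intro sum_mono) (auto simp: bad_def)
    also have "\<dots> \<le> (\<Sum>v\<in>cut \<rho>. \<Sum>w\<in>nb \<rho> v. pw w)"
      using finite_cut by (intro sum_mono2 sum_nonneg)
        (auto simp: bad_def nb_def intro!: less_imp_le[OF pw_pos] dest: cut_bounds(1))
    also have "\<dots> = (\<Sum>v\<in>cut \<rho>. \<Sum>w\<in>cut \<rho>. if w \<in> nb \<rho> v then pw w else 0)"
    proof (rule sum.cong[OF refl])
      fix v
      have "{w\<in>cut \<rho>. w \<in> nb \<rho> v} = nb \<rho> v" by (auto simp: nb_def)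
      then show "(\<Sum>w\<in>nb \<rho> v. pw w) = (\<Sum>w\<in>cut \<rho>. if w \<in> nb \<rho> v then pw w else 0)"
        using sum.inter_filter[OF finite_cut[of \<rho>], where g=pw and P="\<lambda>w. w \<in> nb \<rho> v"] by simp
    qed
    also have "\<dots> = (\<Sum>w\<in>cut \<rho>. \<Sum>v\<in>cut \<rho>. if w \<in> nb \<rho> v then pw w else 0)"
      by (rule sum.swap)
    also have "\<dots> = (\<Sum>w\<in>cut \<rho>. real (card {v\<in>cut \<rho>. w \<in> nb \<rho> v}) * pw w)"
      by (intro sum.cong refl) (simp add: sum.If_cases finite_cut Int_def)
    also have "\<dots> \<le> (\<Sum>w\<in>cut \<rho>. real N * pw w)"
      using nb_card by (intro sum_mono mult_right_mono) (auto intro!: less_imp_le[OF pw_pos] dest: cut_bounds(1))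
    also have "\<dots> \<le> real N * 1"
      unfolding sum_distrib_left[symmetric] by (intro mult_left_mono sum_cut_le_1) auto
    finally show ?thesis by simp
  qed
  define B where "B j = (\<Union>w\<in>bad ((1 / 2) ^ j) ((real j)\<^sup>2). cyl w)" for j :: nat
  have bad_cut: "bad \<rho> A \<subseteq> cut \<rho>" for \<rho> A by (auto simp: bad_def)
  have B_sets: "B j \<in> sets M" for j
    unfolding B_def using finite_subset[OF bad_cut finite_cut] by (intro sets.finite_UN) auto
  have "summable (\<lambda>j. measure M (B j))"
  proof (rule summable_comparison_test_ev)
    show "\<forall>\<^sub>F j in sequentially. norm (measure M (B j)) \<le> real N * (1 / (real j)\<^sup>2)"
      using eventually_gt_at_top[of 0]
    proof eventually_elim
      case (elim j)
      have "(real j)\<^sup>2 * measure M (B j) \<le> (real j)\<^sup>2 * (\<Sum>v\<in>bad ((1 / 2) ^ j) ((real j)\<^sup>2). pw v)"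
        unfolding B_def by (intro mult_left_mono measure_cyls_le[OF bad_cut]) auto
      also have "\<dots> \<le> N" by (rule bad_sum)
      finally show ?case using elim by (simp add: field_simps)
    qed
    have "summable (\<lambda>j. 1 / (real j)\<^sup>2)"
      using inverse_power_summable[of 2, where 'a=real] by (simp add: inverse_eq_divide)
    then show "summable (\<lambda>j. real N * (1 / (real j)\<^sup>2))" by (rule summable_mult)
  qed
  then have "AE \<omega> in M. \<forall>\<^sub>F j in sequentially. \<omega> \<in> space M - B j"
    by (intro borel_cantelli_AE1 B_sets) (auto simp: M.emeasure_eq_measure)
  then show ?thesis
    using AE_streams
  proof eventually_elim
    case (elim \<omega>)
    from elim(1) eventually_gt_at_top[of 0] show ?case
    proof eventually_elim
      case (elim j)
      show ?case
      proof (intro allI impI)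
        let ?\<rho> = "(1 / 2 :: real) ^ j"
        fix n assume n: "stake n \<omega> \<in> cut ?\<rho>"
        have \<rho>: "0 < ?\<rho>" "?\<rho> < 1" using elim(2) by (auto simp: power_less_one_iff)
        have "\<omega> \<in> cyl (stake n \<omega>)" by (simp add: cyl_def)
        then have good: "stake n \<omega> \<notin> bad ?\<rho> ((real j)\<^sup>2)" using elim(1) by (auto simp: B_def)
        have "measure \<mu> (cball (code \<omega>) ?\<rho>) = measure M {\<omega>'. code \<omega>' \<in> cball (code \<omega>) ?\<rho>}"
          by (rule measure_\<mu>) simp
        also have "\<dots> \<le> (\<Sum>w\<in>{w\<in>cut ?\<rho>. \<exists>y\<in>K. foldr S w y \<in> cball (code \<omega>) ?\<rho>}. pw w)"
          by (rule measure_near_le[OF \<rho>]) simp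
        also have "\<dots> \<le> (\<Sum>w\<in>nb ?\<rho> (stake n \<omega>). pw w)"
        proof (rule sum_mono2)
          show "finite (nb ?\<rho> (stake n \<omega>))"
            by (rule finite_subset[OF _ finite_cut[of ?\<rho>]]) (auto simp: nb_def)
          have "code (sdrop n \<omega>) \<in> K" by (intro code_in_K sdrop_streams \<open>\<omega> \<in> streams I\<close>)
          then show "{w\<in>cut ?\<rho>. \<exists>y\<in>K. foldr S w y \<in> cball (code \<omega>) ?\<rho>} \<subseteq> nb ?\<rho> (stake n \<omega>)"
            unfolding nb_def code_stake[OF \<open>\<omega> \<in> streams I\<close>, of n] by auto
        qed (auto simp: nb_def intro!: less_imp_le[OF pw_pos] dest: cut_bounds(1))
        also have "\<dots> \<le> (real j)\<^sup>2 * pw (stake n \<omega>)"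
          using good n by (simp add: bad_def)
        finally show "measure \<mu> (cball (code \<omega>) ?\<rho>) \<le> (real j)\<^sup>2 * pw (stake n \<omega>)" .
      qed
    qed
  qed
qed

end

section \<open>The Hausdorff dimension of the attractor\<close>

context ifs
begin

lemma sum_words_powr:
  "(\<Sum>w\<in>{w. set w \<subseteq> I \<and> length w = n}. rat w powr s) = (\<Sum>i\<in>I. r i powr s) ^ n"
proof (induction n)
  case 0
  have "{w. set w \<subseteq> I \<and> length w = 0} = {[]}" by auto
  then show ?case by simp
next
  case (Suc n)
  let ?W = "\<lambda>n. {w. set w \<subseteq> I \<and> length w = n}"
  have eq: "?W (Suc n) = (\<lambda>(i, w). i # w) ` (I \<times> ?W n)"
    by (auto simp: length_Suc_conv image_iff)
  have inj: "inj_on (\<lambda>(i, w). i # w) (I \<times> ?W n)" by (auto simp: inj_on_def)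
  have "(\<Sum>w\<in>?W (Suc n). rat w powr s) = (\<Sum>(i, w)\<in>I \<times> ?W n. (r i * rat w) powr s)"
    unfolding eq by (subst sum.reindex[OF inj]) (auto intro!: sum.cong)
  also have "\<dots> = (\<Sum>i\<in>I. \<Sum>w\<in>?W n. r i powr s * rat w powr s)"
    unfolding sum.cartesian_product by (intro sum.cong) (auto simp: powr_mult)
  also have "\<dots> = (\<Sum>i\<in>I. r i powr s) ^ Suc n"
    by (simp add: sum_product[symmetric] Suc.IH)
  finally show ?case .
qed

text \<open>The natural cover of \<open>K\<close> by its images under the words of length \<open>n\<close>, enumerated as a sequence
  that continues with empty sets.\<close>

lemma hausdorff_premeasure_le_words:
  assumes s: "0 < s" and \<eta>: "rmax ^ n * diameter K \<le> \<eta>"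
  shows "hausdorff_premeasure s \<eta> K \<le> ennreal ((\<Sum>i\<in>I. r i powr s) ^ n * diameter K powr s)"
proof -
  let ?W = "{w. set w \<subseteq> I \<and> length w = n}"
  have fin: "finite ?W" by (rule finite_lists_length_eq[OF finite_letters])
  then obtain h where h: "bij_betw h {0..<card ?W} ?W" using ex_bij_betw_nat_finite by blast
  define A where "A i = (if i < card ?W then foldr S (h i) ` K else {})" for i
  have hW: "h i \<in> ?W" if "i < card ?W" for i using h that by (auto simp: bij_betw_def)
  have bd: "bounded (foldr S w ` K)" if "set w \<subseteq> I" for w
    using K_compact continuous_on_subset[OF continuous_word[OF that]]
    by (intro compact_imp_bounded compact_continuous_image) auto
  have diam: "diameter (foldr S w ` K) \<le> rat w * diameter K" if "set w \<subseteq> I" for w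
    using K_ne diameter_K rat_pos[OF that]
    by (intro diameter_le) (auto simp: dist_norm[symmetric] dist_word[OF that] intro!: mult_left_mono dist_K)
  have nonneg: "0 \<le> diameter (A i)" for i
    using hW[of i] bd by (auto simp: A_def intro!: diameter_ge_0)
  have A_diam: "diameter (A i) \<le> rat (h i) * diameter K" if "i < card ?W" for i
    using diam hW[OF that] that by (simp add: A_def)
  have "A \<in> {A :: nat \<Rightarrow> 'a set. K \<subseteq> (\<Union>i. A i) \<and> (\<forall>i. bounded (A i) \<and> diameter (A i) \<le> \<eta>)}"
  proof (intro CollectI conjI allI)
    show "K \<subseteq> (\<Union>i. A i)"
    proof
      fix x assume "x \<in> K"
      then obtain w where w: "w \<in> ?W" "x \<in> foldr S w ` K" using K_covered_by_words[of x n] by blast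
      have "w \<in> h ` {0..<card ?W}" using w(1) h by (simp only: bij_betw_def)
      then obtain i where "w = h i" "i \<in> {0..<card ?W}" by (rule imageE)
      then have "x \<in> A i" using w(2) by (simp add: A_def)
      then show "x \<in> (\<Union>i. A i)" by blast
    qed
    show "bounded (A i)" for i using hW[of i] bd by (auto simp: A_def)
    have "rat w * diameter K \<le> \<eta>" if "w \<in> ?W" for w
      using rat_le[of w] that diameter_K \<eta> mult_right_mono[of "rat w" "rmax ^ n" "diameter K"] by auto
    moreover have "0 \<le> \<eta>"
      using \<eta> rmax diameter_K by (meson less_imp_le mult_nonneg_nonneg order_trans zero_le_power)
    ultimately show "diameter (A i) \<le> \<eta>" for i
      using A_diam[of i] hW[of i] by (cases "i < card ?W") (auto simp: A_def intro: order_trans)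
  qed
  then have "hausdorff_premeasure s \<eta> K \<le> (\<Sum>i. ennreal (diameter (A i) powr s))"
    unfolding hausdorff_premeasure_def by (rule INF_lower)
  also have "\<dots> = (\<Sum>i<card ?W. ennreal (diameter (A i) powr s))"
    by (rule suminf_finite) (auto simp: A_def)
  also have "\<dots> \<le> (\<Sum>i<card ?W. ennreal ((rat (h i) * diameter K) powr s))"
    using A_diam nonneg s by (intro sum_mono ennreal_leI powr_mono2) auto
  also have "\<dots> = ennreal (\<Sum>i<card ?W. (rat (h i) * diameter K) powr s)"
    by (intro sum_ennreal) auto
  also have "(\<Sum>i<card ?W. (rat (h i) * diameter K) powr s) = (\<Sum>w\<in>?W. (rat w * diameter K) powr s)"
    using sum.reindex_bij_betw[OF h, of "\<lambda>w. (rat w * diameter K) powr s"] by (simp add: atLeast0LessThan)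
  also have "\<dots> = (\<Sum>w\<in>?W. rat w powr s) * diameter K powr s"
    unfolding sum_distrib_right by (intro sum.cong refl) (auto simp: powr_mult)
  finally show ?thesis by (simp only: sum_words_powr)
qed

lemma hausdorff_measure_zero:
  assumes s: "0 < s" "(\<Sum>i\<in>I. r i powr s) < 1"
  shows "hausdorff_measure s K = 0"
proof -
  let ?q = "\<Sum>i\<in>I. r i powr s"
  have q: "0 \<le> ?q" by (simp add: sum_nonneg)
  have "hausdorff_premeasure s \<eta> K \<le> 0" if \<eta>: "0 < \<eta>" for \<eta>
  proof (rule ennreal_le_epsilon)
    fix e :: real assume e: "0 < e"
    have "(\<lambda>n. rmax ^ n * diameter K) \<longlonglongrightarrow> 0 * diameter K"
      using rmax by (intro tendsto_intros LIMSEQ_realpow_zero) auto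
    then have 1: "\<forall>\<^sub>F n in sequentially. rmax ^ n * diameter K < \<eta>"
      using \<eta> by (intro order_tendstoD) auto
    have "(\<lambda>n. ?q ^ n * diameter K powr s) \<longlonglongrightarrow> 0 * diameter K powr s"
      using q s by (intro tendsto_intros LIMSEQ_realpow_zero) auto
    then have 2: "\<forall>\<^sub>F n in sequentially. ?q ^ n * diameter K powr s < e"
      using e by (intro order_tendstoD) auto
    from eventually_conj[OF 1 2] obtain n where
      n: "rmax ^ n * diameter K < \<eta>" "?q ^ n * diameter K powr s < e"
      by (auto simp: eventually_sequentially)
    have "hausdorff_premeasure s \<eta> K \<le> ennreal (?q ^ n * diameter K powr s)"
      using n by (intro hausdorff_premeasure_le_words s) auto
    also have "\<dots> \<le> 0 + ennreal e" using n by (simp add: ennreal_leI)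
    finally show "hausdorff_premeasure s \<eta> K \<le> 0 + ennreal e" .
  qed
  then show ?thesis
    unfolding hausdorff_measure_eq_Sup
    by (metis (no_types, lifting) SUP_least greaterThan_iff le_zero_eq)
qed

lemma hausdorff_dim_nonneg_le:
  assumes s: "0 < s" "(\<Sum>i\<in>I. r i powr s) < 1"
  shows "0 \<le> hausdorff_dim K \<and> hausdorff_dim K \<le> s"
proof -
  let ?D = "{s. s > 0 \<and> hausdorff_measure s K = 0}"
  have s_in: "s \<in> ?D" using hausdorff_measure_zero[OF s] s by simp
  have "bdd_below ?D" by (rule bdd_belowI[of _ 0]) auto
  then have "Inf ?D \<le> s" using s_in by (intro cInf_lower)
  moreover have "0 \<le> Inf ?D" using s_in by (intro cInf_greatest) auto
  ultimately show ?thesis by (simp add: hausdorff_dim_def)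
qed

end

context osc_ifs
begin

text \<open>With the weights \<open>r i powr s\<close> a cut word at scale \<open>diameter F\<close> has mass at most
  \<open>diameter F powr s\<close>, and boundedly many of them meet \<open>F\<close>.  Sets of diameter zero have no scale
  of their own and are reached as a limit.\<close>

lemma mass_le_diameter:
  assumes p: "\<And>i. i \<in> I \<Longrightarrow> p i = r i powr s" and s: "0 < s"
  shows "\<exists>N>0. \<forall>F. closed F \<longrightarrow> bounded F \<longrightarrow> diameter F < 1 \<longrightarrow>
    measure M {\<omega>. code \<omega> \<in> F} \<le> N * diameter F powr s"
proof -
  obtain N :: nat where N: "\<And>\<rho> x T. T \<subseteq> cut \<rho> \<Longrightarrow> (\<forall>v\<in>T. \<exists>y\<in>K. dist (foldr S v y) x \<le> 1 * \<rho>) \<Longrightarrow> card T \<le> N"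
    using cut_words_near_point[of 1] by blast
  have pw: "pw w = rat w powr s" if "set w \<subseteq> I" for w
    using that
  proof (induction w)
    case (Cons i w)
    then show ?case by (simp add: p powr_mult)
  qed simp
  have le: "measure M {\<omega>. code \<omega> \<in> F} \<le> N * \<rho> powr s"
    if F: "closed F" "bounded F" "diameter F \<le> \<rho>" and \<rho>: "0 < \<rho>" "\<rho> < 1" for F \<rho>
  proof (cases "F = {}")
    case False
    then obtain x where x: "x \<in> F" by blast
    let ?T = "{w\<in>cut \<rho>. \<exists>y\<in>K. foldr S w y \<in> F}"
    have "measure M {\<omega>. code \<omega> \<in> F} \<le> (\<Sum>w\<in>?T. pw w)"
      using F by (intro measure_near_le \<rho>) auto
    also have "\<dots> \<le> (\<Sum>w\<in>?T. \<rho> powr s)"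
    proof (rule sum_mono)
      fix w assume "w \<in> ?T"
      then have w: "w \<in> cut \<rho>" by simp
      show "pw w \<le> \<rho> powr s"
        unfolding pw[OF cut_bounds(1)[OF w]] using s cut_bounds(2)[OF w] rat_pos[OF cut_bounds(1)[OF w]]
        by (intro powr_mono2) auto
    qed
    also have "\<dots> = card ?T * \<rho> powr s" by simp
    also have "\<dots> \<le> N * \<rho> powr s"
    proof (intro mult_right_mono of_nat_mono N)
      show "\<forall>v\<in>?T. \<exists>y\<in>K. dist (foldr S v y) x \<le> 1 * \<rho>"
      proof
        fix v assume "v \<in> ?T"
        then obtain y where y: "y \<in> K" "foldr S v y \<in> F" by blast
        have "dist (foldr S v y) x \<le> 1 * \<rho>"
          using diameter_bounded_bound[OF F(2) y(2) x] F(3) by simp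
        then show "\<exists>y\<in>K. dist (foldr S v y) x \<le> 1 * \<rho>" using y(1) by blast
      qed
    qed auto
    finally show ?thesis .
  qed simp
  show ?thesis
  proof (intro exI[of _ "real N + 1"] conjI allI impI)
    fix F :: "'a set" assume F: "closed F" "bounded F" "diameter F < 1"
    show "measure M {\<omega>. code \<omega> \<in> F} \<le> (real N + 1) * diameter F powr s"
    proof (cases "diameter F = 0")
      case False
      then have "0 < diameter F" using diameter_ge_0[OF F(2)] by simp
      then have "measure M {\<omega>. code \<omega> \<in> F} \<le> N * diameter F powr s"
        using F by (intro le) auto
      then show ?thesis by (simp add: distrib_right add_increasing2)
    next
      case True
      have "((\<lambda>\<rho>. N * \<rho> powr s) \<longlongrightarrow> N * 0 powr s) (at_right 0)"
        using s by (intro tendsto_intros) (auto intro: eventually_mono[OF eventually_at_right_less] less_imp_le)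
      then have "((\<lambda>\<rho>. N * \<rho> powr s) \<longlongrightarrow> 0) (at_right 0)" by simp
      moreover have "\<forall>\<^sub>F \<rho> in at_right 0. measure M {\<omega>. code \<omega> \<in> F} \<le> N * \<rho> powr s"
        unfolding eventually_at_right_field using F True
        by (intro exI[of _ 1]) (auto intro!: le)
      ultimately have "measure M {\<omega>. code \<omega> \<in> F} \<le> 0"
        by (intro tendsto_lowerbound) auto
      then show ?thesis by (simp add: order_trans)
    qed
  qed simp
qed

text \<open>The mass distribution principle: each cover of \<open>K\<close> carries total mass one.\<close>

lemma hausdorff_measure_pos:
  assumes p: "\<And>i. i \<in> I \<Longrightarrow> p i = r i powr s" and s: "0 < s" and t: "0 < t" "t \<le> s"
  shows "hausdorff_measure t K \<noteq> 0"
proof -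
  obtain N where N: "0 < N" "\<And>F. closed F \<Longrightarrow> bounded F \<Longrightarrow> diameter F < 1 \<Longrightarrow>
      measure M {\<omega>. code \<omega> \<in> F} \<le> N * diameter F powr s"
    using mass_le_diameter[OF p s] by blast
  have "ennreal (1 / N) \<le> hausdorff_premeasure t (1 / 2) K"
    unfolding hausdorff_premeasure_def
  proof (rule INF_greatest, elim CollectE conjE)
    fix A :: "nat \<Rightarrow> 'a set"
    assume cov: "K \<subseteq> (\<Union>i. A i)" and A: "\<forall>i. bounded (A i) \<and> diameter (A i) \<le> 1 / 2"
    have "1 = emeasure M {\<omega>. code \<omega> \<in> K}"
    proof -
      have "measure M {\<omega>. code \<omega> \<in> K} = 1"
      proof (rule M.prob_eq_1[THEN iffD2])
        show "{\<omega>. code \<omega> \<in> K} \<in> sets M" by (intro code_sets borel_closed compact_imp_closed K_compact)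
        show "AE \<omega> in M. \<omega> \<in> {\<omega>. code \<omega> \<in> K}"
          using AE_streams by eventually_elim (simp add: code_in_K)
      qed
      then show ?thesis by (simp add: M.emeasure_eq_measure)
    qed
    also have "\<dots> \<le> emeasure M (\<Union>i. {\<omega>. code \<omega> \<in> closure (A i)})"
      using cov closure_subset by (intro emeasure_mono) (auto intro!: code_sets, blast)
    also have "\<dots> \<le> (\<Sum>i. emeasure M {\<omega>. code \<omega> \<in> closure (A i)})"
      by (intro emeasure_subadditive_countably) (auto intro!: code_sets)
    also have "\<dots> \<le> (\<Sum>i. ennreal N * ennreal (diameter (A i) powr t))"
    proof (rule suminf_le)
      fix i
      have bd: "bounded (A i)" "diameter (A i) \<le> 1 / 2" using A by auto
      then have "measure M {\<omega>. code \<omega> \<in> closure (A i)} \<le> N * diameter (A i) powr s"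
        using N(2)[of "closure (A i)"] by (simp add: diameter_closure bounded_closure)
      also have "\<dots> \<le> N * diameter (A i) powr t"
        using N(1) bd t diameter_ge_0[OF bd(1)] by (intro mult_left_mono powr_mono') auto
      finally show "emeasure M {\<omega>. code \<omega> \<in> closure (A i)} \<le> ennreal N * ennreal (diameter (A i) powr t)"
        using N(1) by (simp add: M.emeasure_eq_measure ennreal_mult[symmetric] ennreal_leI)
    qed auto
    also have "\<dots> = ennreal N * (\<Sum>i. ennreal (diameter (A i) powr t))"
      by (rule ennreal_suminf_cmult)
    finally have "ennreal (1 / N) * 1 \<le> ennreal (1 / N) * (ennreal N * (\<Sum>i. ennreal (diameter (A i) powr t)))"
      by (rule mult_left_mono) simp
    also have "\<dots> = (\<Sum>i. ennreal (diameter (A i) powr t))"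
      using N(1) by (simp add: mult.assoc[symmetric] ennreal_mult[symmetric])
    finally show "ennreal (1 / N) \<le> (\<Sum>i. ennreal (diameter (A i) powr t))" by simp
  qed
  also have "\<dots> \<le> hausdorff_measure t K"
    unfolding hausdorff_measure_eq_Sup by (rule SUP_upper) simp
  finally show ?thesis using N(1) by auto
qed

theorem hausdorff_dim_attractor:
  assumes p: "\<And>i. i \<in> I \<Longrightarrow> p i = r i powr s" and s: "0 < s"
  shows "hausdorff_dim K = s"
proof -
  let ?D = "{s. s > 0 \<and> hausdorff_measure s K = 0}"
  have r_sum: "(\<Sum>i\<in>I. r i powr s) = 1" using p p_sum by simp
  have up: "t \<in> ?D" if "s < t" for t
    using moran_sum_strict_anti[OF finite_letters letters_ne _ that, of r] ratio r_sum s that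
    by (auto intro!: hausdorff_measure_zero)
  have low: "s \<le> t" if "t \<in> ?D" for t
    using hausdorff_measure_pos[OF p s, of t] that by (force simp: not_le)
  have "Inf ?D = s"
  proof (rule antisym)
    show "Inf ?D \<le> s"
    proof (rule dense_ge)
      fix t assume "s < t"
      then show "Inf ?D \<le> t" using up low by (intro cInf_lower) (auto intro!: bdd_belowI[of _ s])
    qed
    show "s \<le> Inf ?D" using up[of "s + 1"] low by (intro cInf_greatest) auto
  qed
  then show ?thesis by (simp add: hausdorff_dim_def)
qed

end

section \<open>Gauge functions\<close>

text \<open>A constant factor disappears under \<open>ln ln\<close>, so only the square root of the quotient remains.\<close>

lemma lil_ratio:
  assumes a: "filterlim a at_top F" and ba: "((\<lambda>x. b x / a x) \<longlongrightarrow> c) F" and c: "0 < c"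
  shows "((\<lambda>x. lil (b x) / lil (a x)) \<longlongrightarrow> sqrt c) F"
proof -
  have lnln: "((\<lambda>y. ln (ln (k * y)) / ln (ln y)) \<longlongrightarrow> 1) at_top" if "0 < k" for k :: real
    using that by real_asymp
  have a_large: "\<forall>\<^sub>F x in F. k \<le> a x" for k
    using a by (simp add: filterlim_at_top)
  have "\<forall>\<^sub>F x in F. c / 2 < b x / a x" "\<forall>\<^sub>F x in F. b x / a x < 2 * c"
    using c by (intro order_tendstoD[OF ba], simp)+
  then have between: "\<forall>\<^sub>F x in F. c / 2 * a x \<le> b x \<and> b x \<le> 2 * c * a x \<and> exp 1 \<le> c / 2 * a x \<and> exp 2 \<le> a x"
    using a_large[of "exp 2"] a_large[of "2 * exp 1 / c"]
  proof eventually_elim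
    case (elim x)
    have "0 < a x" using elim(3) exp_gt_zero[of "2::real"] by linarith
    with elim c show ?case by (simp add: field_simps)
  qed
  have "((\<lambda>x. ln (ln (b x)) / ln (ln (a x))) \<longlongrightarrow> 1) F"
  proof (rule tendsto_sandwich)
    show "((\<lambda>x. ln (ln (c / 2 * a x)) / ln (ln (a x))) \<longlongrightarrow> 1) F"
      using c by (intro filterlim_compose[OF lnln a]) auto
    show "((\<lambda>x. ln (ln (2 * c * a x)) / ln (ln (a x))) \<longlongrightarrow> 1) F"
      using c by (intro filterlim_compose[OF lnln a]) auto
    show "\<forall>\<^sub>F x in F. ln (ln (c / 2 * a x)) / ln (ln (a x)) \<le> ln (ln (b x)) / ln (ln (a x))"
      using between
    proof eventually_elim
      case (elim x)
      have "exp 1 \<le> a x" using elim by (meson exp_le_cancel_iff one_le_numeral order_trans)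
      with elim show ?case by (intro divide_right_mono ln_ln_mono ln_ln_nonneg) auto
    qed
    show "\<forall>\<^sub>F x in F. ln (ln (b x)) / ln (ln (a x)) \<le> ln (ln (2 * c * a x)) / ln (ln (a x))"
      using between
    proof eventually_elim
      case (elim x)
      have "exp 1 \<le> a x" using elim by (meson exp_le_cancel_iff one_le_numeral order_trans)
      with elim show ?case by (intro divide_right_mono ln_ln_mono ln_ln_nonneg) auto
    qed
  qed
  then have "((\<lambda>x. sqrt ((b x / a x) * (ln (ln (b x)) / ln (ln (a x))))) \<longlongrightarrow> sqrt (c * 1)) F"
    by (intro tendsto_intros ba)
  then have "((\<lambda>x. sqrt ((b x / a x) * (ln (ln (b x)) / ln (ln (a x))))) \<longlongrightarrow> sqrt c) F" by simp
  moreover have "sqrt ((b x / a x) * (ln (ln (b x)) / ln (ln (a x)))) = lil (b x) / lil (a x)" for x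
    by (simp add: lil_def real_sqrt_divide[symmetric])
  ultimately show ?thesis by simp
qed

lemma filterlim_lil: "filterlim (\<lambda>n. lil (real n)) at_top sequentially"
  unfolding lil_def by real_asymp

lemma const_over_lil: "(\<lambda>n. c / lil (real n)) \<longlonglongrightarrow> 0"
  by (rule real_tendsto_divide_at_top[OF tendsto_const filterlim_lil])

lemma ln_over_lil:
  assumes "0 < c" shows "(\<lambda>n. ln (c * real n) / lil (real n)) \<longlonglongrightarrow> 0"
  unfolding lil_def using assms by real_asymp

lemma lil_over_id: "(\<lambda>n. lil (real n) / real n) \<longlonglongrightarrow> 0"
  unfolding lil_def by real_asymp

lemma Theta_eq_lil: "Theta t = exp (lil (ln (1 / t)))"
  by (simp add: Theta_def lil_def)

lemma Theta_powr: "Theta t powr c = exp (c * lil (ln (1 / t)))"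
  by (simp add: Theta_eq_lil powr_def)

lemma gauge_exp_form:
  assumes "0 < t"
  shows "t powr d * Theta t powr (- s) = exp (- d * ln (1 / t) - s * lil (ln (1 / t)))"
proof -
  have "t powr d = exp (- d * ln (1 / t))" using assms by (simp add: powr_def ln_div)
  then show ?thesis by (simp add: Theta_powr exp_diff exp_minus divide_inverse)
qed

lemma Theta_small:
  assumes "0 < c" "0 < e" shows "\<forall>\<^sub>F t in at_right 0. Theta t powr (- c) < e"
proof -
  have "filterlim (\<lambda>t::real. lil (ln (1 / t))) at_top (at_right 0)"
    unfolding lil_def by real_asymp
  then have "filterlim (\<lambda>t::real. c * lil (ln (1 / t))) at_top (at_right 0)"
    using assms by (intro filterlim_tendsto_pos_mult_at_top[OF tendsto_const])
  then have "((\<lambda>t. exp (- (c * lil (ln (1 / t))))) \<longlongrightarrow> 0) (at_right 0)"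
    by (intro filterlim_compose[OF exp_at_bot] filterlim_compose[OF filterlim_uminus_at_bot_at_top])
  then have "((\<lambda>t. Theta t powr (- c)) \<longlongrightarrow> 0) (at_right 0)" by (simp add: Theta_powr)
  from order_tendstoD(2)[OF this assms(2)] show ?thesis .
qed

lemma gauge_small:
  assumes "a < b" "0 < e"
  shows "\<forall>\<^sub>F t in at_right 0. t powr d * Theta t powr (- b) \<le> e * (t powr d * Theta t powr (- a))"
  using Theta_small[of "b - a" e]
proof (rule eventually_mono)
  fix t assume "Theta t powr (- (b - a)) < e"
  then have "(t powr d * Theta t powr (- a)) * Theta t powr (- (b - a)) \<le> (t powr d * Theta t powr (- a)) * e"
    by (intro mult_left_mono) auto
  moreover have "Theta t powr (- b) = Theta t powr (- a) * Theta t powr (- (b - a))"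
    by (simp add: powr_add[symmetric])
  ultimately show "t powr d * Theta t powr (- b) \<le> e * (t powr d * Theta t powr (- a))"
    by (simp add: mult_ac)
qed (use assms in auto)

section \<open>Local mass of the self-similar measure\<close>

locale lil_ifs = osc_ifs I p S r K U
  for I p and S :: "nat \<Rightarrow> 'a::euclidean_space \<Rightarrow> 'a" and r K U +
  fixes d \<sigma> :: real
  assumes d: "d = (\<Sum>i\<in>I. p i * ln (p i)) / (\<Sum>i\<in>I. p i * ln (r i))"
    and d_pos: "0 < d" and \<sigma>_pos: "0 < \<sigma>"
    and \<sigma>: "\<sigma>\<^sup>2 = (\<Sum>i\<in>I. p i * (ln (p i) - d * ln (r i))\<^sup>2) / - (\<Sum>i\<in>I. p i * ln (r i))"
begin

text \<open>The Lyapunov exponent of the weighted system.\<close>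

definition "lyap = - (\<Sum>i\<in>I. p i * ln (r i))"
definition "X i = ln (p i) - d * ln (r i)"
definition "v = \<sigma>\<^sup>2 * lyap"

definition scale :: "nat list \<Rightarrow> real" where "scale w = - ln (rat w)"

definition fluct :: "nat list \<Rightarrow> real" where "fluct w = sum_list (map X w)"

lemma lyap_pos: "0 < lyap"
proof -
  have "(\<Sum>i\<in>I. p i * ln (r i)) < (\<Sum>i\<in>I. 0)"
    using finite_letters letters_ne p_pos ratio by (intro sum_strict_mono mult_pos_neg) auto
  then show ?thesis by (simp add: lyap_def)
qed

lemma X_mean: "(\<Sum>i\<in>I. p i * X i) = 0"
proof -
  have "(\<Sum>i\<in>I. p i * X i) = (\<Sum>i\<in>I. p i * ln (p i) - d * (p i * ln (r i)))"
    by (intro sum.cong) (auto simp: X_def algebra_simps)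
  also have "\<dots> = (\<Sum>i\<in>I. p i * ln (p i)) - d * (\<Sum>i\<in>I. p i * ln (r i))"
    by (simp only: sum_subtractf sum_distrib_left)
  finally show ?thesis using lyap_pos d by (simp add: lyap_def)
qed

lemma X_var: "(\<Sum>i\<in>I. p i * (X i)\<^sup>2) = v"
  using \<sigma> lyap_pos by (simp add: v_def lyap_def X_def field_simps)

lemma v_pos: "0 < v" using \<sigma>_pos lyap_pos by (simp add: v_def)

lemma sqrt_v: "sqrt v = \<sigma> * sqrt lyap"
  using \<sigma>_pos by (simp add: v_def real_sqrt_mult)

lemma pw_eq_exp: "set w \<subseteq> I \<Longrightarrow> pw w = exp (fluct w - d * scale w)"
proof (induction w)
  case (Cons i w)
  then have i: "i \<in> I" and w: "set w \<subseteq> I" by auto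
  have "ln (rat (i # w)) = ln (r i) + ln (rat w)"
    using ratio[OF i] rat_pos[OF w] by (simp add: ln_mult)
  then have "fluct (i # w) - d * scale (i # w) = ln (p i) + (fluct w - d * scale w)"
    by (simp add: fluct_def scale_def X_def algebra_simps)
  then show ?case using Cons p_pos[OF i] by (simp add: exp_add)
qed (simp add: fluct_def scale_def)

text \<open>The strong law of large numbers for the bounded letters \<open>- ln (r i)\<close>; the law of the iterated
  logarithm, applied to them and to their negatives, is more than enough.\<close>

lemma scale_rate: "AE \<omega> in M. (\<lambda>n. scale (stake n \<omega>) / real n) \<longlonglongrightarrow> lyap"
proof -
  define Y where "Y i = - ln (r i) - lyap" for i
  define V where "V = (\<Sum>i\<in>I. p i * (Y i)\<^sup>2) + 1"
  have "0 \<le> (\<Sum>i\<in>I. p i * (Y i)\<^sup>2)" using p_pos by (intro sum_nonneg) (auto simp: less_imp_le)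
  then have V: "0 < V" by (simp add: V_def)
  have "(\<Sum>i\<in>I. p i * Y i) = (\<Sum>i\<in>I. - (p i * ln (r i)) - lyap * p i)"
    by (intro sum.cong) (auto simp: Y_def algebra_simps)
  also have "\<dots> = 0"
    by (simp only: sum_subtractf sum_distrib_left[symmetric] sum_negf p_sum lyap_def)
  finally have Y_mean: "(\<Sum>i\<in>I. p i * Y i) = 0" .
  have "AE \<omega> in M. \<forall>\<^sub>F n in sequentially. sum_list (map Y (stake n \<omega>)) \<le> (1 + 1) * sqrt V * lil (real n)"
    using Y_mean V by (intro lil_upper) (auto simp: V_def)
  moreover have "AE \<omega> in M. \<forall>\<^sub>F n in sequentially.
      sum_list (map (\<lambda>i. - Y i) (stake n \<omega>)) \<le> (1 + 1) * sqrt V * lil (real n)"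
    using Y_mean V by (intro lil_upper) (auto simp: V_def sum_negf)
  ultimately show ?thesis using AE_streams
  proof eventually_elim
    case (elim \<omega>)
    have Y_scale: "sum_list (map Y w) = scale w - real (length w) * lyap" if "set w \<subseteq> I" for w
      using that
    proof (induction w)
      case (Cons i w)
      then have "ln (rat (i # w)) = ln (r i) + ln (rat w)"
        using ratio[of i] rat_pos[of w] by (simp add: ln_mult)
      then show ?case using Cons by (simp add: Y_def scale_def algebra_simps)
    qed (simp add: scale_def)
    have neg: "sum_list (map (\<lambda>i. - Y i) w) = - sum_list (map Y w)" for w by (induction w) auto
    have lim: "(\<lambda>n. 2 * sqrt V * (lil (real n) / real n)) \<longlonglongrightarrow> 2 * sqrt V * 0"
      by (intro tendsto_intros lil_over_id)
    have "(\<lambda>n. scale (stake n \<omega>) / real n - lyap) \<longlonglongrightarrow> 0"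
    proof (rule Lim_null_comparison)
      show "(\<lambda>n. 2 * sqrt V * (lil (real n) / real n)) \<longlonglongrightarrow> 0" using lim by simp
      show "\<forall>\<^sub>F n in sequentially. norm (scale (stake n \<omega>) / real n - lyap) \<le> 2 * sqrt V * (lil (real n) / real n)"
        using elim(1,2) eventually_gt_at_top[of 0]
      proof eventually_elim
        case (elim n)
        have "\<bar>scale (stake n \<omega>) - real n * lyap\<bar> \<le> 2 * sqrt V * lil (real n)"
          using elim Y_scale[OF set_stake[OF \<open>\<omega> \<in> streams I\<close>], of n] unfolding neg by simp
        moreover have "scale (stake n \<omega>) / real n - lyap = (scale (stake n \<omega>) - real n * lyap) / real n"
          using elim by (simp add: field_simps)
        ultimately show ?case using elim by (simp add: divide_right_mono)
      qed
    qed
    then show ?case by (simp add: LIM_zero_iff)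
  qed
qed

lemma scale_shift:
  assumes "(\<lambda>n. scale (stake n \<omega>) / real n) \<longlonglongrightarrow> lyap"
  shows "(\<lambda>n. lil (scale (stake n \<omega>) + c) / lil (real n)) \<longlonglongrightarrow> sqrt lyap"
proof (rule lil_ratio[OF filterlim_real_sequentially _ lyap_pos])
  have "(\<lambda>n. c / real n) \<longlonglongrightarrow> 0" by real_asymp
  from tendsto_add[OF assms this] show "(\<lambda>n. (scale (stake n \<omega>) + c) / real n) \<longlonglongrightarrow> lyap"
    by (simp add: add_divide_distrib)
qed

lemma scale_at_top:
  assumes "(\<lambda>n. scale (stake n \<omega>) / real n) \<longlonglongrightarrow> lyap"
  shows "filterlim (\<lambda>n. scale (stake n \<omega>)) at_top sequentially"
proof -
  have "filterlim (\<lambda>n. scale (stake n \<omega>) / real n * real n) at_top sequentially"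
    by (rule filterlim_tendsto_pos_mult_at_top[OF assms lyap_pos filterlim_real_sequentially])
  moreover have "\<forall>\<^sub>F n in sequentially. scale (stake n \<omega>) / real n * real n = scale (stake n \<omega>)"
    using eventually_gt_at_top[of 0] by eventually_elim simp
  ultimately show ?thesis by (rule filterlim_cong[OF refl refl, THEN iffD1, rotated])
qed

text \<open>A ball of radius \<open>\<rho>\<close> around a typical point contains the image of \<open>K\<close> under its cut word at
  scale \<open>\<rho> / D\<close>.  The upper half of the law of the iterated logarithm, applied to \<open>- X\<close>, bounds
  the mass of that cylinder below.\<close>

theorem mass_ball_lower:
  assumes \<epsilon>: "0 < \<epsilon>"
  shows "AE \<omega> in M. \<exists>\<rho>0>0. \<forall>\<rho>. 0 < \<rho> \<longrightarrow> \<rho> < \<rho>0 \<longrightarrow>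
    (2 * \<rho>) powr d * Theta (2 * \<rho>) powr (- (\<sigma> + \<epsilon>)) \<le> measure \<mu> (cball (code \<omega>) \<rho>)"
proof -
  define e where "e = \<epsilon> / (2 * \<sigma>)"
  have e: "0 < e" "(1 + e) * \<sigma> = \<sigma> + \<epsilon> / 2" using \<epsilon> \<sigma>_pos by (auto simp: e_def field_simps)
  define D where "D = diameter K + 1"
  have D: "1 \<le> D" "diameter K < D" using diameter_K by (auto simp: D_def)
  define c where "c = ln (2 * D / rmin)"
  have "AE \<omega> in M. \<forall>\<^sub>F n in sequentially.
      sum_list (map (\<lambda>i. - X i) (stake n \<omega>)) \<le> (1 + e) * sqrt v * lil (real n)"
    using X_mean X_var v_pos e by (intro lil_upper) (auto simp: sum_negf)
  then show ?thesis using scale_rate AE_streams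
  proof eventually_elim
    case (elim \<omega>)
    note \<omega> = elim(3)
    have neg: "sum_list (map (\<lambda>i. - X i) w) = - fluct w" for w
      unfolding fluct_def by (induction w) auto
    have "(\<lambda>n. (\<sigma> + \<epsilon>) * (lil (scale (stake n \<omega>) + (- c)) / lil (real n)) - d * c / lil (real n))
        \<longlonglongrightarrow> (\<sigma> + \<epsilon>) * sqrt lyap - 0"
      by (intro tendsto_intros scale_shift elim(2) const_over_lil)
    moreover have "(1 + e) * sqrt v < (\<sigma> + \<epsilon>) * sqrt lyap - 0"
    proof -
      have "(1 + e) * sqrt v = (\<sigma> + \<epsilon> / 2) * sqrt lyap"
        unfolding sqrt_v by (simp only: mult.assoc[symmetric] e(2))
      also have "\<dots> < (\<sigma> + \<epsilon>) * sqrt lyap" using lyap_pos \<epsilon> by (intro mult_strict_right_mono) auto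
      finally show ?thesis by simp
    qed
    ultimately have "\<forall>\<^sub>F n in sequentially. (1 + e) * sqrt v <
        (\<sigma> + \<epsilon>) * (lil (scale (stake n \<omega>) + (- c)) / lil (real n)) - d * c / lil (real n)"
      by (rule order_tendstoD)
    moreover have "\<forall>\<^sub>F n in sequentially. exp 1 + c \<le> scale (stake n \<omega>)"
      using scale_at_top[OF elim(2)] by (simp add: filterlim_at_top)
    moreover have "\<forall>\<^sub>F n in sequentially. 1 \<le> lil (real n)"
      using filterlim_lil by (simp add: filterlim_at_top)
    ultimately have "\<forall>\<^sub>F n in sequentially.
        d * c - fluct (stake n \<omega>) \<le> (\<sigma> + \<epsilon>) * lil (scale (stake n \<omega>) - c) \<and> exp 1 + c \<le> scale (stake n \<omega>)"
      using elim(1)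
    proof eventually_elim
      case (elim n)
      have "(1 + e) * sqrt v * lil (real n) \<le> ((\<sigma> + \<epsilon>) * (lil (scale (stake n \<omega>) + (- c)) / lil (real n)) - d * c / lil (real n)) * lil (real n)"
        using elim by (intro mult_right_mono) auto
      also have "\<dots> = (\<sigma> + \<epsilon>) * lil (scale (stake n \<omega>) - c) - d * c"
        using elim(3) by (simp add: field_simps)
      finally show ?case using elim unfolding neg by linarith
    qed
    then obtain L where L: "\<And>n. L \<le> n \<Longrightarrow> d * c - fluct (stake n \<omega>) \<le> (\<sigma> + \<epsilon>) * lil (scale (stake n \<omega>) - c)"
        "\<And>n. L \<le> n \<Longrightarrow> exp 1 + c \<le> scale (stake n \<omega>)"
      unfolding eventually_sequentially by blast
    define \<rho>0 where "\<rho>0 = rat (stake L \<omega>)"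
    have \<rho>0: "0 < \<rho>0" "\<rho>0 \<le> 1"
      unfolding \<rho>0_def by (intro rat_pos rat_le_1 set_stake \<omega>)+
    show ?case
    proof (intro exI[of _ \<rho>0] conjI allI impI)
      fix \<rho> :: real assume \<rho>: "0 < \<rho>" "\<rho> < \<rho>0"
      have \<rho>D: "0 < \<rho> / D" "\<rho> / D < 1" "\<rho> / D \<le> \<rho>"
        using \<rho> \<rho>0 D by (auto simp: field_simps)
      obtain n where n: "stake n \<omega> \<in> cut (\<rho> / D)" using stake_in_cut[OF \<omega> \<rho>D(1,2)] by blast
      define w where "w = stake n \<omega>"
      have w: "w \<in> cut (\<rho> / D)" "set w \<subseteq> I" using n cut_bounds(1) by (auto simp: w_def)
      have "L \<le> n"
      proof (rule ccontr)
        assume "\<not> L \<le> n"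
        then have "stake L \<omega> = stake n \<omega> @ stake (L - n) (sdrop n \<omega>)" by (simp only: stake_add) simp
        then have "rat (stake L \<omega>) = rat w * rat (stake (L - n) (sdrop n \<omega>))" by (simp only: w_def rat_simps)
        also have "\<dots> \<le> rat w * 1"
          using rat_pos[OF w(2)] by (intro mult_left_mono rat_le_1 set_stake sdrop_streams \<omega>) auto
        also have "\<dots> \<le> \<rho>" using cut_bounds(2)[OF w(1)] \<rho>D by simp
        finally show False using \<rho> by (simp add: \<rho>0_def)
      qed
      define T where "T = ln (1 / (2 * \<rho>))"
      have T_le: "T \<le> scale w"
      proof -
        have "rat w \<le> 2 * \<rho>" using cut_bounds(2)[OF w(1)] \<rho>D \<rho> by linarith
        then have "ln (rat w) \<le> ln (2 * \<rho>)" using rat_pos[OF w(2)] \<rho> by simp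
        then show ?thesis using \<rho> by (simp add: T_def scale_def ln_div)
      qed
      have T_ge: "scale w - c \<le> T"
      proof -
        have "rmin * (\<rho> / D) \<le> rat w" by (rule cut_bounds(3)[OF w(1)])
        then have "2 * \<rho> \<le> rat w * (2 * D / rmin)" using rmin(1) D by (simp add: field_simps)
        then have "ln (2 * \<rho>) \<le> ln (rat w * (2 * D / rmin))" using \<rho> by (intro ln_mono) auto
        also have "\<dots> = ln (rat w) + c"
          unfolding c_def using rat_pos[OF w(2)] D rmin(1) by (intro ln_mult_pos) auto
        finally show ?thesis using \<rho> by (simp add: T_def scale_def ln_div)
      qed
      have "(2 * \<rho>) powr d * Theta (2 * \<rho>) powr (- (\<sigma> + \<epsilon>)) = exp (- d * T - (\<sigma> + \<epsilon>) * lil T)"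
        unfolding T_def using \<rho> by (intro gauge_exp_form) auto
      also have "\<dots> \<le> exp (fluct w - d * scale w)"
      proof -
        have "lil (scale w - c) \<le> lil T"
          using L(2)[OF \<open>L \<le> n\<close>] T_ge by (intro lil_mono) (auto simp: w_def)
        then have "(\<sigma> + \<epsilon>) * lil (scale w - c) \<le> (\<sigma> + \<epsilon>) * lil T"
          using \<sigma>_pos \<epsilon> by (intro mult_left_mono) auto
        moreover have "d * scale w - d * T \<le> d * c"
          using T_ge d_pos unfolding right_diff_distrib[symmetric] by (intro mult_left_mono) auto
        moreover have "d * c - fluct w \<le> (\<sigma> + \<epsilon>) * lil (scale w - c)"
          using L(1)[OF \<open>L \<le> n\<close>] by (simp add: w_def)
        ultimately show ?thesis by simp
      qed
      also have "\<dots> = measure M (cyl w)" by (simp add: pw_eq_exp measure_cyl w)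
      also have "\<dots> \<le> measure M {\<omega>'. code \<omega>' \<in> cball (code \<omega>) \<rho>}"
      proof (rule M.finite_measure_mono_AE)
        show "AE \<omega>' in M. \<omega>' \<in> cyl w \<longrightarrow> \<omega>' \<in> {\<omega>'. code \<omega>' \<in> cball (code \<omega>) \<rho>}"
          using AE_streams
        proof eventually_elim
          case (elim \<omega>')
          show ?case
          proof
            assume "\<omega>' \<in> cyl w"
            then have "stake n \<omega>' = w" by (simp add: cyl_def w_def)
            then have "code \<omega>' = foldr S w (code (sdrop n \<omega>'))" "code \<omega> = foldr S w (code (sdrop n \<omega>))"
              using code_stake[OF elim, of n] code_stake[OF \<omega>, of n] by (simp_all add: w_def)
            then have "dist (code \<omega>) (code \<omega>') = rat w * dist (code (sdrop n \<omega>)) (code (sdrop n \<omega>'))"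
              by (simp add: dist_word[OF w(2)])
            also have "\<dots> \<le> \<rho> / D * D"
              using cut_bounds(2)[OF w(1)] \<rho>D D dist_K[of "code (sdrop n \<omega>)" "code (sdrop n \<omega>')"]
              by (intro mult_mono) (auto intro!: code_in_K sdrop_streams \<omega> elim order_trans[OF dist_K])
            finally show "\<omega>' \<in> {\<omega>'. code \<omega>' \<in> cball (code \<omega>) \<rho>}" using D by simp
          qed
        qed
        show "{\<omega>'. code \<omega>' \<in> cball (code \<omega>) \<rho>} \<in> sets M" by (rule code_sets) simp
      qed
      also have "\<dots> = measure \<mu> (cball (code \<omega>) \<rho>)" by (rule measure_\<mu>[symmetric]) simp
      finally show "(2 * \<rho>) powr d * Theta (2 * \<rho>) powr (- (\<sigma> + \<epsilon>)) \<le> measure \<mu> (cball (code \<omega>) \<rho>)" .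
    qed (rule \<rho>0)
  qed
qed

end

context lil_ifs
begin

text \<open>The lower half of the law for \<open>- X\<close> yields lengths \<open>n\<close> at which the cylinder has small mass.
  The radius \<open>2 powr - j\<close> is the least of its form that is at least the ratio of \<open>stake n \<omega>\<close>; the cut word at
  that scale is a prefix of \<open>stake n \<omega>\<close> with boundedly many letters removed, so it has comparable
  mass, and \<open>mass_ball_le_cylinder\<close> passes from the cylinder to the ball.  The factor \<open>2 / 5\<close>
  is the quotient of the diameter of the fivefold smaller ball and the radius.\<close>

theorem mass_ball_upper:
  assumes \<epsilon>: "0 < \<epsilon>"
  shows "AE \<omega> in M. \<exists>\<^sub>F j in sequentially. measure \<mu> (cball (code \<omega>) ((1 / 2) ^ j))
    \<le> (2 / 5 * (1 / 2) ^ j) powr d * Theta (2 / 5 * (1 / 2) ^ j) powr (- (\<sigma> - \<epsilon>))"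
proof -
  define s where "s = max 0 (\<sigma> - \<epsilon>)"
  have s: "0 \<le> s" "s < \<sigma>" "\<sigma> - \<epsilon> \<le> s" using \<epsilon> \<sigma>_pos by (auto simp: s_def)
  define e where "e = (\<sigma> - s) / (2 * \<sigma>)"
  have e: "0 < e" "(1 - e) * \<sigma> = (\<sigma> + s) / 2" using s \<sigma>_pos by (auto simp: e_def field_simps)
  define pmin where "pmin = Min (p ` I)"
  have "pmin \<in> p ` I" unfolding pmin_def using finite_letters letters_ne by (intro Min_in) auto
  then have pmin_pos: "0 < pmin" using p_pos by auto
  have pmin_le: "pmin \<le> p i" if "i \<in> I" for i
    unfolding pmin_def using finite_letters that by simp
  have pmin_1: "pmin \<le> 1"
  proof -
    obtain i where i: "i \<in> I" using letters_ne by blast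
    have "p i \<le> (\<Sum>i\<in>I. p i)" using finite_letters i p_pos by (intro member_le_sum) (auto simp: less_imp_le)
    then show ?thesis using pmin_le[OF i] p_sum by simp
  qed
  have pw_ge: "pmin ^ length z \<le> pw z" if "set z \<subseteq> I" for z
    using that
  proof (induction z)
    case (Cons i z)
    then show ?case using pmin_pos pmin_le[of i] p_pos[of i] by (auto intro!: mult_mono)
  qed simp
  have "(\<lambda>n. rmax ^ n) \<longlonglongrightarrow> 0" using rmax by (intro LIMSEQ_realpow_zero) auto
  then have "\<forall>\<^sub>F n in sequentially. rmax ^ n < 1 / 2" by (intro order_tendstoD) auto
  then obtain m0 where m0: "rmax ^ m0 < 1 / 2" by (auto simp: eventually_sequentially)
  define c where "c = pmin ^ m0"
  have c: "0 < c" using pmin_pos by (simp add: c_def)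
  define b where "b = ln (5 / 2 :: real)"
  have b: "ln 2 \<le> b" by (simp add: b_def)
  have ln2: "1 / 2 \<le> ln (2::real)" "0 < ln (2::real)" using ln2_ge_two_thirds by linarith+
  have "AE \<omega> in M. \<exists>\<^sub>F n in sequentially.
      (1 - e) * sqrt v * lil (real n) \<le> sum_list (map (\<lambda>i. - X i) (stake n \<omega>))"
    using X_mean X_var v_pos e by (intro lil_lower) (auto simp: sum_negf)
  then show ?thesis using scale_rate mass_ball_le_cylinder AE_streams
  proof eventually_elim
    case (elim \<omega>)
    note \<omega> = elim(4) and rate = elim(2)
    have neg: "sum_list (map (\<lambda>i. - X i) w) = - fluct w" for w
      unfolding fluct_def by (induction w) auto
    have "(\<lambda>n. (d * b - ln c) / lil (real n) + 2 * (ln (4 * lyap * real n) / lil (real n))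
          + s * (lil (scale (stake n \<omega>) + b) / lil (real n)))
        \<longlonglongrightarrow> 0 + 2 * 0 + s * sqrt lyap"
      using lyap_pos by (intro tendsto_intros const_over_lil ln_over_lil scale_shift rate) auto
    moreover have "0 + 2 * 0 + s * sqrt lyap < (1 - e) * sqrt v"
    proof -
      have "(1 - e) * sqrt v = (\<sigma> + s) / 2 * sqrt lyap"
        unfolding sqrt_v by (simp only: mult.assoc[symmetric] e(2))
      moreover have "s * sqrt lyap < (\<sigma> + s) / 2 * sqrt lyap"
        using s lyap_pos by (intro mult_strict_right_mono) auto
      ultimately show ?thesis by simp
    qed
    ultimately have "\<forall>\<^sub>F n in sequentially. (d * b - ln c) / lil (real n) + 2 * (ln (4 * lyap * real n) / lil (real n))
          + s * (lil (scale (stake n \<omega>) + b) / lil (real n)) < (1 - e) * sqrt v"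
      by (rule order_tendstoD)
    moreover have "\<forall>\<^sub>F n in sequentially. 1 \<le> lil (real n)"
      using filterlim_lil by (simp add: filterlim_at_top)
    moreover have "\<forall>\<^sub>F n in sequentially. scale (stake n \<omega>) / real n < 2 * lyap"
      using rate lyap_pos by (intro order_tendstoD) auto
    moreover have "\<forall>\<^sub>F n in sequentially. exp 1 \<le> scale (stake n \<omega>)"
      using scale_at_top[OF rate] by (simp add: filterlim_at_top)
    ultimately have ev: "\<forall>\<^sub>F n in sequentially. exp 1 \<le> scale (stake n \<omega>) \<and>
        2 * ln (2 * scale (stake n \<omega>)) - ln c + d * b + s * lil (scale (stake n \<omega>) + b) \<le> (1 - e) * sqrt v * lil (real n)"
      using eventually_gt_at_top[of 0]
    proof eventually_elim
      case (elim n)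
      have "0 < scale (stake n \<omega>)" using elim(4) exp_gt_zero[of "1::real"] by linarith
      moreover have "2 * scale (stake n \<omega>) \<le> 4 * lyap * real n" using elim(3,5) by (simp add: field_simps)
      ultimately have "ln (2 * scale (stake n \<omega>)) \<le> ln (4 * lyap * real n)" by (intro ln_mono) auto
      moreover have "((d * b - ln c) / lil (real n) + 2 * (ln (4 * lyap * real n) / lil (real n))
          + s * (lil (scale (stake n \<omega>) + b) / lil (real n))) * lil (real n) \<le> (1 - e) * sqrt v * lil (real n)"
        using elim(1,2) by (intro mult_right_mono) auto
      moreover have "((d * b - ln c) / lil (real n) + 2 * (ln (4 * lyap * real n) / lil (real n))
          + s * (lil (scale (stake n \<omega>) + b) / lil (real n))) * lil (real n)
        = d * b - ln c + 2 * ln (4 * lyap * real n) + s * lil (scale (stake n \<omega>) + b)"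
        using elim(2) by (simp add: distrib_right)
      ultimately show ?case using elim(4) by linarith
    qed
    obtain J where J: "\<And>j n. J \<le> j \<Longrightarrow> stake n \<omega> \<in> cut ((1 / 2) ^ j) \<Longrightarrow>
        measure \<mu> (cball (code \<omega>) ((1 / 2) ^ j)) \<le> (real j)\<^sup>2 * pw (stake n \<omega>)"
      using elim(3) unfolding eventually_sequentially by blast
    have "\<exists>j\<ge>J'. measure \<mu> (cball (code \<omega>) ((1 / 2) ^ j))
      \<le> (2 / 5 * (1 / 2) ^ j) powr d * Theta (2 / 5 * (1 / 2) ^ j) powr (- (\<sigma> - \<epsilon>))" for J'
    proof -
      define J2 where "J2 = max J J' + 1"
      have large: "\<forall>\<^sub>F n in sequentially. real J2 * ln 2 \<le> scale (stake n \<omega>)"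
        using scale_at_top[OF rate] by (simp add: filterlim_at_top)
      have "\<exists>\<^sub>F n in sequentially. real J2 * ln 2 \<le> scale (stake n \<omega>) \<and> exp 1 \<le> scale (stake n \<omega>) \<and>
        fluct (stake n \<omega>) + 2 * ln (2 * scale (stake n \<omega>)) - ln c + d * b + s * lil (scale (stake n \<omega>) + b) \<le> 0"
        by (rule frequently_rev_mp[OF elim(1)]) (use ev large in \<open>eventually_elim, simp add: neg\<close>)
      then obtain n where n: "real J2 * ln 2 \<le> scale (stake n \<omega>)" "exp 1 \<le> scale (stake n \<omega>)"
        "fluct (stake n \<omega>) + 2 * ln (2 * scale (stake n \<omega>)) - ln c + d * b + s * lil (scale (stake n \<omega>) + b) \<le> 0"
        by (auto dest: frequently_ex)
      define w where "w = stake n \<omega>"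
      have w: "set w \<subseteq> I" unfolding w_def by (rule set_stake[OF \<omega>])
      define j where "j = nat \<lfloor>scale w / ln 2\<rfloor>"
      have "real J2 \<le> scale w / ln 2" using n(1) ln2 by (simp add: w_def pos_le_divide_eq)
      then have "J2 \<le> j" "real j \<le> scale w / ln 2" "scale w / ln 2 < real j + 1"
        unfolding j_def by (auto simp: le_nat_floor)
      then have j: "1 \<le> j" "J \<le> j" "J' \<le> j" "real j * ln 2 \<le> scale w" "scale w < (real j + 1) * ln 2"
        using ln2 by (auto simp: J2_def pos_le_divide_eq pos_divide_less_eq)
      have half_pow: "(1 / 2) ^ j = exp (- (real j * ln 2))"
        by (simp add: exp_minus exp_of_nat_mult power_one_over inverse_eq_divide)
      have rat_w: "rat w = exp (- scale w)" using rat_pos[OF w] by (simp add: scale_def)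
      have w_le: "rat w \<le> (1 / 2) ^ j" using j(4) unfolding rat_w half_pow by simp
      have rat_ge: "(1 / 2) ^ j / 2 < rat w"
      proof -
        have "(1 / 2) ^ j / 2 = exp (- ((real j + 1) * ln 2))"
          unfolding half_pow by (simp add: distrib_right exp_diff)
        then show ?thesis using j(5) unfolding rat_w by simp
      qed
      have "(1 / 2 :: real) ^ j < 1" using j(1) by (simp add: power_less_one_iff)
      then obtain n' where n': "stake n' \<omega> \<in> cut ((1 / 2) ^ j)"
        using stake_in_cut[OF \<omega>, of "(1 / 2) ^ j"] by auto
      have "n' \<le> n"
      proof (rule ccontr)
        assume "\<not> n' \<le> n"
        then obtain k where k: "n' = Suc k" "n \<le> k" by (cases n') auto
        have "butlast (stake n' \<omega>) = stake k \<omega>" by (simp only: k stake_Suc butlast_snoc)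
        also have "\<dots> = w @ stake (k - n) (sdrop n \<omega>)" using k by (simp only: stake_add w_def) simp
        finally have "rat (butlast (stake n' \<omega>)) = rat w * rat (stake (k - n) (sdrop n \<omega>))" by simp
        also have "\<dots> \<le> rat w * 1"
          using rat_pos[OF w] by (intro mult_left_mono rat_le_1 set_stake sdrop_streams \<omega>) auto
        finally show False using n' w_le by (simp add: cut_def)
      qed
      define w' z where "w' = stake n' \<omega>" and "z = stake (n - n') (sdrop n' \<omega>)"
      have w_eq: "w = w' @ z" using \<open>n' \<le> n\<close> by (simp only: w_def w'_def z_def stake_add) simp
      have w'z: "set w' \<subseteq> I" "set z \<subseteq> I" using w w_eq by auto
      have "length z \<le> m0"
      proof (rule ccontr)
        assume "\<not> length z \<le> m0"
        then have "rmax ^ length z \<le> rmax ^ m0" using rmax by (intro power_decreasing) auto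
        then have "rat z \<le> 1 / 2" using m0 rat_le[OF w'z(2)] by linarith
        then have "rat w' * rat z \<le> (1 / 2) ^ j * (1 / 2)"
          using n' cut_bounds(2) rat_pos[OF w'z(2)] by (intro mult_mono) (auto simp: w'_def)
        then show False using rat_ge by (simp add: w_eq)
      qed
      then have "c \<le> pmin ^ length z" unfolding c_def using pmin_pos pmin_1 by (intro power_decreasing) auto
      then have "c \<le> pw z" using pw_ge[OF w'z(2)] by linarith
      then have "pw w' * c \<le> pw w" using pw_pos[OF w'z(1)] by (simp add: w_eq)
      then have pw_le: "pw w' \<le> pw w / c" using c by (simp add: pos_le_divide_eq)
      define T where "T = ln (1 / (2 / 5 * (1 / 2 :: real) ^ j))"
      have "T = b + real j * ln 2"
        unfolding T_def b_def by (simp add: ln_div ln_mult ln_realpow)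
      then have T: "scale w \<le> T" "T \<le> scale w + b" using j(4,5) b by (auto simp: distrib_right)
      have lilT: "0 \<le> lil T"
      proof -
        have "exp 1 \<le> T" using T n(2) by (simp add: w_def)
        moreover have "0 < T" using calculation exp_gt_zero[of "1::real"] by linarith
        ultimately show ?thesis unfolding lil_def by (auto intro!: mult_nonneg_nonneg ln_ln_nonneg)
      qed
      have "measure \<mu> (cball (code \<omega>) ((1 / 2) ^ j)) \<le> (real j)\<^sup>2 * pw w'"
        unfolding w'_def by (rule J[OF j(2) n'])
      also have "\<dots> \<le> (real j)\<^sup>2 * (pw w / c)" by (intro mult_left_mono pw_le) auto
      also have "\<dots> = exp (2 * ln (real j) - ln c + fluct w - d * scale w)"
      proof -
        have "exp (2 * ln (real j)) = (real j)\<^sup>2" using j(1) by (simp add: exp_double)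
        moreover have "2 * ln (real j) - ln c + fluct w - d * scale w
            = 2 * ln (real j) + (- ln c + (fluct w - d * scale w))" by simp
        ultimately show ?thesis
          using c by (simp only: exp_add pw_eq_exp[OF w] exp_minus exp_ln) (simp add: field_simps)
      qed
      also have "\<dots> \<le> exp (- d * T - (\<sigma> - \<epsilon>) * lil T)"
      proof -
        have "real j \<le> 2 * scale w"
        proof -
          have "real j * (1 / 2) \<le> real j * ln 2" using ln2 by (intro mult_left_mono) auto
          then show ?thesis using j(4) by linarith
        qed
        then have "ln (real j) \<le> ln (2 * scale w)" using j(1) by (intro ln_mono) auto
        moreover have "(\<sigma> - \<epsilon>) * lil T \<le> s * lil T" using s lilT by (intro mult_right_mono) auto
        moreover have "s * lil T \<le> s * lil (scale w + b)"
          using s T n(2) by (intro mult_left_mono lil_mono) (auto simp: w_def)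
        moreover have "d * T \<le> d * (scale w + b)" using T d_pos by (intro mult_left_mono) auto
        moreover have "d * (scale w + b) = d * scale w + d * b" by (simp add: distrib_left)
        ultimately show ?thesis using n(3) unfolding w_def[symmetric] by simp
      qed
      also have "\<dots> = (2 / 5 * (1 / 2) ^ j) powr d * Theta (2 / 5 * (1 / 2) ^ j) powr (- (\<sigma> - \<epsilon>))"
        unfolding T_def by (rule gauge_exp_form[symmetric]) simp
      finally show ?thesis using j(3) by blast
    qed
    then show ?case unfolding frequently_sequentially by blast
  qed
qed

end

section \<open>Comparison with packing measures\<close>

context lil_ifs
begin

lemma AE_code_transfer:
  assumes "G \<in> sets borel" "AE \<omega> in M. code \<omega> \<in> G"
  shows "AE x in \<mu>. x \<in> G"
  unfolding \<mu>_def using assms by (subst AE_distr_iff) auto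

text \<open>Balls of radius \<open>(2 powr - j) / 5\<close> are those whose fivefold enlargements \<open>mass_ball_upper\<close>
  controls.\<close>

theorem abs_cont_packing_\<mu>:
  assumes \<epsilon>: "0 < \<epsilon>"
  shows "abs_cont_packing \<mu> (\<lambda>t. t powr d * Theta t powr (- (\<sigma> - \<epsilon>)))"
proof -
  interpret \<mu>: prob_space \<mu> using self_similar_\<mu> by (simp add: self_similar_def)
  have sets: "sets \<mu> = sets borel" by (simp add: \<mu>_def)
  define \<Psi> where "\<Psi> t = t powr d * Theta t powr (- (\<sigma> - \<epsilon>))" for t
  define G where "G = {x. \<exists>\<^sub>F j in sequentially. measure \<mu> (cball x ((1 / 2) ^ j)) \<le> \<Psi> (2 / 5 * (1 / 2) ^ j)}"
  have "G \<in> sets borel"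
  proof -
    have [measurable]: "(\<lambda>x. measure \<mu> (cball x ((1 / 2) ^ j))) \<in> borel_measurable borel" for j :: nat
      by (rule borel_measurable_mass_cball[OF \<mu>.finite_measure_axioms sets])
    have "{x \<in> space borel. \<forall>N. \<exists>j\<in>{N..}. measure \<mu> (cball x ((1 / 2) ^ j)) \<le> \<Psi> (2 / 5 * (1 / 2) ^ j)} \<in> sets borel"
      by measurable
    then show ?thesis by (simp add: G_def frequently_sequentially Bex_def)
  qed
  moreover have "AE \<omega> in M. code \<omega> \<in> G"
    using mass_ball_upper[OF \<epsilon>] by (simp add: G_def \<Psi>_def)
  ultimately have G: "AE x in \<mu>. x \<in> G" by (rule AE_code_transfer)
  have ball: "\<exists>\<rho>>0. \<rho> \<le> \<eta> \<and> emeasure \<mu> (cball x (5 * \<rho>)) \<le> ennreal (\<Psi> (2 * \<rho>))"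
    if x: "x \<in> G" and \<eta>: "0 < \<eta>" for x \<eta>
  proof -
    have "(\<lambda>j. (1 / 2 :: real) ^ j / 5) \<longlonglongrightarrow> 0" by real_asymp
    then have "\<forall>\<^sub>F j in sequentially. (1 / 2 :: real) ^ j / 5 < \<eta>" using \<eta> by (intro order_tendstoD)
    with x have "\<exists>\<^sub>F j in sequentially. measure \<mu> (cball x ((1 / 2) ^ j)) \<le> \<Psi> (2 / 5 * (1 / 2) ^ j) \<and> (1 / 2 :: real) ^ j / 5 < \<eta>"
      unfolding G_def by (auto elim: frequently_rev_mp elim!: eventually_mono)
    then obtain j where j: "measure \<mu> (cball x ((1 / 2) ^ j)) \<le> \<Psi> (2 / 5 * (1 / 2) ^ j)" "(1 / 2 :: real) ^ j / 5 < \<eta>"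
      by (auto dest: frequently_ex)
    show ?thesis
    proof (intro exI[of _ "(1 / 2) ^ j / 5"] conjI)
      show "emeasure \<mu> (cball x (5 * ((1 / 2) ^ j / 5))) \<le> ennreal (\<Psi> (2 * ((1 / 2) ^ j / 5)))"
        using j(1) by (simp add: \<mu>.emeasure_eq_measure ennreal_leI)
    qed (use j(2) in auto)
  qed
  show ?thesis
    unfolding abs_cont_packing_def \<Psi>_def[symmetric]
  proof (intro ballI impI)
    fix E :: "'a set" assume "E \<in> sets borel" "packing_measure \<Psi> E = 0"
    then have "emeasure \<mu> E = 0" by (intro null_if_packing_null[OF sets G ball])
    then show "measure \<mu> E = 0" by (simp add: measure_def)
  qed
qed

text \<open>The sets \<open>E n\<close> on which the bound of \<open>mass_ball_lower\<close> with \<open>\<epsilon> / 2\<close> holds below radius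
  \<open>1 / (n + 1)\<close> have finite premeasure for the gauge with \<open>\<epsilon> / 2\<close>, hence premeasure zero for the
  gauge with \<open>\<epsilon>\<close>.\<close>

theorem singular_packing_\<mu>:
  assumes \<epsilon>: "0 < \<epsilon>"
  shows "singular_packing \<mu> (\<lambda>t. t powr d * Theta t powr (- (\<sigma> + \<epsilon>)))"
proof -
  interpret \<mu>: prob_space \<mu> using self_similar_\<mu> by (simp add: self_similar_def)
  have sets: "sets \<mu> = sets borel" by (simp add: \<mu>_def)
  define \<Psi> where "\<Psi> t = t powr d * Theta t powr (- (\<sigma> + \<epsilon>))" for t
  define \<Psi>' where "\<Psi>' t = t powr d * Theta t powr (- (\<sigma> + \<epsilon> / 2))" for t
  define E where "E n = (\<Inter>\<rho>\<in>{0<..<inverse (real (Suc n))}. {x. \<Psi>' (2 * \<rho>) \<le> measure \<mu> (cball x \<rho>)})" for n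
  have "closed (E n)" for n
    unfolding E_def by (intro closed_INT ballI closed_mass_cball_ge \<mu>.finite_measure_axioms sets)
  then have E_borel: "(\<Union>n. E n) \<in> sets borel" by (intro sets.countable_UN) auto
  have "0 < \<epsilon> / 2" using \<epsilon> by simp
  from mass_ball_lower[OF this] have "AE \<omega> in M. code \<omega> \<in> (\<Union>n. E n)"
  proof eventually_elim
    case (elim \<omega>)
    then obtain \<rho>0 where \<rho>0: "0 < \<rho>0"
        "\<And>\<rho>. 0 < \<rho> \<Longrightarrow> \<rho> < \<rho>0 \<Longrightarrow> \<Psi>' (2 * \<rho>) \<le> measure \<mu> (cball (code \<omega>) \<rho>)"
      unfolding \<Psi>'_def by blast
    obtain n where n: "inverse (real (Suc n)) < \<rho>0" using reals_Archimedean[OF \<rho>0(1)] by blast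
    have "\<Psi>' (2 * \<rho>) \<le> measure \<mu> (cball (code \<omega>) \<rho>)" if "\<rho> \<in> {0<..<inverse (real (Suc n))}" for \<rho>
    proof (rule \<rho>0(2))
      show "0 < \<rho>" "\<rho> < \<rho>0" using that n by (auto simp only: greaterThanLessThan_iff)
    qed
    then have "code \<omega> \<in> E n" unfolding E_def by blast
    then show ?case by blast
  qed
  then have "AE x in \<mu>. x \<in> (\<Union>n. E n)" by (rule AE_code_transfer[OF E_borel])
  then have "measure \<mu> (\<Union>n. E n) = 1" using E_borel sets by (simp add: \<mu>.prob_eq_1)
  moreover have "packing_measure \<Psi> (\<Union>n. E n) = 0"
  proof -
    have "packing_premeasure \<Psi> (E n) = 0" for n
    proof (rule packing_premeasure_smaller_gauge)
      have "packing_premeasure \<Psi>' (E n) \<le> emeasure \<mu> (space \<mu>)"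
        by (rule packing_premeasure_le_mass[where R="inverse (real (Suc n))"])
          (auto simp: E_def sets intro: \<mu>.finite_measure_axioms)
      then show "packing_premeasure \<Psi>' (E n) < \<infinity>"
        using \<mu>.emeasure_space_1 by (simp add: le_less_trans)
      show "\<forall>\<^sub>F t in at_right 0. \<Psi> t \<le> e * \<Psi>' t" if "0 < e" for e
        unfolding \<Psi>_def \<Psi>'_def using \<epsilon> that by (intro gauge_small) auto
      show "\<forall>\<^sub>F t in at_right 0. 0 \<le> \<Psi>' t" by (simp add: \<Psi>'_def)
    qed
    then have "(\<Sum>n. packing_premeasure \<Psi> (E n)) = 0" by simp
    moreover have "packing_measure \<Psi> (\<Union>n. E n) \<le> (\<Sum>n. packing_premeasure \<Psi> (E n))"
      unfolding packing_measure_def by (rule INF_lower) simp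
    ultimately show ?thesis by simp
  qed
  ultimately show ?thesis
    unfolding singular_packing_def \<Psi>_def[symmetric] using E_borel by blast
qed

text \<open>The gauge with \<open>\<epsilon> = \<sigma> / 2\<close> is of smaller order than \<open>t powr d\<close>.\<close>

theorem null_if_finite_packing:
  assumes E: "E \<in> sets borel" and fin: "packing_measure (\<lambda>t. t powr d) E < \<infinity>"
  shows "measure \<mu> E = 0"
proof -
  have "packing_measure (\<lambda>t. t powr d * Theta t powr (- (\<sigma> - \<sigma> / 2))) E = 0"
  proof (rule packing_measure_smaller_gauge[OF fin])
    show "\<forall>\<^sub>F t in at_right 0. t powr d * Theta t powr (- (\<sigma> - \<sigma> / 2)) \<le> e * t powr d" if "0 < e" for e
      using gauge_small[of 0 "\<sigma> - \<sigma> / 2" e d] \<sigma>_pos that by (simp add: Theta_def)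
  qed simp
  moreover have "abs_cont_packing \<mu> (\<lambda>t. t powr d * Theta t powr (- (\<sigma> - \<sigma> / 2)))"
    using \<sigma>_pos by (intro abs_cont_packing_\<mu>) auto
  ultimately show ?thesis using E by (simp add: abs_cont_packing_def)
qed

end

section \<open>The dichotomy for packing measures\<close>

theorem theorem3p5:
  fixes S :: "nat \<Rightarrow> 'a::euclidean_space \<Rightarrow> 'a"
    and r p :: "nat \<Rightarrow> real"
    and k :: nat
    and K :: "'a set"
    and m :: "'a measure"
    and \<delta> d \<sigma> :: real
  assumes sim: "\<forall>i\<in>{1..k}. 0 < r i \<and> r i < 1 \<and> similarity (r i) (S i)"
    and attr: "attractor k S K"
    and osc: "open_set_condition k S"
    and delta: "\<delta> = hausdorff_dim K"
    and p_pos: "\<forall>i\<in>{1..k}. 0 < p i"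
    and p_sum: "(\<Sum>i=1..k. p i) = 1"
    and m: "self_similar_measure k p S m"
    and d: "d = (\<Sum>i=1..k. p i * ln (p i)) / (\<Sum>i=1..k. p i * ln (r i))"
    and sigma: "\<sigma> \<ge> 0"
      "\<sigma>\<^sup>2 = (\<Sum>i=1..k. p i * (ln (p i) - d * ln (r i))\<^sup>2) / - (\<Sum>i=1..k. p i * ln (r i))"
  shows
    "(2 \<le> k \<longrightarrow> 0 < \<delta> \<and> (\<Sum>i=1..k. r i powr \<delta>) = 1 \<and>
        (\<forall>s>0. (\<Sum>i=1..k. r i powr s) = 1 \<longrightarrow> s = \<delta>)) \<and>
     (d \<noteq> \<delta> \<longleftrightarrow> \<sigma> > 0) \<and>
     (d \<noteq> \<delta> \<longrightarrow>
        (\<forall>\<epsilon>>0. abs_cont_packing m (\<lambda>t. t powr d * Theta t powr (- (\<sigma> - \<epsilon>))) \<and>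
               singular_packing m (\<lambda>t. t powr d * Theta t powr (- (\<sigma> + \<epsilon>)))) \<and>
        (\<forall>E\<in>sets borel. packing_measure (\<lambda>t. t powr d) E < \<infinity> \<longrightarrow> measure m E = 0))"
proof -
  have "compact K \<and> K \<noteq> {} \<and> K = (\<Union>i\<in>{1..k}. S i ` K)"
    using attr unfolding attractor_def .
  note K = conjunct1[OF this] conjunct1[OF conjunct2[OF this]] conjunct2[OF conjunct2[OF this]]
  have "{1..k} \<noteq> {}" using K(2,3) by (metis UN_empty)
  then have "1 \<le> k" by simp
  obtain U where U: "U \<noteq> {}" "bounded U" "open U" "(\<Union>i\<in>{1..k}. S i ` U) \<subseteq> U"
      "\<forall>i\<in>{1..k}. \<forall>j\<in>{1..k}. i \<noteq> j \<longrightarrow> S i ` U \<inter> S j ` U = {}"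
    using osc unfolding open_set_condition_def by blast
  have rr: "0 < r i \<and> r i < 1" if "i \<in> {1..k}" for i using sim that by blast
  have osc_ifsI: "osc_ifs {1..k} q S r K U" if "\<And>i. i \<in> {1..k} \<Longrightarrow> 0 < q i" "(\<Sum>i=1..k. q i) = 1" for q
  proof unfold_locales
    show "K = (\<Union>i\<in>{1..k}. S i ` K)" by (rule K)
    show "S i ` U \<subseteq> U" if "i \<in> {1..k}" for i using U(4) that by blast
    show "S i ` U \<inter> S j ` U = {}" if "i \<in> {1..k}" "j \<in> {1..k}" "i \<noteq> j" for i j using U(5) that by blast
  qed (use that sim K U \<open>{1..k} \<noteq> {}\<close> in auto)
  interpret osc_ifs "{1..k}" p S r K U
    using p_pos p_sum by (intro osc_ifsI) auto
  have "self_similar m"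
    using m unfolding self_similar_measure_def self_similar_def .
  then have m_eq: "m = \<mu>" by (rule self_similar_unique)
  show ?thesis
  proof (cases "2 \<le> k")
    case True
    then have card: "2 \<le> card {1..k}" by simp
    obtain s where s: "0 < s" "(\<Sum>i=1..k. r i powr s) = 1"
      using moran_exponent_exists[OF finite_atLeastAtMost card, of r] rr by blast
    \<comment> \<open>the dimension is computed with the natural weights \<open>r i powr s\<close>\<close>
    interpret D: osc_ifs "{1..k}" "\<lambda>i. r i powr s" S r K U
      using rr s by (intro osc_ifsI) (auto simp: less_imp_neq[symmetric])
    have \<delta>: "\<delta> = s" unfolding delta by (rule D.hausdorff_dim_attractor) (use s in auto)
    have unique: "t = \<delta>" if "(\<Sum>i=1..k. r i powr t) = 1" for t
      using moran_sum_strict_anti[of "{1..k}" r t s] moran_sum_strict_anti[of "{1..k}" r s t]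
        \<open>{1..k} \<noteq> {}\<close> rr s that \<delta> by (cases t s rule: linorder_cases) auto
    have d_pos: "0 < d"
      unfolding d using p_pos p_sum rr by (intro entropy_quotient_pos card) auto
    have "(\<Sum>i=1..k. p i * ln (r i)) \<noteq> 0" using d_pos d by auto
    then have "\<sigma>\<^sup>2 = 0 \<longleftrightarrow> (\<Sum>i=1..k. p i * (ln (p i) - d * ln (r i))\<^sup>2) = 0"
      unfolding sigma(2) by simp
    also have "\<dots> \<longleftrightarrow> d = \<delta>"
      unfolding \<delta> using p_pos p_sum rr s d by (intro variance_zero_iff card) auto
    finally have \<sigma>: "d \<noteq> \<delta> \<longleftrightarrow> \<sigma> > 0" using sigma(1) by auto
    have "(\<forall>\<epsilon>>0. abs_cont_packing m (\<lambda>t. t powr d * Theta t powr (- (\<sigma> - \<epsilon>))) \<and>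
               singular_packing m (\<lambda>t. t powr d * Theta t powr (- (\<sigma> + \<epsilon>)))) \<and>
        (\<forall>E\<in>sets borel. packing_measure (\<lambda>t. t powr d) E < \<infinity> \<longrightarrow> measure m E = 0)" if "d \<noteq> \<delta>"
    proof -
      interpret lil_ifs "{1..k}" p S r K U d \<sigma>
        using d d_pos \<sigma> that sigma(2) by unfold_locales auto
      show ?thesis
        unfolding m_eq using abs_cont_packing_\<mu> singular_packing_\<mu> null_if_finite_packing by blast
    qed
    then show ?thesis using s \<delta> unique \<sigma> by blast
  next
    \<comment> \<open>a single map: \<open>K\<close> is a point and \<open>d = \<delta> = 0\<close>\<close>
    case False
    with \<open>1 \<le> k\<close> have k: "k = 1" by simp
    have dim: "0 \<le> \<delta> \<and> \<delta> \<le> s" if "0 < s" for s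
    proof -
      have "1 \<in> {1..k}" using \<open>1 \<le> k\<close> by simp
      then have "r 1 powr s < 1 powr s" using rr[of 1] that by (intro powr_less_mono2) auto
      moreover have "(\<Sum>i=1..k. r i powr s) = r 1 powr s" by (simp only: k atLeastAtMost_singleton sum.insert) simp
      ultimately have "(\<Sum>i=1..k. r i powr s) < 1" by simp
      then show ?thesis unfolding delta using that by (intro hausdorff_dim_nonneg_le)
    qed
    have "\<delta> \<le> 0" by (rule dense_ge) (use dim in blast)
    then have "\<delta> = 0" using dim[of 1] by simp
    moreover have "p 1 = 1" using p_sum k by simp
    then have "d = 0" "\<sigma>\<^sup>2 = 0" using d sigma(2) k by simp_all
    ultimately show ?thesis using False by simp
  qed
qed

end
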